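(* Let $\rho_0$ be a Borel probability measure on $\mathbb{R}$ with $\int_{\mathbb{R}}x^2\,d\rho_0(x)<\infty$ and let $v_0:\mathbb{R}\to\mathbb{R}$ be absolutely continuous. Then there is a Lipschitz continuous $X:[0,\infty)\to L^2(\rho_0)$ which satisfies the Euler-Poisson flow equation $$\dot X(t)=\mathbb{E}_{\rho_0}\left[v_0-\int_0^t(\mathrm{sgn}*\rho_s)(X(s))\,ds\,\Big|\,X(t)\right]\quad\text{for a.e. }t\ge0,\qquad \rho_s:=X(s)_{\#}\rho_0,$$ and the initial condition $X(0)=\mathrm{id}_{\mathbb{R}}$ $\rho_0$-almost everywhere. Moreover, $X$ has the following properties. (i) For Lebesgue almost every $t,s\in[0,\infty)$ with $s\le t$, $E(t)\le E(s)$, where $$E(\tau):=\int_{\mathbb{R}}\frac12\dot X(\tau)^2\,d\rho_0+\int_{\mathbb{R}}\int_{\mathbb{R}}\frac12|X(y,\tau)-X(z,\tau)|\,d\rho_0(y)\,d\rho_0(z).$$ (ii) For $t\ge0$ and $y,z\in\mathrm{supp}(\rho_0)$ with $y\ge z$, $$0\le X(y,t)-X(z,t)\le y-z+t\int_z^y|v_0'(x)|\,dx.$$ (iii) For $0<s\le t$ and $y,z\in\mathrm{supp}(\rho_0)$, $$\frac1t|X(y,t)-X(z,t)|\le\frac1s|X(y,s)-X(z,s)|.$$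
   Context: Absolute continuity of $v_0$ on $\mathbb{R}$ is meant in the usual $\varepsilon$-$\delta$ sense on the whole line: for each $\varepsilon>0$ there is $\delta>0$ such that $\sum_i|v_0(b_i)-v_0(a_i)|<\varepsilon$ for every finite family of disjoint intervals $(a_i,b_i)$ with $\sum_i(b_i-a_i)<\delta$; $v_0'$ is its a.e. derivative. $\mathrm{sgn}(x)=1$ for $x>0$, $\mathrm{sgn}(0)=0$, $\mathrm{sgn}(x)=-1$ for $x<0$; $(\mathrm{sgn}*\rho_s)(x)=\int_{\mathbb{R}}\mathrm{sgn}(x-y)\,d\rho_s(y)$. $\dot X(t)=\lim_{\tau\to0}\frac{X(t+\tau)-X(t)}{\tau}$ in $L^2(\rho_0)$, which exists for a.e. $t>0$ since $X$ is Lipschitz. Each $X(t)$ is regarded as a function $X(t):\mathbb{R}\to\mathbb{R}$, $y\mapsto X(y,t)$; pointwise statements concern this chosen representative of the class in $L^2(\rho_0)$. $X(t)_{\#}\rho_0$ is the push-forward measure, and $\mathrm{supp}(\rho_0)=\{y:\rho_0((y-\delta,y+\delta))>0\text{ for all }\delta>0\}$. For $g\in L^2(\rho_0)$ and Borel $Y:\mathbb{R}\to\mathbb{R}$, $\mathbb{E}_{\rho_0}[g|Y]$ is the ($\rho_0$-a.e. unique) element of $L^2(\rho_0)$ such that $\int \mathbb{E}_{\rho_0}[g|Y]\,h(Y)\,d\rho_0=\int g\,h(Y)\,d\rho_0$ for every Borel $h$ with $h(Y)\in L^2(\rho_0)$, and $\mathbb{E}_{\rho_0}[g|Y]=f(Y)$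 $\rho_0$-a.e. for some Borel $f:\mathbb{R}\to\mathbb{R}$. *)

theory Defs
  imports "HOL-Probability.Probability"
begin

definition abs_continuous :: "(real \<Rightarrow> real) \<Rightarrow> bool" where
  "abs_continuous v \<longleftrightarrow>
     (\<forall>\<epsilon>>0. \<exists>\<delta>>0. \<forall>(n::nat) a b.
        (\<forall>i<n. a i < b i) \<and> disjoint_family_on (\<lambda>i. {a i<..<b i}) {..<n} \<and>
        (\<Sum>i<n. b i - a i) < \<delta> \<longrightarrow> (\<Sum>i<n. \<bar>v (b i) - v (a i)\<bar>) < \<epsilon>)"

definition msupp :: "real measure \<Rightarrow> real set" where
  "msupp \<mu> = {y. \<forall>\<delta>>0. measure \<mu> {y - \<delta><..<y + \<delta>} > 0}"

definition sgn_conv :: "real measure \<Rightarrow> real \<Rightarrow> real" where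
  "sgn_conv \<mu> x = (LINT y|\<mu>. sgn (x - y))"

text \<open>Elements of L2 are represented by functions; equality of classes is equality almost
  everywhere. A curve in L2 is a function \<open>X\<close> with \<open>X t y\<close> the value at the point \<open>y\<close> of the
  chosen representative at time \<open>t\<close>; only \<open>t \<ge> 0\<close> matters.\<close>

definition L2 :: "real measure \<Rightarrow> (real \<Rightarrow> real) set" where
  "L2 \<mu> = {f \<in> borel_measurable \<mu>. integrable \<mu> (\<lambda>y. (f y)\<^sup>2)}"

definition L2norm :: "real measure \<Rightarrow> (real \<Rightarrow> real) \<Rightarrow> real" where
  "L2norm \<mu> f = sqrt (LINT y|\<mu>. (f y)\<^sup>2)"

definition L2_lipschitz :: "real measure \<Rightarrow> (real \<Rightarrow> real \<Rightarrow> real) \<Rightarrow> bool" where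
  "L2_lipschitz \<mu> X \<longleftrightarrow>
     (\<forall>t\<ge>0. X t \<in> L2 \<mu>) \<and>
     (\<exists>C\<ge>0. \<forall>s\<ge>0. \<forall>t\<ge>0. L2norm \<mu> (\<lambda>y. X t y - X s y) \<le> C * \<bar>t - s\<bar>)"

definition has_L2_deriv ::
    "real measure \<Rightarrow> (real \<Rightarrow> real \<Rightarrow> real) \<Rightarrow> real \<Rightarrow> (real \<Rightarrow> real) \<Rightarrow> bool" where
  "has_L2_deriv \<mu> X t V \<longleftrightarrow>
     V \<in> L2 \<mu> \<and>
     ((\<lambda>\<tau>. L2norm \<mu> (\<lambda>y. (X (t + \<tau>) y - X t y) / \<tau> - V y)) \<longlongrightarrow> 0) (at 0)"

text \<open>A representative of the derivative class, meaningful when the derivative exists. By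
  \<open>has_L2_deriv_unique\<close> below, integrals of it do not depend on the choice.\<close>

definition L2_deriv :: "real measure \<Rightarrow> (real \<Rightarrow> real \<Rightarrow> real) \<Rightarrow> real \<Rightarrow> (real \<Rightarrow> real)" where
  "L2_deriv \<mu> X t = (SOME V. has_L2_deriv \<mu> X t V)"

definition cond_exp_given ::
    "real measure \<Rightarrow> (real \<Rightarrow> real) \<Rightarrow> (real \<Rightarrow> real) \<Rightarrow> (real \<Rightarrow> real)" where
  "cond_exp_given \<mu> g Y = real_cond_exp \<mu> (vimage_algebra (space \<mu>) Y borel) g"

definition EP_force :: "real measure \<Rightarrow> (real \<Rightarrow> real \<Rightarrow> real) \<Rightarrow> real \<Rightarrow> real \<Rightarrow> real" where
  "EP_force \<mu> X s y = sgn_conv (distr \<mu> borel (X s)) (X s y)"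

definition EP_free_velocity ::
    "real measure \<Rightarrow> (real \<Rightarrow> real) \<Rightarrow> (real \<Rightarrow> real \<Rightarrow> real) \<Rightarrow> real \<Rightarrow> real \<Rightarrow> real" where
  "EP_free_velocity \<mu> v X t y = v y - (LINT s:{0..t}|lborel. EP_force \<mu> X s y)"

text \<open>The first two conjuncts say that the time integral and the conditional expectation in the
  flow equation are well defined, as Bochner integrals have a default value otherwise.\<close>

definition EP_flow_at ::
    "real measure \<Rightarrow> (real \<Rightarrow> real) \<Rightarrow> (real \<Rightarrow> real \<Rightarrow> real) \<Rightarrow> real \<Rightarrow> bool" where
  "EP_flow_at \<mu> v X t \<longleftrightarrow>
     (AE y in \<mu>. set_integrable lborel {0..t} (\<lambda>s. EP_force \<mu> X s y)) \<and>
     EP_free_velocity \<mu> v X t \<in> L2 \<mu> \<and>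
     has_L2_deriv \<mu> X t (cond_exp_given \<mu> (EP_free_velocity \<mu> v X t) (X t))"

definition EP_energy :: "real measure \<Rightarrow> (real \<Rightarrow> real \<Rightarrow> real) \<Rightarrow> real \<Rightarrow> real" where
  "EP_energy \<mu> X \<tau> =
     (LINT y|\<mu>. 1/2 * (L2_deriv \<mu> X \<tau> y)\<^sup>2) +
     (LINT z|\<mu>. LINT y|\<mu>. 1/2 * \<bar>X \<tau> y - X \<tau> z\<bar>)"

lemma L2_diff:
  assumes "f \<in> L2 \<mu>" "g \<in> L2 \<mu>"
  shows "(\<lambda>y. f y - g y) \<in> L2 \<mu>"
proof -
  have [measurable]: "f \<in> borel_measurable \<mu>" "g \<in> borel_measurable \<mu>"
    and i: "integrable \<mu> (\<lambda>y. (f y)\<^sup>2)" "integrable \<mu> (\<lambda>y. (g y)\<^sup>2)"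
    using assms by (auto simp: L2_def)
  have "integrable \<mu> (\<lambda>y. (f y - g y)\<^sup>2)"
  proof (rule Bochner_Integration.integrable_bound[where f="\<lambda>y. 2 * (f y)\<^sup>2 + 2 * (g y)\<^sup>2"])
    show "integrable \<mu> (\<lambda>y. 2 * (f y)\<^sup>2 + 2 * (g y)\<^sup>2)" using i by simp
    have "(a - b)\<^sup>2 \<le> 2 * a\<^sup>2 + 2 * b\<^sup>2" for a b :: real
      using zero_le_power2[of "a + b"] by (simp add: power2_eq_square algebra_simps)
    then show "AE y in \<mu>. norm ((f y - g y)\<^sup>2) \<le> norm (2 * (f y)\<^sup>2 + 2 * (g y)\<^sup>2)" by simp
  qed measurable
  then show ?thesis by (simp add: L2_def)
qed

lemma has_L2_deriv_unique:
  assumes lip: "L2_lipschitz \<mu> X" and t: "t > 0"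
    and V: "has_L2_deriv \<mu> X t V" and W: "has_L2_deriv \<mu> X t W"
  shows "AE y in \<mu>. V y = W y"
proof -
  have VW: "V \<in> L2 \<mu>" "W \<in> L2 \<mu>" using V W by (auto simp: has_L2_deriv_def)
  have XL: "\<And>s. s \<ge> 0 \<Longrightarrow> X s \<in> L2 \<mu>" using lip by (auto simp: L2_lipschitz_def)
  define q where "q \<tau> y = (X (t + \<tau>) y - X t y) / \<tau>" for \<tau> y
  define I where "I U \<tau> = (LINT y|\<mu>. (q \<tau> y - U y)\<^sup>2)" for U \<tau>
  have qL: "q \<tau> \<in> L2 \<mu>" if "t + \<tau> \<ge> 0" for \<tau>
  proof -
    have "(\<lambda>y. X (t + \<tau>) y - X t y) \<in> L2 \<mu>" using XL that t by (intro L2_diff) auto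
    then show ?thesis unfolding L2_def q_def by (auto simp: power_divide)
  qed
  have "((\<lambda>\<tau>. (sqrt (I U \<tau>))\<^sup>2) \<longlongrightarrow> 0\<^sup>2) (at 0)" if "has_L2_deriv \<mu> X t U" for U
    using that by (intro tendsto_power) (simp add: has_L2_deriv_def L2norm_def I_def q_def)
  moreover have "I U \<tau> \<ge> 0" for U \<tau> by (simp add: I_def)
  ultimately have "((\<lambda>\<tau>. I U \<tau>) \<longlongrightarrow> 0) (at 0)" if "has_L2_deriv \<mu> X t U" for U
    using that by simp
  then have lim: "((\<lambda>\<tau>. 2 * I V \<tau> + 2 * I W \<tau>) \<longlongrightarrow> 2 * 0 + 2 * 0) (at 0)"
    using V W by (intro tendsto_intros)
  have le: "(LINT y|\<mu>. (V y - W y)\<^sup>2) \<le> 2 * I V \<tau> + 2 * I W \<tau>" if "t + \<tau> \<ge> 0" for \<tau>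
  proof -
    have i: "integrable \<mu> (\<lambda>y. (q \<tau> y - V y)\<^sup>2)" "integrable \<mu> (\<lambda>y. (q \<tau> y - W y)\<^sup>2)"
      using L2_diff[OF qL[OF that] VW(1)] L2_diff[OF qL[OF that] VW(2)] by (auto simp: L2_def)
    have "(LINT y|\<mu>. (V y - W y)\<^sup>2) \<le>
          (LINT y|\<mu>. 2 * (q \<tau> y - V y)\<^sup>2 + 2 * (q \<tau> y - W y)\<^sup>2)"
    proof (rule integral_mono)
      show "integrable \<mu> (\<lambda>y. (V y - W y)\<^sup>2)" using L2_diff[OF VW] by (simp add: L2_def)
      have "(b - c)\<^sup>2 \<le> 2 * (a - b)\<^sup>2 + 2 * (a - c)\<^sup>2" for a b c :: real
        using zero_le_power2[of "(a - b) + (a - c)"]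
        by (simp add: power2_eq_square algebra_simps)
      then show "(V y - W y)\<^sup>2 \<le> 2 * (q \<tau> y - V y)\<^sup>2 + 2 * (q \<tau> y - W y)\<^sup>2" for y .
    qed (use i in simp)
    also have "\<dots> = 2 * I V \<tau> + 2 * I W \<tau>" using i by (simp add: I_def)
    finally show ?thesis .
  qed
  have "eventually (\<lambda>\<tau>. t + \<tau> \<ge> 0) (at 0)"
    unfolding eventually_at using t by (intro exI[of _ t]) (auto simp: dist_real_def)
  then have "eventually (\<lambda>\<tau>. (LINT y|\<mu>. (V y - W y)\<^sup>2) \<le> 2 * I V \<tau> + 2 * I W \<tau>) (at 0)"
    by eventually_elim (rule le)
  with lim have "(LINT y|\<mu>. (V y - W y)\<^sup>2) \<le> 2 * 0 + 2 * 0"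
    by (rule tendsto_lowerbound) simp
  then have "(LINT y|\<mu>. (V y - W y)\<^sup>2) = 0" by (simp add: antisym)
  then have "AE y in \<mu>. (V y - W y)\<^sup>2 = 0"
    using L2_diff[OF VW] by (subst (asm) integral_nonneg_eq_0_iff_AE) (auto simp: L2_def)
  then show ?thesis by simp
qed

text \<open>The variational description of the conditional expectation of \<open>g\<close> given \<open>Y\<close> in L2
  agrees with the library notion.\<close>

lemma cond_exp_given_charact:
  assumes "prob_space \<mu>" and sets: "sets \<mu> = sets borel"
    and Y: "Y \<in> borel_measurable borel" and g: "g \<in> L2 \<mu>" and e: "e \<in> L2 \<mu>"
    and test: "\<And>h. h \<in> borel_measurable borel \<Longrightarrow> (\<lambda>y. h (Y y)) \<in> L2 \<mu> \<Longrightarrow>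
        (LINT y|\<mu>. e y * h (Y y)) = (LINT y|\<mu>. g y * h (Y y))"
    and f: "f \<in> borel_measurable borel" "AE y in \<mu>. e y = f (Y y)"
  shows "AE y in \<mu>. cond_exp_given \<mu> g Y y = e y"
proof -
  interpret prob_space \<mu> by fact
  have sp: "space \<mu> = UNIV" using sets_eq_imp_space_eq[OF sets] by simp
  let ?F = "vimage_algebra (space \<mu>) Y borel"
  have Ym [measurable]: "Y \<in> borel_measurable \<mu>"
    using Y measurable_cong_sets[OF sets refl] by blast
  have sub: "subalgebra \<mu> ?F"
    unfolding subalgebra_def by (auto simp: sets_vimage_algebra2 intro: measurable_sets[OF Ym])
  interpret finite_measure_subalgebra \<mu> ?F by unfold_locales (rule sub)
  have em [measurable]: "e \<in> borel_measurable \<mu>" "g \<in> borel_measurable \<mu>"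
    and ei: "integrable \<mu> e" "integrable \<mu> g"
    using e g by (auto simp: L2_def intro: square_integrable_imp_integrable)
  have fY: "(\<lambda>y. f (Y y)) \<in> borel_measurable ?F"
    by (rule measurable_compose[OF measurable_vimage_algebra1 f(1)]) auto
  have fYm [measurable]: "(\<lambda>y. f (Y y)) \<in> borel_measurable \<mu>"
    by (rule measurable_from_subalg[OF sub fY])
  have "AE y in \<mu>. real_cond_exp \<mu> ?F g y = f (Y y)"
  proof (rule real_cond_exp_charact)
    show "integrable \<mu> (\<lambda>y. f (Y y))"
      using ei(1) integrable_cong_AE[OF em(1) fYm f(2)] by simp
    fix A assume "A \<in> sets ?F"
    then obtain B where B: "B \<in> sets borel" "A = Y -` B \<inter> space \<mu>"
      by (auto simp: sets_vimage_algebra2)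
    have ind: "indicator A y = (indicator B (Y y) :: real)" for y
      using B sp by (auto simp: indicator_def)
    have A: "A \<in> sets \<mu>" using B Ym by (auto intro: measurable_sets)
    have "(\<lambda>y. indicator B (Y y) :: real) \<in> L2 \<mu>"
      using A unfolding ind[symmetric] L2_def
      by (auto simp: power2_eq_square simp flip: indicator_inter_arith
          intro!: integrable_real_indicator simp: less_top[symmetric])
    moreover have "(indicator B :: real \<Rightarrow> real) \<in> borel_measurable borel" using B by simp
    ultimately have eq: "(LINT y|\<mu>. e y * indicator A y) = (LINT y|\<mu>. g y * indicator A y)"
      using test[of "indicator B"] by (simp add: ind)
    have "(LINT y:A|\<mu>. f (Y y)) = (LINT y:A|\<mu>. e y)"
      using f(2) A unfolding set_lebesgue_integral_def by (intro integral_cong_AE) auto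
    with eq show "(LINT y:A|\<mu>. g y) = (LINT y:A|\<mu>. f (Y y))"
      by (simp add: set_lebesgue_integral_def mult.commute)
  qed (use ei fY in auto)
  with f(2) show ?thesis unfolding cond_exp_given_def by eventually_elim simp
qed

end

theory Submission
  imports Defs
begin

text \<open>With \<open>A y = \<integral> sgn (y - z) d\<rho>\<^sub>0(z)\<close>, the flow is \<open>X(t) = P\<^sub>K(id + t v\<^sub>0 - t\<^sup>2/2 A)\<close>, where \<open>P\<^sub>K\<close> is
  the projection of \<open>L\<^sup>2(\<rho>\<^sub>0)\<close> onto the cone \<open>K\<close> of nondecreasing functions. Two facts about \<open>P\<^sub>K\<close>
  carry the proof: \<open>P\<^sub>K g\<close> is the conditional expectation of \<open>g\<close> given \<open>P\<^sub>K g\<close>, and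
  \<open>P\<^sub>K (g + h) - P\<^sub>K g \<in> K\<close> whenever \<open>h \<in> K\<close>. The second one, applied to \<open>id + t Var(v\<^sub>0)\<close> and to
  \<open>X(s)/s\<close>, \<open>X(t)/t\<close>, gives the estimates (ii) and (iii). By (iii), \<open>X(t)\<close> is a function of \<open>X(s)\<close>
  for \<open>s \<le> t\<close>, so the \<open>\<sigma>\<close>-algebras generated by \<open>X(t)\<close> decrease and
  \<open>V(t) = E[v\<^sub>0 - t A | X(t)]\<close> is a reverse martingale up to the drift, hence continuous in
  \<open>L\<^sup>2\<close> off a countable set of times. Comparing \<open>X(t) - X(s)\<close> with the Riemann sums of \<open>V\<close> leaves a sum
  of orthogonal increments that vanishes with the mesh; this yields \<open>X' = V\<close> a.e. and, since the
  potential energy is \<open>\<integral> X(t) A d\<rho>\<^sub>0\<close>, the decay of the energy and thereby the global Lipschitz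
  bound. Finally \<open>E[A | X(s)]\<close> is the force \<open>(sgn * \<rho>\<^sub>s)(X(s))\<close>, so \<open>V(t)\<close> is the right-hand side
  of the flow equation.\<close>

section \<open>Absolutely continuous functions\<close>

text \<open>As long as no two labels meet, the force on the label y is \<open>A y\<close>, so
  \<open>y + t v(y) - t^2/2 A(y)\<close> is the free motion with constant acceleration
  \<open>- A y\<close>; the projection glues together the labels that would cross. The construction
  thus uses \<open>A\<close> alone and never the unknown measures \<rho>_s, which removes the fixed
  point problem from the flow equation. Two obstacles shape the rest. First, the projection is
  determined only up to null sets, whereas (ii) and (iii) are pointwise on the support and the
  generated \<sigma>-algebras have to be nested exactly. Each X(t) therefore gets a representative
  that is continuous on the support and constant off it; continuity holds because both X(t) and id +
  t Var(v0) - X(t) are nondecreasing. Second, (ii) speaks of v0', so Var(v0) has to be bounded by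
  the integral of |v0'|. This rests on the fundamental theorem for absolutely continuous functions,
  obtained from the densities of the Stieltjes measures of Var(v0) and v0 + Var(v0).\<close>

lemma abs_continuous_family:
  assumes "abs_continuous v" and "\<epsilon> > 0"
  obtains \<delta> where "\<delta> > 0"
    and "\<And>(I :: 'i set) a b. finite I \<Longrightarrow> (\<And>i. i \<in> I \<Longrightarrow> a i \<le> b i) \<Longrightarrow>
      disjoint_family_on (\<lambda>i. {a i<..<b i}) I \<Longrightarrow> (\<Sum>i\<in>I. b i - a i) < \<delta> \<Longrightarrow>
      (\<Sum>i\<in>I. \<bar>v (b i) - v (a i)\<bar>) < \<epsilon>"
proof -
  from assms obtain \<delta> where \<delta>: "\<delta> > 0" and H: "\<And>(n::nat) a b.
        (\<forall>i<n. a i < b i) \<and> disjoint_family_on (\<lambda>i. {a i<..<b i}) {..<n} \<and>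
        (\<Sum>i<n. b i - a i) < \<delta> \<Longrightarrow> (\<Sum>i<n. \<bar>v (b i) - v (a i)\<bar>) < \<epsilon>"
    unfolding abs_continuous_def by meson
  show thesis
  proof
    fix I :: "'i set" and a b
    assume I: "finite I" "\<And>i. i \<in> I \<Longrightarrow> a i \<le> b i" and dj: "disjoint_family_on (\<lambda>i. {a i<..<b i}) I"
      and less: "(\<Sum>i\<in>I. b i - a i) < \<delta>"
    \<comment> \<open>The definition of absolute continuity wants nondegenerate intervals numbered
      by \<open>nat\<close>. Degenerate intervals contribute zero to both sums, so they are dropped
      and the remaining ones are enumerated by \<open>f\<close>.\<close>
    define J where "J = {i\<in>I. a i < b i}"
    have J: "finite J" "J \<subseteq> I" using I by (auto simp: J_def)
    obtain f where f: "bij_betw f {..<card J} J"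
      using ex_bij_betw_nat_finite[OF J(1)] by (auto simp: atLeast0LessThan)
    have eq: "a i = b i" if "i \<in> I - J" for i using that I(2)[of i] by (auto simp: J_def)
    have s: "(\<Sum>i\<in>I. g i) = (\<Sum>k<card J. g (f k))" if "\<And>i. i \<in> I - J \<Longrightarrow> g i = 0" for g :: "'i \<Rightarrow> real"
    proof -
      have "(\<Sum>i\<in>I. g i) = (\<Sum>i\<in>J. g i)" using I(1) J(2) that by (intro sum.mono_neutral_right) auto
      also have "\<dots> = (\<Sum>k<card J. g (f k))" by (rule sum.reindex_bij_betw[OF f, symmetric])
      finally show ?thesis .
    qed
    have fJ: "f k \<in> J" if "k < card J" for k using f that by (auto simp: bij_betw_def)
    have "(\<Sum>k<card J. \<bar>v (b (f k)) - v (a (f k))\<bar>) < \<epsilon>"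
    proof (rule H, intro conjI)
      show "\<forall>i<card J. a (f i) < b (f i)" using fJ by (auto simp: J_def)
      show "disjoint_family_on (\<lambda>i. {a (f i)<..<b (f i)}) {..<card J}"
        unfolding disjoint_family_on_def
      proof (intro ballI impI)
        fix m n assume mn: "m \<in> {..<card J}" "n \<in> {..<card J}" "m \<noteq> n"
        then have "f m \<noteq> f n" using f by (auto simp: bij_betw_def inj_on_def)
        then show "{a (f m)<..<b (f m)} \<inter> {a (f n)<..<b (f n)} = {}"
          using dj fJ mn J(2) unfolding disjoint_family_on_def by (meson lessThan_iff subsetD)
      qed
      show "(\<Sum>i<card J. b (f i) - a (f i)) < \<delta>" using less by (subst (asm) s) (auto simp: eq[symmetric])
    qed
    then show "(\<Sum>i\<in>I. \<bar>v (b i) - v (a i)\<bar>) < \<epsilon>" by (subst s) (auto simp: eq[symmetric])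
  qed (rule \<delta>)
qed

lemma abs_continuous_dist:
  assumes "abs_continuous v" and "\<epsilon> > 0"
  obtains \<delta> where "\<delta> > 0" and "\<And>x y. \<bar>x - y\<bar> < \<delta> \<Longrightarrow> \<bar>v x - v y\<bar> < \<epsilon>"
proof -
  obtain \<delta> where \<delta>: "\<delta> > 0" and H: "\<And>(I :: unit set) a b. finite I \<Longrightarrow> (\<And>i. i \<in> I \<Longrightarrow> a i \<le> b i) \<Longrightarrow>
      disjoint_family_on (\<lambda>i. {a i<..<b i}) I \<Longrightarrow> (\<Sum>i\<in>I. b i - a i) < \<delta> \<Longrightarrow>
      (\<Sum>i\<in>I. \<bar>v (b i) - v (a i)\<bar>) < \<epsilon>"
    using abs_continuous_family[OF assms, where 'i = unit] by blast
  show thesis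
  proof
    fix x y :: real assume "\<bar>x - y\<bar> < \<delta>"
    then show "\<bar>v x - v y\<bar> < \<epsilon>"
      using H[of "{()}" "\<lambda>_. min x y" "\<lambda>_. max x y"]
      by (cases "x \<le> y") (auto simp: disjoint_family_on_def abs_minus_commute)
  qed (rule \<delta>)
qed

lemma abs_continuous_uniformly_continuous:
  assumes "abs_continuous v"
  shows "uniformly_continuous_on UNIV v"
  unfolding uniformly_continuous_on_def dist_real_def
proof (intro allI impI)
  fix e :: real assume "e > 0"
  then obtain d where "d > 0" "\<And>x y. \<bar>x - y\<bar> < d \<Longrightarrow> \<bar>v x - v y\<bar> < e"
    using abs_continuous_dist[OF assms] by blast
  then show "\<exists>d>0. \<forall>x\<in>UNIV. \<forall>x'\<in>UNIV. \<bar>x' - x\<bar> < d \<longrightarrow> \<bar>v x' - v x\<bar> < e" by blast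
qed

lemma abs_continuous_isCont: "abs_continuous v \<Longrightarrow> isCont v x"
  using abs_continuous_uniformly_continuous uniformly_continuous_imp_continuous
    continuous_on_eq_continuous_at open_UNIV by blast

lemma abs_continuous_measurable: "abs_continuous v \<Longrightarrow> v \<in> borel_measurable borel"
  by (intro borel_measurable_continuous_onI continuous_at_imp_continuous_on ballI
      abs_continuous_isCont)

text \<open>Each step of length \<open>d\<close> changes \<open>v\<close> by at most 1, so
  \<open>v\<close> grows at most linearly. This is what makes \<open>v\<close> and its variation
  square integrable when the measure has a finite second moment.\<close>

lemma abs_continuous_growth:
  assumes "abs_continuous v"
  obtains C where "C \<ge> 0" and "\<And>x y. \<bar>v x - v y\<bar> \<le> C * (1 + \<bar>x - y\<bar>)"
proof -
  obtain \<delta> where \<delta>: "\<delta> > 0" "\<And>x y. \<bar>x - y\<bar> < \<delta> \<Longrightarrow> \<bar>v x - v y\<bar> < 1"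
    using abs_continuous_dist[OF assms zero_less_one] by blast
  define d where "d = \<delta> / 2"
  have d: "d > 0" "\<And>x y. \<bar>x - y\<bar> \<le> d \<Longrightarrow> \<bar>v x - v y\<bar> \<le> 1"
    using \<delta> by (auto simp: d_def intro!: less_imp_le)
  have A: "\<bar>v y - v x\<bar> \<le> real N" if "x \<le> y" "y - x \<le> real N * d" for x y N
    using that
  proof (induction N arbitrary: y)
    case (Suc N)
    let ?z = "max x (y - d)"
    have "\<bar>v ?z - v x\<bar> \<le> real N" using Suc.prems by (intro Suc.IH) (auto simp: algebra_simps d(1) less_imp_le)
    moreover have "\<bar>v y - v ?z\<bar> \<le> 1" using Suc.prems d(1) by (intro d(2)) auto
    ultimately show ?case by simp
  qed simp
  have B: "\<bar>v y - v x\<bar> \<le> (1 + 1 / d) * (1 + \<bar>y - x\<bar>)" if "x \<le> y" for x y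
  proof -
    let ?N = "nat \<lceil>(y - x) / d\<rceil>"
    have 1: "(y - x) / d \<le> real ?N" by linarith
    have "y - x \<le> real ?N * d" using 1 d(1) by (metis pos_divide_le_eq)
    then have "\<bar>v y - v x\<bar> \<le> real ?N" by (rule A[OF that])
    also have "\<dots> \<le> (y - x) / d + 1"
      using that d by (simp add: ceiling_correct)
    also have "\<dots> \<le> (1 + 1 / d) * (1 + \<bar>y - x\<bar>)"
    proof -
      have "0 \<le> 1 / d" using d(1) by simp
      moreover have "(1 + 1 / d) * (1 + \<bar>y - x\<bar>) = 1 + (y - x) / d + 1 / d + (y - x)"
        using that by (simp add: distrib_right distrib_left)
      ultimately show ?thesis using that by linarith
    qed
    finally show ?thesis .
  qed
  show thesis
  proof
    show "0 \<le> 1 + 1 / d" using d by simp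
    show "\<bar>v x - v y\<bar> \<le> (1 + 1 / d) * (1 + \<bar>x - y\<bar>)" for x y
      using B[of x y] B[of y x] by (cases "x \<le> y") (auto simp: abs_minus_commute)
  qed
qed

section \<open>Total variation of an absolutely continuous function\<close>

definition partition_sum :: "(real \<Rightarrow> real) \<Rightarrow> nat \<Rightarrow> (nat \<Rightarrow> real) \<Rightarrow> real" where
  "partition_sum v n x = (\<Sum>i<n. \<bar>v (x (Suc i)) - v (x i)\<bar>)"

text \<open>Partitions are monotone sequences in which points may repeat and whose end points need
  not be a and b. Hence clipping a partition at a point with \<open>min\<close> or
  \<open>max\<close> gives a partition again.\<close>

definition partition_sums :: "(real \<Rightarrow> real) \<Rightarrow> real \<Rightarrow> real \<Rightarrow> real set" where
  "partition_sums v a b = {partition_sum v n x |n x. mono x \<and> (\<forall>i. a \<le> x i \<and> x i \<le> b)}"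

definition variation :: "(real \<Rightarrow> real) \<Rightarrow> real \<Rightarrow> real \<Rightarrow> real" where
  "variation v a b = Sup (partition_sums v a b)"

definition variation_fun :: "(real \<Rightarrow> real) \<Rightarrow> real \<Rightarrow> real" where
  "variation_fun v x = (if 0 \<le> x then variation v 0 x else - variation v x 0)"

lemma disjoint_family_partition:
  fixes x :: "nat \<Rightarrow> real"
  assumes "mono x"
  shows "disjoint_family_on (\<lambda>i. {x i<..<x (Suc i)}) I"
proof -
  have "{x m<..<x (Suc m)} \<inter> {x n<..<x (Suc n)} = {}" if "m < n" for m n
    using monoD[OF assms, of "Suc m" n] that by auto
  then show ?thesis unfolding disjoint_family_on_def by (metis Int_commute nat_neq_iff)
qed

text \<open>A step that does not straddle \<open>c\<close> survives in exactly one of the two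
  clipped partitions; for a step that does, the bound is the triangle inequality through
  \<open>v c\<close>.\<close>

lemma partition_sum_split:
  assumes "mono x"
  shows "partition_sum v n x \<le> partition_sum v n (\<lambda>i. min c (x i)) + partition_sum v n (\<lambda>i. max c (x i))"
proof -
  have "\<bar>v (x (Suc i)) - v (x i)\<bar> \<le>
      \<bar>v (min c (x (Suc i))) - v (min c (x i))\<bar> + \<bar>v (max c (x (Suc i))) - v (max c (x i))\<bar>" for i
    using monoD[OF assms, of i "Suc i"] by (auto simp: min_def max_def)
  then show ?thesis unfolding partition_sum_def sum.distrib[symmetric] by (intro sum_mono)
qed

lemma mono_min_max:
  fixes x :: "nat \<Rightarrow> real"
  assumes "mono x"
  shows "mono (\<lambda>i. min c (x i))" "mono (\<lambda>i. max c (x i))"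
  using assms unfolding mono_def by (meson max.mono min.mono order_refl)+

lemma partition_sums_nonempty: "a \<le> b \<Longrightarrow> partition_sums v a b \<noteq> {}"
proof -
  assume "a \<le> b"
  then have "partition_sum v 0 (\<lambda>_. a) \<in> partition_sums v a b"
    unfolding partition_sums_def by (auto simp: mono_def intro!: exI[of _ "0::nat"] exI[of _ "\<lambda>_. a"])
  then show ?thesis by auto
qed

text \<open>On an interval of length at most \<open>d\<close> every partition sum is at most 1, by
  absolute continuity with \<epsilon> = 1. An interval of length \<open>N * d\<close> is shortened
  by \<open>d\<close> at its right end N times with \<open>partition_sum_split\<close>, so N bounds
  its sums.\<close>

lemma partition_sums_bdd_above:
  assumes "abs_continuous v"
  shows "bdd_above (partition_sums v a b)"
proof -
  obtain \<delta> where \<delta>: "\<delta> > 0" and H: "\<And>(I :: nat set) a b. finite I \<Longrightarrow> (\<And>i. i \<in> I \<Longrightarrow> a i \<le> b i) \<Longrightarrow>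
      disjoint_family_on (\<lambda>i. {a i<..<b i}) I \<Longrightarrow> (\<Sum>i\<in>I. b i - a i) < \<delta> \<Longrightarrow>
      (\<Sum>i\<in>I. \<bar>v (b i) - v (a i)\<bar>) < 1"
    using abs_continuous_family[OF assms zero_less_one, where 'i = nat] by blast
  define d where "d = \<delta> / 2"
  have d: "0 < d" "d < \<delta>" using \<delta> by (auto simp: d_def)
  have one: "partition_sum v n x \<le> 1"
    if "mono x" "\<And>i. c \<le> x i \<and> x i \<le> e" "e - c \<le> d" for n x c e
  proof -
    have "(\<Sum>i<n. x (Suc i) - x i) < \<delta>"
      using that(2)[of n] that(2)[of 0] that(3) d by (subst sum_lessThan_telescope) linarith
    then show ?thesis
      using H[of "{..<n}" x "\<lambda>i. x (Suc i)"] disjoint_family_partition[OF that(1)] monoD[OF that(1)]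
      by (simp add: partition_sum_def less_imp_le)
  qed
  have A: "partition_sum v n x \<le> real N"
    if "mono x" "\<And>i. a \<le> x i \<and> x i \<le> b" "b - a \<le> real N * d" for n x N a b
    using that
  proof (induction N arbitrary: x b)
    case 0
    have "x i = a" for i using 0(2)[of i] 0(3) by simp
    then show ?case by (simp add: partition_sum_def)
  next
    case (Suc N)
    let ?c = "max a (b - d)"
    have "a \<le> b" using Suc.prems(2) order_trans by blast
    have "partition_sum v n (\<lambda>i. min ?c (x i)) \<le> real N"
      using Suc.prems(2,3) d(1) by (intro Suc.IH[where b="?c"] mono_min_max Suc.prems(1)) (auto simp: algebra_simps le_max_iff_disj)
    moreover have "partition_sum v n (\<lambda>i. max ?c (x i)) \<le> 1"
      using Suc.prems(2) d(1) \<open>a \<le> b\<close> by (intro one[where c="?c" and e=b] mono_min_max Suc.prems(1)) auto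
    ultimately show ?case using partition_sum_split[OF Suc.prems(1), of v n ?c] by simp
  qed
  obtain N :: nat where "(b - a) / d \<le> real N" using real_arch_simple by blast
  then have "b - a \<le> real N * d" using d by (simp add: field_simps)
  from A[OF _ _ this] show ?thesis unfolding partition_sums_def by (intro bdd_aboveI[of _ "real N"]) blast
qed

lemma sum_lessThan_add_nat:
  fixes f :: "nat \<Rightarrow> 'a :: comm_monoid_add"
  shows "(\<Sum>i<k + m. f i) = (\<Sum>i<k. f i) + (\<Sum>i<m. f (k + i))"
  by (induction m) (simp_all add: add.assoc)

context
  fixes v assumes v: "abs_continuous v"
begin

lemma partition_sum_le_variation:
  "mono x \<Longrightarrow> (\<And>i. a \<le> x i \<and> x i \<le> b) \<Longrightarrow> partition_sum v n x \<le> variation v a b"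
  unfolding variation_def
  by (intro cSup_upper partition_sums_bdd_above v) (auto simp: partition_sums_def)

lemma variation_approx:
  assumes "a \<le> b" "e > 0"
  shows "\<exists>n x. mono x \<and> (\<forall>i. a \<le> x i \<and> x i \<le> b) \<and> variation v a b - e < partition_sum v n x"
proof -
  have "variation v a b - e < Sup (partition_sums v a b)" using assms by (simp add: variation_def)
  then obtain s where "s \<in> partition_sums v a b" "variation v a b - e < s"
    using less_cSup_iff[OF partition_sums_nonempty[OF assms(1)] partition_sums_bdd_above[OF v]] by blast
  then show ?thesis by (auto simp: partition_sums_def)
qed

lemma variation_add:
  assumes "a \<le> b" "b \<le> c"
  shows "variation v a c = variation v a b + variation v b c"
proof (rule antisym)
  show "variation v a c \<le> variation v a b + variation v b c"
  proof (rule field_le_epsilon)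
    fix e :: real assume "e > 0"
    then obtain n x where x: "mono x" "\<And>i. a \<le> x i \<and> x i \<le> c" "variation v a c - e < partition_sum v n x"
      using variation_approx[of a c e] order_trans[OF assms] by blast
    have "partition_sum v n x \<le> partition_sum v n (\<lambda>i. min b (x i)) + partition_sum v n (\<lambda>i. max b (x i))"
      by (rule partition_sum_split[OF x(1)])
    also have "\<dots> \<le> variation v a b + variation v b c"
      using assms x(2) by (intro add_mono partition_sum_le_variation mono_min_max x(1)) auto
    finally show "variation v a c \<le> variation v a b + variation v b c + e" using x(3) by simp
  qed
  show "variation v a b + variation v b c \<le> variation v a c"
  proof (rule field_le_epsilon)
    fix e :: real assume "e > 0"
    then have "e / 2 > 0" by simp
    obtain n x where x: "mono x" "\<And>i. a \<le> x i \<and> x i \<le> b" "variation v a b - e/2 < partition_sum v n x"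
      using variation_approx[OF assms(1) \<open>e / 2 > 0\<close>] by blast
    obtain m y where y: "mono y" "\<And>i. b \<le> y i \<and> y i \<le> c" "variation v b c - e/2 < partition_sum v m y"
      using variation_approx[OF assms(2) \<open>e / 2 > 0\<close>] by blast
    \<comment> \<open>The concatenation of the two partitions. The points \<open>x 0\<close> to
      \<open>x n\<close> fill the indices up to n, so \<open>y\<close> starts at
      \<open>Suc n\<close>; the extra step from \<open>x n\<close> to \<open>y 0\<close> contributes
      a nonnegative term that is discarded.\<close>
    define z where "z i = (if i \<le> n then x i else y (i - Suc n))" for i
    have xy: "x i \<le> y j" for i j using x(2) y(2) order_trans by blast
    have mz: "mono z" unfolding mono_def z_def
      using xy monoD[OF x(1)] monoD[OF y(1)] by auto
    have "partition_sum v (Suc n + m) z = (\<Sum>i<Suc n. \<bar>v (z (Suc i)) - v (z i)\<bar>)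
        + (\<Sum>i<m. \<bar>v (z (Suc (Suc n + i))) - v (z (Suc n + i))\<bar>)"
      unfolding partition_sum_def by (rule sum_lessThan_add_nat)
    also have "\<dots> \<ge> partition_sum v n x + partition_sum v m y"
      by (simp add: z_def partition_sum_def Suc_diff_le)
    finally have "partition_sum v n x + partition_sum v m y \<le> partition_sum v (Suc n + m) z" .
    also have "\<dots> \<le> variation v a c"
      using x(2) y(2) assms by (intro partition_sum_le_variation mz) (auto simp: z_def intro: order_trans)
    finally show "variation v a b + variation v b c \<le> variation v a c + e" using x(3) y(3) by simp
  qed
qed

lemma variation_ge: "a \<le> b \<Longrightarrow> \<bar>v b - v a\<bar> \<le> variation v a b"
  using partition_sum_le_variation[of "\<lambda>i. if i = 0 then a else b" a b 1]
  by (auto simp: partition_sum_def mono_def)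

lemma variation_fun_diff:
  assumes "a \<le> b"
  shows "variation_fun v b - variation_fun v a = variation v a b"
proof -
  consider "0 \<le> a" | "a < 0" "0 \<le> b" | "b < 0" by linarith
  then show ?thesis
  proof cases
    case 1
    from variation_add[OF this assms] show ?thesis using 1 assms by (simp add: variation_fun_def)
  next
    case 2
    from variation_add[OF less_imp_le[OF 2(1)] 2(2)] show ?thesis using 2 by (simp add: variation_fun_def)
  next
    case 3
    from variation_add[OF assms less_imp_le[OF 3]] show ?thesis using 3 assms by (simp add: variation_fun_def)
  qed
qed

lemma variation_fun_ge: "a \<le> b \<Longrightarrow> \<bar>v b - v a\<bar> \<le> variation_fun v b - variation_fun v a"
  by (subst variation_fun_diff) (auto intro: variation_ge)

lemma mono_variation_fun: "mono (variation_fun v)"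
proof (rule monoI)
  fix x y :: real assume "x \<le> y"
  from order_trans[OF abs_ge_zero variation_fun_ge[OF this]]
  show "variation_fun v x \<le> variation_fun v y" by simp
qed

text \<open>Every given interval is refined by a partition that nearly attains its variation. All
  the small intervals together are still disjoint and no longer in total, so the \<delta> of
  \<open>v\<close> for \<epsilon>/2 serves for the variation and \<epsilon>.\<close>

lemma abs_continuous_variation_fun: "abs_continuous (variation_fun v)"
  unfolding abs_continuous_def
proof (intro allI impI)
  fix \<epsilon> :: real assume "\<epsilon> > 0"
  obtain \<delta> where \<delta>: "\<delta> > 0" and H: "\<And>(I :: (nat \<times> nat) set) a b. finite I \<Longrightarrow> (\<And>i. i \<in> I \<Longrightarrow> a i \<le> b i) \<Longrightarrow>
      disjoint_family_on (\<lambda>i. {a i<..<b i}) I \<Longrightarrow> (\<Sum>i\<in>I. b i - a i) < \<delta> \<Longrightarrow>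
      (\<Sum>i\<in>I. \<bar>v (b i) - v (a i)\<bar>) < \<epsilon> / 2"
    using abs_continuous_family[OF v half_gt_zero[OF \<open>\<epsilon> > 0\<close>], where 'i = "nat \<times> nat"] by blast
  show "\<exists>\<delta>>0. \<forall>(n::nat) a b. (\<forall>i<n. a i < b i) \<and> disjoint_family_on (\<lambda>i. {a i<..<b i}) {..<n} \<and>
        (\<Sum>i<n. b i - a i) < \<delta> \<longrightarrow> (\<Sum>i<n. \<bar>variation_fun v (b i) - variation_fun v (a i)\<bar>) < \<epsilon>"
  proof (intro exI conjI allI impI; (elim conjE)?)
    fix n :: nat and a b :: "nat \<Rightarrow> real"
    assume ab: "\<forall>i<n. a i < b i" and dj: "disjoint_family_on (\<lambda>i. {a i<..<b i}) {..<n}"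
      and less: "(\<Sum>i<n. b i - a i) < \<delta>"
    \<comment> \<open>The approximation errors of the n intervals share the other half of
      \<epsilon>; \<open>Suc n\<close> covers n = 0.\<close>
    define e where "e = \<epsilon> / (2 * real (Suc n))"
    have "e > 0" using \<open>\<epsilon> > 0\<close> by (simp add: e_def)
    have "\<forall>i. \<exists>p. i < n \<longrightarrow> mono (snd p) \<and> (\<forall>k. a i \<le> snd p k \<and> snd p k \<le> b i) \<and>
        variation v (a i) (b i) - e < partition_sum v (fst p) (snd p)"
    proof
      fix i show "\<exists>p. i < n \<longrightarrow> mono (snd p) \<and> (\<forall>k. a i \<le> snd p k \<and> snd p k \<le> b i) \<and>
        variation v (a i) (b i) - e < partition_sum v (fst p) (snd p)"
      proof (cases "i < n")
        case True
        then obtain m x where "mono x" "\<forall>k. a i \<le> x k \<and> x k \<le> b i"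
            "variation v (a i) (b i) - e < partition_sum v m x"
          using variation_approx[of "a i" "b i" e] ab \<open>e > 0\<close> less_imp_le by blast
        then show ?thesis by (intro exI[of _ "(m, x)"]) simp
      qed simp
    qed
    then obtain p where p: "\<forall>i. i < n \<longrightarrow> mono (snd (p i)) \<and> (\<forall>k. a i \<le> snd (p i) k \<and> snd (p i) k \<le> b i) \<and>
        variation v (a i) (b i) - e < partition_sum v (fst (p i)) (snd (p i))" by (rule choice[THEN exE])
    define m where "m i = fst (p i)" for i
    define x where "x i = snd (p i)" for i
    have x: "\<And>i. i < n \<Longrightarrow> mono (x i)"
      "\<And>i k. i < n \<Longrightarrow> a i \<le> x i k \<and> x i k \<le> b i"
      "\<And>i. i < n \<Longrightarrow> variation v (a i) (b i) - e < partition_sum v (m i) (x i)"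
      using p by (simp_all add: m_def x_def)
    let ?I = "Sigma {..<n} (\<lambda>i. {..<m i})"
    let ?a = "\<lambda>(i, k). x i k" and ?b = "\<lambda>(i, k). x i (Suc k)"
    have "(\<Sum>p\<in>?I. \<bar>v (?b p) - v (?a p)\<bar>) < \<epsilon> / 2"
    proof (rule H)
      show "?a p \<le> ?b p" if "p \<in> ?I" for p using that monoD[OF x(1), of "fst p" "snd p" "Suc (snd p)"] by auto
      show "disjoint_family_on (\<lambda>p. {?a p<..<?b p}) ?I"
        unfolding disjoint_family_on_def
      proof (intro ballI impI)
        fix p q assume "p \<in> ?I" "q \<in> ?I" "p \<noteq> q"
        then obtain i k j l where pq: "p = (i, k)" "q = (j, l)" "i < n" "j < n" "i \<noteq> j \<or> k \<noteq> l" by auto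
        show "{?a p<..<?b p} \<inter> {?a q<..<?b q} = {}"
        proof (cases "i = j")
          case True
          then show ?thesis using disjoint_family_partition[OF x(1), of i UNIV] pq
            by (auto simp: disjoint_family_on_def)
        next
          case False
          then have "{a i<..<b i} \<inter> {a j<..<b j} = {}"
            using dj pq by (auto simp: disjoint_family_on_def)
          moreover have "{?a p<..<?b p} \<subseteq> {a i<..<b i}" "{?a q<..<?b q} \<subseteq> {a j<..<b j}"
            using x(2)[of i k] x(2)[of i "Suc k"] x(2)[of j l] x(2)[of j "Suc l"] pq(1-4) by auto
          ultimately show ?thesis by blast
        qed
      qed
      have "(\<Sum>p\<in>?I. ?b p - ?a p) = (\<Sum>i<n. \<Sum>k<m i. x i (Suc k) - x i k)"
        by (subst sum.Sigma) (auto intro!: sum.cong)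
      also have "\<dots> \<le> (\<Sum>i<n. b i - a i)"
      proof (intro sum_mono)
        fix i assume "i \<in> {..<n}"
        then show "(\<Sum>k<m i. x i (Suc k) - x i k) \<le> b i - a i"
          using x(2)[of i "m i"] x(2)[of i 0] by (subst sum_lessThan_telescope) auto
      qed
      finally show "(\<Sum>p\<in>?I. ?b p - ?a p) < \<delta>" using less by simp
    qed auto
    also have "(\<Sum>p\<in>?I. \<bar>v (?b p) - v (?a p)\<bar>) = (\<Sum>i<n. partition_sum v (m i) (x i))"
      unfolding partition_sum_def by (subst sum.Sigma) (auto intro!: sum.cong)
    finally have *: "(\<Sum>i<n. partition_sum v (m i) (x i)) < \<epsilon> / 2" .
    have "(\<Sum>i<n. \<bar>variation_fun v (b i) - variation_fun v (a i)\<bar>) \<le> (\<Sum>i<n. partition_sum v (m i) (x i) + e)"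
    proof (intro sum_mono)
      fix i assume "i \<in> {..<n}"
      moreover have "\<bar>variation_fun v (b i) - variation_fun v (a i)\<bar> = variation v (a i) (b i)"
        using ab \<open>i \<in> {..<n}\<close> variation_fun_diff[of "a i" "b i"] variation_ge[of "a i" "b i"] by auto
      ultimately show "\<bar>variation_fun v (b i) - variation_fun v (a i)\<bar> \<le> partition_sum v (m i) (x i) + e"
        using x(3)[of i] by simp
    qed
    also have "\<dots> = (\<Sum>i<n. partition_sum v (m i) (x i)) + real n * e" by (simp add: sum.distrib)
    also have "real n * e \<le> \<epsilon> / 2" using \<open>\<epsilon> > 0\<close> by (simp add: e_def field_simps)
    finally show "(\<Sum>i<n. \<bar>variation_fun v (b i) - variation_fun v (a i)\<bar>) < \<epsilon>" using * by simp
  qed (rule \<delta>)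
qed

end

lemma open_bounded_connected_interval:
  fixes C :: "real set"
  assumes "open C" "connected C" "bounded C" "C \<noteq> {}"
  obtains a b where "a < b" and "C = {a<..<b}"
proof -
  have bd: "bdd_above C" "bdd_below C"
    using assms(3) by (auto simp: bounded_imp_bdd_above bounded_imp_bdd_below)
  have 1: "Inf C < x \<and> x < Sup C" if "x \<in> C" for x
  proof -
    have "\<exists>e>0. ball x e \<subseteq> C" using assms(1) \<open>x \<in> C\<close> by (simp add: open_contains_ball)
    then obtain e where e: "e > 0" "ball x e \<subseteq> C" by (elim exE conjE)
    have "x + e/2 \<in> ball x e" "x - e/2 \<in> ball x e" using e(1) by (auto simp: dist_real_def)
    then have m: "x + e/2 \<in> C" "x - e/2 \<in> C" using e(2) by auto
    have "x + e/2 \<le> Sup C" "Inf C \<le> x - e/2"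
      using cSup_upper[OF m(1) bd(1)] cInf_lower[OF m(2) bd(2)] by auto
    then show ?thesis using e(1) by linarith
  qed
  then have "Inf C < Sup C" using assms(4) by fastforce
  moreover have "C = {Inf C<..<Sup C}"
  proof (intro set_eqI iffI)
    fix x assume "x \<in> {Inf C<..<Sup C}"
    then obtain u w where "u \<in> C" "u < x" "w \<in> C" "x < w"
      using cInf_lessD[OF assms(4)] less_cSupD[OF assms(4)] by (metis greaterThanLessThan_iff)
    then show "x \<in> C" using assms(2) connected_contains_Icc[of C u w] by auto
  qed (use 1 in auto)
  ultimately show thesis by (rule that)
qed

section \<open>The Stieltjes measure of a nondecreasing absolutely continuous function\<close>

context
  fixes F :: "real \<Rightarrow> real" assumes F: "abs_continuous F" and mono_F: "mono F"
begin

lemma right_cont_abs_continuous: "continuous (at_right a) F"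
  using abs_continuous_isCont[OF F] by (simp add: continuous_at_imp_continuous_at_within)

text \<open>The components of an open set of measure below \<delta> are disjoint open intervals,
  bounded because two points further apart than \<delta> would span an interval too long for the
  set. Absolute continuity bounds the increments of \<open>F\<close> over any finite family of them
  by \<epsilon>, and continuity from below passes to the countable union.\<close>

lemma emeasure_interval_measure_open:
  assumes "\<epsilon> > 0"
  obtains \<delta> where "\<delta> > 0" and "\<And>U. open U \<Longrightarrow> emeasure lborel U < ennreal \<delta> \<Longrightarrow>
      emeasure (interval_measure F) U \<le> ennreal \<epsilon>"
proof -
  let ?\<mu> = "interval_measure F"
  obtain \<delta> where \<delta>: "\<delta> > 0" and H: "\<And>(I :: real set set) a b. finite I \<Longrightarrow> (\<And>i. i \<in> I \<Longrightarrow> a i \<le> b i) \<Longrightarrow>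
      disjoint_family_on (\<lambda>i. {a i<..<b i}) I \<Longrightarrow> (\<Sum>i\<in>I. b i - a i) < \<delta> \<Longrightarrow>
      (\<Sum>i\<in>I. \<bar>F (b i) - F (a i)\<bar>) < \<epsilon>"
    using abs_continuous_family[OF F assms, where 'i = "real set"] by blast
  show thesis
  proof
    fix U :: "real set" assume U: "open U" "emeasure lborel U < ennreal \<delta>"
    let ?C = "components U"
    have C: "open C" "connected C" "C \<noteq> {}" "C \<subseteq> U" if "C \<in> ?C" for C
      using that open_components[OF U(1) that] in_components_connected[OF that]
        in_components_nonempty[OF that] in_components_subset[OF that] by auto
    have cC: "countable ?C"
    proof (rule countable_disjoint_open_subsets)
      show "\<And>S. S \<in> ?C \<Longrightarrow> open S" by (rule C)
      show "disjoint ?C" using pairwise_disjoint_components[of U] by (simp add: disjnt_def pairwise_def)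
    qed
    have bC: "bounded C" if "C \<in> ?C" for C
    proof (rule ccontr)
      assume nb: "\<not> bounded C"
      then have "\<exists>x\<in>C. \<exists>y\<in>C. \<bar>x - y\<bar> > \<delta>"
        unfolding bounded_two_points dist_real_def by (simp add: not_le)
      then obtain x y where xy: "x \<in> C" "y \<in> C" "\<bar>x - y\<bar> > \<delta>" by blast
      have "{min x y..max x y} \<subseteq> U"
        using C(2,4)[OF that] connected_contains_Icc[of C "min x y" "max x y"] xy
        by (cases "x \<le> y") (auto simp del: atLeastAtMost_iff)
      then have "emeasure lborel {min x y..max x y} \<le> emeasure lborel U"
        using U by (intro emeasure_mono) auto
      moreover have "emeasure lborel {min x y..max x y} = ennreal \<bar>x - y\<bar>"
        by (auto simp: min_def max_def)
      ultimately have "ennreal \<bar>x - y\<bar> < ennreal \<delta>" using U(2) by (metis le_less_trans)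
      then show False using xy(3) \<delta> by (simp add: ennreal_less_iff)
    qed
    have I: "\<exists>a b. a < b \<and> C = {a<..<b}" if "C \<in> ?C" for C
      by (rule open_bounded_connected_interval[OF C(1)[OF that] C(2)[OF that] bC[OF that] C(3)[OF that]]) blast
    have IC: "Inf C < Sup C" if "C \<in> ?C" for C using I[OF that] by auto
    have mC: "emeasure lborel C = ennreal (Sup C - Inf C)"
      "emeasure ?\<mu> C \<le> ennreal \<bar>F (Sup C) - F (Inf C)\<bar>" if "C \<in> ?C" for C
    proof -
      obtain a b where ab: "a < b" "C = {a<..<b}" using I[OF \<open>C \<in> ?C\<close>] by auto
      then show "emeasure lborel C = ennreal (Sup C - Inf C)" by simp
      have "emeasure ?\<mu> C \<le> emeasure ?\<mu> {a<..b}"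
        unfolding ab(2) by (rule emeasure_mono) auto
      also have "\<dots> = ennreal (F b - F a)"
        using ab(1) mono_F by (intro emeasure_interval_measure_Ioc right_cont_abs_continuous) (auto simp: mono_def)
      finally show "emeasure ?\<mu> C \<le> ennreal \<bar>F (Sup C) - F (Inf C)\<bar>"
        using ab monoD[OF mono_F, of a b] by simp
    qed
    have fin: "(\<Sum>C\<in>\<D>. emeasure ?\<mu> C) \<le> ennreal \<epsilon>" if \<D>: "finite \<D>" "\<D> \<subseteq> ?C" for \<D>
    proof -
      have dj: "disjoint_family_on (\<lambda>C. C) \<D>"
        using pairwise_disjoint_components[of U] \<D>(2) by (auto simp: disjoint_family_on_def pairwise_def)
      have "ennreal (\<Sum>C\<in>\<D>. Sup C - Inf C) = (\<Sum>C\<in>\<D>. emeasure lborel C)"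
        using \<D> mC(1) IC by (subst sum_ennreal[symmetric]) (auto simp: less_imp_le subset_eq intro!: sum.cong)
      also have "\<dots> = emeasure lborel (\<Union>C\<in>\<D>. C)"
        using \<D> C(1) dj by (intro sum_emeasure) auto
      also have "\<dots> \<le> emeasure lborel U" using \<D> C(4) U by (intro emeasure_mono) auto
      finally have "ennreal (\<Sum>C\<in>\<D>. Sup C - Inf C) < ennreal \<delta>" using U(2) by simp
      then have "(\<Sum>C\<in>\<D>. Sup C - Inf C) < \<delta>" by (meson ennreal_leI leD not_le_imp_less)
      moreover have "{Inf C<..<Sup C} = C" if "C \<in> \<D>" for C
      proof -
        obtain a b where "a < b" "C = {a<..<b}" using I[of C] \<open>C \<in> \<D>\<close> \<D>(2) by blast
        then show ?thesis by simp
      qed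
      then have "disjoint_family_on (\<lambda>C. {Inf C<..<Sup C}) \<D>"
        using dj by (simp add: disjoint_family_on_def)
      ultimately have *: "(\<Sum>C\<in>\<D>. \<bar>F (Sup C) - F (Inf C)\<bar>) < \<epsilon>"
        using IC \<D> by (intro H) (auto simp: less_imp_le subset_eq)
      have "(\<Sum>C\<in>\<D>. emeasure ?\<mu> C) \<le> (\<Sum>C\<in>\<D>. ennreal (\<bar>F (Sup C) - F (Inf C)\<bar>))"
        using \<D> mC(2) by (intro sum_mono) auto
      also have "\<dots> = ennreal (\<Sum>C\<in>\<D>. \<bar>F (Sup C) - F (Inf C)\<bar>)" by (rule sum_ennreal) auto
      also have "\<dots> \<le> ennreal \<epsilon>" using * by (intro ennreal_leI) simp
      finally show ?thesis .
    qed
    show "emeasure ?\<mu> U \<le> ennreal \<epsilon>"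
    proof (cases "?C = {}")
      case False
      define D where "D n = from_nat_into ?C ` {..n}" for n :: nat
      have D: "finite (D n)" "D n \<subseteq> ?C" for n
        using from_nat_into[OF False] by (auto simp: D_def)
      have le: "emeasure ?\<mu> (\<Union>(D n)) \<le> ennreal \<epsilon>" for n
      proof -
        have "emeasure ?\<mu> (\<Union>C\<in>D n. C) \<le> (\<Sum>C\<in>D n. emeasure ?\<mu> C)"
          using D[of n] C(1) by (intro emeasure_subadditive_finite) auto
        also have "\<dots> \<le> ennreal \<epsilon>" by (rule fin[OF D])
        finally show ?thesis by simp
      qed
      have "U = (\<Union>n. \<Union>(D n))"
      proof -
        have "(\<Union>n. D n) = range (from_nat_into ?C)" unfolding D_def by blast
        then have "(\<Union>n. D n) = ?C" using range_from_nat_into[OF False cC] by simp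
        moreover have "(\<Union>n. \<Union>(D n)) = \<Union>(\<Union>n. D n)" by auto
        ultimately show ?thesis using Union_components[of U] by simp
      qed
      also have "emeasure ?\<mu> \<dots> = (SUP n. emeasure ?\<mu> (\<Union>(D n)))"
      proof (rule SUP_emeasure_incseq[symmetric])
        show "range (\<lambda>n. \<Union> (D n)) \<subseteq> sets ?\<mu>" 
        proof safe
          fix n
          have "open (\<Union>(D n))" using C(1) D(2)[of n] by (intro open_Union) auto
          then show "\<Union>(D n) \<in> sets ?\<mu>" by simp
        qed
        show "incseq (\<lambda>n. \<Union> (D n))" 
          unfolding incseq_def D_def by (intro allI impI Union_mono image_mono) auto
      qed
      also have "\<dots> \<le> ennreal \<epsilon>" by (intro SUP_least le)
      finally show ?thesis .
    qed (use components_eq_empty in auto)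
  qed (rule \<delta>)
qed

text \<open>Outer regularity encloses a Lebesgue null set in open sets of arbitrarily small measure,
  to which the preceding bound applies.\<close>

lemma interval_measure_absolutely_continuous: "absolutely_continuous lborel (interval_measure F)"
  unfolding absolutely_continuous_def
proof
  fix N :: "real set" assume N: "N \<in> null_sets lborel"
  have "emeasure (interval_measure F) N \<le> ennreal \<epsilon>" if "\<epsilon> > 0" for \<epsilon>
  proof -
    obtain \<delta> where \<delta>: "\<delta> > 0" "\<And>U. open U \<Longrightarrow> emeasure lborel U < ennreal \<delta> \<Longrightarrow>
        emeasure (interval_measure F) U \<le> ennreal \<epsilon>"
      using emeasure_interval_measure_open[OF \<open>\<epsilon> > 0\<close>] by blast
    obtain U where U: "open U" "N \<subseteq> U" "emeasure lborel (U - N) < \<delta>"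
      using outer_regular_lborel[of N \<delta>] N \<delta>(1) by (auto simp: null_sets_def)
    then have "emeasure lborel U < \<delta>" using N by (subst emeasure_Diff_null_set[symmetric, OF N]) auto
    then have "emeasure (interval_measure F) U \<le> ennreal \<epsilon>" using \<delta>(2) U(1) by blast
    moreover have "emeasure (interval_measure F) N \<le> emeasure (interval_measure F) U"
      using U by (intro emeasure_mono) auto
    ultimately show ?thesis by (rule order_trans[rotated])
  qed
  then have "emeasure (interval_measure F) N = 0"
    by (metis ennreal_le_epsilon add_0 le_zero_eq)
  then show "N \<in> null_sets (interval_measure F)" using N by (auto simp: null_sets_def)
qed

text \<open>The density is that of Radon and Nikodym. It is finite almost everywhere because its
  integral over every bounded interval is an increment of \<open>F\<close>, so passing to real
  values with \<open>enn2real\<close> changes no integral.\<close>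

lemma mono_abs_continuous_density:
  obtains f :: "real \<Rightarrow> real" where "f \<in> borel_measurable borel"
    "\<And>a b. a \<le> b \<Longrightarrow> set_integrable lborel {a..b} f"
    "\<And>a b. a \<le> b \<Longrightarrow> (LINT x:{a..b}|lborel. f x) = F b - F a"
proof -
  let ?\<mu> = "interval_measure F"
  obtain g where g[measurable]: "g \<in> borel_measurable lborel" and d: "density lborel g = ?\<mu>"
    using sigma_finite_measure.Radon_Nikodym[OF sigma_finite_lborel interval_measure_absolutely_continuous] by auto
  have I: "(\<integral>\<^sup>+x. g x * indicator {a<..b} x \<partial>lborel) = ennreal (F b - F a)" if "a \<le> b" for a b
  proof -
    have "emeasure ?\<mu> {a<..b} = ennreal (F b - F a)"
      using that mono_F by (intro emeasure_interval_measure_Ioc right_cont_abs_continuous) (auto simp: mono_def)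
    then show ?thesis unfolding d[symmetric] by (subst (asm) emeasure_density) auto
  qed
  have fin: "AE x in lborel. g x \<noteq> \<infinity>"
  proof -
    have "AE x in lborel. g x * indicator {- real n<..real n} x \<noteq> \<infinity>" for n
      by (rule nn_integral_PInf_AE, measurable) (subst I, auto)
    then have "AE x in lborel. \<forall>n. g x * indicator {- real n<..real n} x \<noteq> \<infinity>" by (simp add: AE_all_countable)
    then show ?thesis
    proof eventually_elim
      case (elim x)
      obtain n where "\<bar>x\<bar> < real n" using reals_Archimedean2 by blast
      then have "x \<in> {- real n<..real n}" by auto
      then show ?case using elim[rule_format, of n] by simp
    qed
  qed
  define f where "f x = enn2real (g x)" for x
  have [measurable]: "f \<in> borel_measurable borel" unfolding f_def using g by simp
  have nn: "(\<integral>\<^sup>+x. ennreal (indicator {a..b} x *\<^sub>R f x) \<partial>lborel) = ennreal (F b - F a)" if "a \<le> b" for a b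
  proof -
    have "(\<integral>\<^sup>+x. ennreal (indicator {a..b} x *\<^sub>R f x) \<partial>lborel) = (\<integral>\<^sup>+x. g x * indicator {a<..b} x \<partial>lborel)"
    proof (rule nn_integral_cong_AE)
      have "AE x in lborel. x \<noteq> a" by (rule AE_lborel_singleton)
      with fin show "AE x in lborel. ennreal (indicator {a..b} x *\<^sub>R f x) = g x * indicator {a<..b} x"
        by eventually_elim (auto simp: f_def indicator_def less_top[symmetric])
    qed
    then show ?thesis using I[OF that] by simp
  qed
  show thesis
  proof
    show "f \<in> borel_measurable borel" by measurable
    fix a b :: real assume ab: "a \<le> b"
    have hb: "has_bochner_integral lborel (\<lambda>x. indicator {a..b} x *\<^sub>R f x) (F b - F a)"
      using nn[OF ab] monoD[OF mono_F ab] by (intro has_bochner_integral_nn_integral) (auto simp: f_def indicator_def)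
    then show "set_integrable lborel {a..b} f" "(LINT x:{a..b}|lborel. f x) = F b - F a"
      unfolding set_integrable_def set_lebesgue_integral_def
      by (auto intro: integrable.intros simp: has_bochner_integral_integral_eq)
  qed
qed

end

section \<open>Derivative and variation of a general absolutely continuous function\<close>

lemma abs_continuous_add:
  assumes "abs_continuous v" "abs_continuous w"
  shows "abs_continuous (\<lambda>x. v x + w x)"
  unfolding abs_continuous_def
proof (intro allI impI)
  fix \<epsilon> :: real assume "\<epsilon> > 0"
  then have e2: "\<epsilon> / 2 > 0" by simp
  let ?P = "\<lambda>u \<delta> \<epsilon>. \<forall>(n::nat) a b.
        (\<forall>i<n. a i < b i) \<and> disjoint_family_on (\<lambda>i. {a i<..<b i}) {..<n} \<and>
        (\<Sum>i<n. b i - a i) < \<delta> \<longrightarrow> (\<Sum>i<n. \<bar>u (b i) - u (a i)\<bar>) < (\<epsilon> :: real)"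
  obtain d where d: "d > 0" "?P v d (\<epsilon> / 2)"
    using assms(1) e2 unfolding abs_continuous_def by blast
  obtain e where e: "e > 0" "?P w e (\<epsilon> / 2)"
    using assms(2) e2 unfolding abs_continuous_def by blast
  have "?P (\<lambda>x. v x + w x) (min d e) \<epsilon>"
  proof (intro allI impI; elim conjE)
    fix n :: nat and a b :: "nat \<Rightarrow> real"
    assume *: "\<forall>i<n. a i < b i" "disjoint_family_on (\<lambda>i. {a i<..<b i}) {..<n}"
      "(\<Sum>i<n. b i - a i) < min d e"
    have "(\<Sum>i<n. \<bar>v (b i) + w (b i) - (v (a i) + w (a i))\<bar>) \<le>
        (\<Sum>i<n. \<bar>v (b i) - v (a i)\<bar> + \<bar>w (b i) - w (a i)\<bar>)"
      by (intro sum_mono) linarith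
    moreover have "(\<Sum>i<n. \<bar>v (b i) - v (a i)\<bar>) < \<epsilon> / 2" "(\<Sum>i<n. \<bar>w (b i) - w (a i)\<bar>) < \<epsilon> / 2"
      using d(2) e(2) * by auto
    ultimately show "(\<Sum>i<n. \<bar>v (b i) + w (b i) - (v (a i) + w (a i))\<bar>) < \<epsilon>"
      by (simp add: sum.distrib)
  qed
  then show "\<exists>\<delta>>0. ?P (\<lambda>x. v x + w x) \<delta> \<epsilon>"
    using d(1) e(1) by (intro exI[of _ "min d e"]) simp
qed

text \<open>The Jordan decomposition: \<open>v\<close> is the difference of the nondecreasing
  functions \<open>v + variation_fun v\<close> and \<open>variation_fun v\<close>, both absolutely
  continuous and hence both with a density.\<close>

lemma abs_continuous_density:
  assumes v: "abs_continuous v"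
  obtains w where "w \<in> borel_measurable borel"
    "\<And>a b. a \<le> b \<Longrightarrow> set_integrable lborel {a..b} w"
    "\<And>a b. a \<le> b \<Longrightarrow> (LINT x:{a..b}|lborel. w x) = v b - v a"
proof -
  let ?V = "variation_fun v" and ?P = "\<lambda>x. v x + variation_fun v x"
  have P: "abs_continuous ?P" by (intro abs_continuous_add v abs_continuous_variation_fun)
  have mP: "mono ?P"
  proof (rule monoI)
    fix x y :: real assume "x \<le> y"
    from variation_fun_ge[OF v this] show "?P x \<le> ?P y" by simp
  qed
  obtain f where f: "f \<in> borel_measurable borel" "\<And>a b. a \<le> b \<Longrightarrow> set_integrable lborel {a..b} f"
    "\<And>a b. a \<le> b \<Longrightarrow> (LINT x:{a..b}|lborel. f x) = ?V b - ?V a"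
    using mono_abs_continuous_density[OF abs_continuous_variation_fun[OF v] mono_variation_fun[OF v]] by blast
  obtain g where g: "g \<in> borel_measurable borel" "\<And>a b. a \<le> b \<Longrightarrow> set_integrable lborel {a..b} g"
    "\<And>a b. a \<le> b \<Longrightarrow> (LINT x:{a..b}|lborel. g x) = ?P b - ?P a"
    using mono_abs_continuous_density[OF P mP] by blast
  show thesis
  proof
    show "(\<lambda>x. g x - f x) \<in> borel_measurable borel" using f(1) g(1) by simp
    fix a b :: real assume ab: "a \<le> b"
    show "set_integrable lborel {a..b} (\<lambda>x. g x - f x)" by (intro set_integral_diff f(2) g(2) ab)
    show "(LINT x:{a..b}|lborel. g x - f x) = v b - v a"
      by (subst set_integral_diff(2)[OF g(2)[OF ab] f(2)[OF ab]]) (simp add: f(3)[OF ab] g(3)[OF ab])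
  qed
qed

lemma indefinite_integral_right_derivative:
  fixes v w :: "real \<Rightarrow> real"
  assumes w: "\<And>a b. a \<le> b \<Longrightarrow> (w has_integral (v b - v a)) {a..b}"
  obtains N where "negligible N"
    "\<And>x e. x \<notin> N \<Longrightarrow> e > 0 \<Longrightarrow> \<exists>d>0. \<forall>h. 0 < h \<and> h < d \<longrightarrow> \<bar>(v (x + h) - v x) / h - w x\<bar> < e"
proof -
  have "w integrable_on cbox a b" for a b
    using w[of a b] by (cases "a \<le> b") (auto simp: integrable_on_def)
  then obtain N where N: "negligible N" "\<And>x e. \<lbrakk>x \<notin> N; 0 < e\<rbrakk> \<Longrightarrow> \<exists>d>0. \<forall>h. 0 < h \<and> h < d \<longrightarrow>
      norm (integral (cbox x (x + h *\<^sub>R One)) w /\<^sub>R h ^ DIM(real) - w x) < e"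
    by (rule integrable_ccontinuous_explicit) blast
  have "integral (cbox x (x + h *\<^sub>R One)) w /\<^sub>R h ^ DIM(real) = (v (x + h) - v x) / h" if "h > 0" for x h
    using integral_unique[OF w[of x "x + h"]] that by (simp add: divide_inverse)
  then show thesis using N(2) by (intro that[OF N(1)]) (metis real_norm_def)
qed

text \<open>The differentiation theorem used above averages over cubes with lower corner x, so on
  the line it controls right difference quotients. The left ones are the right difference quotients
  at -x of the reflected function \<open>- v (- x)\<close>, a primitive of \<open>w (- x)\<close>;
  its exceptional set has to be reflected back.\<close>

lemma indefinite_integral_AE_derivative:
  fixes v w :: "real \<Rightarrow> real"
  assumes w: "\<And>a b. a \<le> b \<Longrightarrow> (w has_integral (v b - v a)) {a..b}"
  obtains N where "negligible N" "\<And>x. x \<notin> N \<Longrightarrow> (v has_real_derivative w x) (at x)"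
proof -
  obtain N where N: "negligible N" "\<And>x e. x \<notin> N \<Longrightarrow> e > 0 \<Longrightarrow>
      \<exists>d>0. \<forall>h. 0 < h \<and> h < d \<longrightarrow> \<bar>(v (x + h) - v x) / h - w x\<bar> < e"
    using indefinite_integral_right_derivative[OF w] by blast
  have w': "((\<lambda>x. w (- x)) has_integral (- v (- b) - - v (- a))) {a..b}" if "a \<le> b" for a b
    using w[of "- b" "- a"] that has_integral_reflect_real[where f=w and a="- b" and b="- a"] by simp
  obtain M where M: "negligible M" "\<And>x e. x \<notin> M \<Longrightarrow> e > 0 \<Longrightarrow>
      \<exists>d>0. \<forall>h. 0 < h \<and> h < d \<longrightarrow> \<bar>(- v (- (x + h)) - - v (- x)) / h - w (- x)\<bar> < e"
    using indefinite_integral_right_derivative[OF w'] by blast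
  have nM: "negligible (uminus ` M)"
    by (rule negligible_differentiable_image_negligible[OF order_refl M(1)])
      (intro differentiable_on_minus differentiable_on_ident)
  show thesis
  proof
    show "negligible (N \<union> uminus ` M)" using N(1) nM by (rule negligible_Un)
    fix x assume "x \<notin> N \<union> uminus ` M"
    then have x: "x \<notin> N" "- x \<notin> M" by (auto simp: image_iff)
    show "(v has_real_derivative w x) (at x)"
      unfolding DERIV_def LIM_def
    proof (intro allI impI)
      fix e :: real assume "e > 0"
      obtain d where d: "d > 0" "\<And>h. 0 < h \<Longrightarrow> h < d \<Longrightarrow> \<bar>(v (x + h) - v x) / h - w x\<bar> < e"
        using N(2)[OF x(1) \<open>e > 0\<close>] by blast
      obtain d' where d': "d' > 0" "\<And>h. 0 < h \<Longrightarrow> h < d' \<Longrightarrow> \<bar>(- v (- (- x + h)) - - v (- (- x))) / h - w (- (- x))\<bar> < e"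
        using M(2)[OF x(2) \<open>e > 0\<close>] by blast
      have "dist ((v (x + h) - v x) / h) (w x) < e" if h: "h \<noteq> 0" "\<bar>h\<bar> < min d d'" for h
      proof (cases "h > 0")
        case True
        then show ?thesis using d(2)[of h] h by (simp add: dist_real_def)
      next
        case False
        have "- (- x + - h) = x + h" by simp
        then have "(- v (- (- x + - h)) - - v (- (- x))) / (- h) = (v (x + h) - v x) / h"
          using h(1) by (simp only: minus_minus) (simp add: field_simps)
        moreover have "0 < - h" "- h < d'" using h False by auto
        ultimately show ?thesis using d'(2)[of "- h"] by (simp only: dist_real_def minus_minus)
      qed
      then show "\<exists>s>0. \<forall>h. h \<noteq> 0 \<and> dist h 0 < s \<longrightarrow> dist ((v (x + h) - v x) / h) (w x) < e"
        using d(1) d'(1) by (intro exI[of _ "min d d'"]) (auto simp: dist_real_def)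
    qed
  qed
qed

lemma variation_le:
  assumes "\<And>c d. a \<le> c \<Longrightarrow> c \<le> d \<Longrightarrow> d \<le> b \<Longrightarrow> \<bar>v d - v c\<bar> \<le> I d - I c" and "a \<le> b"
  shows "variation v a b \<le> I b - I a"
  unfolding variation_def
proof (rule cSup_least)
  show "partition_sums v a b \<noteq> {}" by (rule partition_sums_nonempty[OF assms(2)])
  fix s assume "s \<in> partition_sums v a b"
  then obtain n x where x: "s = partition_sum v n x" "mono x" "\<And>i. a \<le> x i \<and> x i \<le> b"
    by (auto simp: partition_sums_def)
  have "s \<le> (\<Sum>i<n. I (x (Suc i)) - I (x i))"
    unfolding x(1) partition_sum_def using x(3) monoD[OF x(2)] by (intro sum_mono assms(1)) auto
  also have "\<dots> = I (x n) - I (x 0)" by (rule sum_lessThan_telescope)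
  also have "\<dots> \<le> I b - I a"
    using assms(1)[of "x n" b] assms(1)[of a "x 0"] x(3)[of n] x(3)[of 0] by auto
  finally show "s \<le> I b - I a" .
qed

text \<open>Increments of \<open>v\<close> are bounded by increments of the primitive
  \<open>I\<close> of the absolute density, and this bound sums over partitions. On the negligible
  set \<open>N\<close>, where \<open>v\<close> may fail to be differentiable, \<open>deriv v\<close>
  is an unspecified value; with respect to the complete measure \<open>lebesgue\<close> this affects
  neither measurability nor the integral.\<close>

lemma variation_le_integral_deriv:
  assumes v: "abs_continuous v" and ab: "a \<le> b"
  shows "variation_fun v b - variation_fun v a \<le> (LINT x:{a..b}|lebesgue. \<bar>deriv v x\<bar>)"
proof -
  obtain w where w: "w \<in> borel_measurable borel" "\<And>a b. a \<le> b \<Longrightarrow> set_integrable lborel {a..b} w"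
    "\<And>a b. a \<le> b \<Longrightarrow> (LINT x:{a..b}|lborel. w x) = v b - v a"
    using abs_continuous_density[OF v] by blast
  have ai: "w absolutely_integrable_on {c..d}" if "c \<le> d" for c d
    using w(2)[OF that] w(1) unfolding set_integrable_def
    by (intro integrable_completion[THEN iffD2]) auto
  have hi: "(w has_integral (v d - v c)) {c..d}" if "c \<le> d" for c d
    using has_integral_set_lebesgue[OF ai[OF that]] w(3)[OF that] w(1)
    by (simp add: set_lebesgue_integral_def integral_completion)
  obtain N where N: "negligible N" "\<And>x. x \<notin> N \<Longrightarrow> (v has_real_derivative w x) (at x)"
    using indefinite_integral_AE_derivative[OF hi] by blast
  have eq: "\<bar>deriv v x\<bar> = \<bar>w x\<bar>" if "x \<notin> N" for x
    using DERIV_imp_deriv[OF N(2)[OF that]] by simp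
  have aw: "(\<lambda>x. \<bar>w x\<bar>) absolutely_integrable_on {c..d}" if "c \<le> d" for c d
    using absolutely_integrable_norm[OF ai[OF that]] by (simp add: o_def)
  then have iw: "(\<lambda>x. \<bar>w x\<bar>) integrable_on {c..d}" if "c \<le> d" for c d
    using that set_lebesgue_integral_eq_integral(1) by blast
  have "(\<lambda>x. \<bar>deriv v x\<bar>) absolutely_integrable_on {a..b}"
    using aw[OF ab] N(1) eq by (rule absolutely_integrable_spike) auto
  then have "(LINT x:{a..b}|lebesgue. \<bar>deriv v x\<bar>) = integral {a..b} (\<lambda>x. \<bar>deriv v x\<bar>)"
    by (rule set_lebesgue_integral_eq_integral)
  also have "\<dots> = integral {a..b} (\<lambda>x. \<bar>w x\<bar>)"
    using N(1) eq by (intro integral_spike[of N]) auto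
  finally have eqI: "(LINT x:{a..b}|lebesgue. \<bar>deriv v x\<bar>) = integral {a..b} (\<lambda>x. \<bar>w x\<bar>)" .
  define I where "I y = integral {a..y} (\<lambda>x. \<bar>w x\<bar>)" for y
  have "variation v a b \<le> I b - I a"
  proof (rule variation_le[OF _ ab])
    fix c d assume cd: "a \<le> c" "c \<le> d" "d \<le> b"
    have "\<bar>v d - v c\<bar> = norm (integral {c..d} w)" using integral_unique[OF hi[OF cd(2)]] by simp
    also have "\<dots> \<le> integral {c..d} (\<lambda>x. \<bar>w x\<bar>)"
      using hi[OF cd(2)] iw[OF cd(2)] by (intro integral_norm_bound_integral) (auto simp: integrable_on_def)
    also have "\<dots> = I d - I c"
      using Henstock_Kurzweil_Integration.integral_combine[OF cd(1,2) iw[OF order_trans[OF cd(1,2)]]]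
      by (simp add: I_def)
    finally show "\<bar>v d - v c\<bar> \<le> I d - I c" .
  qed
  then show ?thesis using variation_fun_diff[OF v ab] by (simp add: eqI I_def)
qed

section \<open>Square integrable functions and the monotone cone\<close>

lemma L2_cmult: "f \<in> L2 \<mu> \<Longrightarrow> (\<lambda>y. c * f y) \<in> L2 \<mu>"
  by (auto simp: L2_def power_mult_distrib)

lemma L2_add: "f \<in> L2 \<mu> \<Longrightarrow> g \<in> L2 \<mu> \<Longrightarrow> (\<lambda>y. f y + g y) \<in> L2 \<mu>"
  using L2_diff[OF _ L2_cmult[of g \<mu> "-1"], of f] by simp

lemma L2_sum: "(\<And>i. i \<in> I \<Longrightarrow> f i \<in> L2 \<mu>) \<Longrightarrow> (\<lambda>y. \<Sum>i\<in>I. f i y) \<in> L2 \<mu>"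
proof (induction I rule: infinite_finite_induct)
  case (insert i I)
  then show ?case using L2_add[of "f i" \<mu> "\<lambda>y. \<Sum>i\<in>I. f i y"] by simp
qed (auto simp: L2_def)

lemma L2_mult_integrable:
  assumes "f \<in> L2 \<mu>" "g \<in> L2 \<mu>"
  shows "integrable \<mu> (\<lambda>y. f y * g y)"
proof (rule Bochner_Integration.integrable_bound[where f="\<lambda>y. (f y)\<^sup>2 + (g y)\<^sup>2"])
  have [measurable]: "f \<in> borel_measurable \<mu>" "g \<in> borel_measurable \<mu>" using assms by (auto simp: L2_def)
  show "integrable \<mu> (\<lambda>y. (f y)\<^sup>2 + (g y)\<^sup>2)" using assms by (auto simp: L2_def)
  show "(\<lambda>y. f y * g y) \<in> borel_measurable \<mu>" by measurable
  have "\<bar>a * b\<bar> \<le> a\<^sup>2 + b\<^sup>2" for a b :: real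
    using zero_le_power2[of "a + b"] zero_le_power2[of "a - b"] zero_le_power2[of a] zero_le_power2[of b]
    by (simp add: power2_sum power2_diff abs_if)
  then show "AE y in \<mu>. norm (f y * g y) \<le> norm ((f y)\<^sup>2 + (g y)\<^sup>2)" by simp
qed

lemma L2_measurable: "f \<in> L2 \<mu> \<Longrightarrow> f \<in> borel_measurable \<mu>"
  and L2_integrable_power2: "f \<in> L2 \<mu> \<Longrightarrow> integrable \<mu> (\<lambda>y. (f y)\<^sup>2)"
  by (auto simp: L2_def)

lemma L2_bound:
  assumes "g \<in> L2 \<mu>" and "f \<in> borel_measurable \<mu>" and "AE y in \<mu>. \<bar>f y\<bar> \<le> \<bar>g y\<bar>"
  shows "f \<in> L2 \<mu>"
proof -
  have "integrable \<mu> (\<lambda>y. (f y)\<^sup>2)"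
  proof (rule Bochner_Integration.integrable_bound[OF L2_integrable_power2[OF assms(1)]])
    show "(\<lambda>y. (f y)\<^sup>2) \<in> borel_measurable \<mu>" using assms(2) by measurable
    show "AE y in \<mu>. norm ((f y)\<^sup>2) \<le> norm ((g y)\<^sup>2)"
      using assms(3) by eventually_elim (simp add: abs_le_square_iff)
  qed
  then show ?thesis using assms(2) by (simp add: L2_def)
qed

lemma L2_const: "finite_measure \<mu> \<Longrightarrow> (\<lambda>_. c) \<in> L2 \<mu>"
  using finite_measure.integrable_const[of \<mu> "c\<^sup>2"] by (simp add: L2_def)

lemma L2_bounded:
  assumes "finite_measure \<mu>" "f \<in> borel_measurable \<mu>" "\<And>y. \<bar>f y\<bar> \<le> B"
  shows "f \<in> L2 \<mu>"
proof (rule L2_bound[OF L2_const[OF assms(1), of B] assms(2)])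
  show "AE y in \<mu>. \<bar>f y\<bar> \<le> \<bar>B\<bar>" using assms(3) by (intro AE_I2) (metis abs_ge_self order_trans)
qed

lemma L2_integrable: "finite_measure \<mu> \<Longrightarrow> f \<in> L2 \<mu> \<Longrightarrow> integrable \<mu> f"
  using L2_mult_integrable[OF _ L2_const, of f \<mu> 1] by simp

lemma L2_cong_AE: "f \<in> L2 \<mu> \<Longrightarrow> g \<in> borel_measurable \<mu> \<Longrightarrow> AE y in \<mu>. f y = g y \<Longrightarrow> g \<in> L2 \<mu>"
  by (rule L2_bound[of f]) (auto elim: eventually_mono)

lemma L2_power2_add:
  assumes "f \<in> L2 \<mu>" "g \<in> L2 \<mu>"
  shows "(LINT y|\<mu>. (f y + g y)\<^sup>2) = (LINT y|\<mu>. (f y)\<^sup>2) + 2 * (LINT y|\<mu>. f y * g y) + (LINT y|\<mu>. (g y)\<^sup>2)"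
proof -
  have "(LINT y|\<mu>. (f y + g y)\<^sup>2) = (LINT y|\<mu>. ((f y)\<^sup>2 + 2 * (f y * g y)) + (g y)\<^sup>2)"
    by (intro Bochner_Integration.integral_cong) (auto simp: power2_sum)
  then show ?thesis
    using assms L2_mult_integrable[OF assms] by (simp add: L2_integrable_power2)
qed

lemma L2_power2_diff:
  assumes "f \<in> L2 \<mu>" "g \<in> L2 \<mu>"
  shows "(LINT y|\<mu>. (f y - g y)\<^sup>2) = (LINT y|\<mu>. (f y)\<^sup>2) - 2 * (LINT y|\<mu>. f y * g y) + (LINT y|\<mu>. (g y)\<^sup>2)"
  using L2_power2_add[OF assms(1) L2_cmult[OF assms(2), of "-1"]] by simp

lemma L2_Cauchy_Schwarz:
  assumes "f \<in> L2 \<mu>" "g \<in> L2 \<mu>"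
  shows "\<bar>LINT y|\<mu>. f y * g y\<bar> \<le> L2norm \<mu> f * L2norm \<mu> g"
proof -
  define a b c where "a = (LINT y|\<mu>. (f y)\<^sup>2)" and "b = (LINT y|\<mu>. f y * g y)" and "c = (LINT y|\<mu>. (g y)\<^sup>2)"
  have nn: "0 \<le> a" "0 \<le> c" by (auto simp: a_def c_def)
  have q: "0 \<le> a - 2 * t * b + t\<^sup>2 * c" for t
  proof -
    have "0 \<le> (LINT y|\<mu>. (f y - t * g y)\<^sup>2)" by simp
    also have "\<dots> = a - 2 * t * b + t\<^sup>2 * c"
      using L2_power2_diff[OF assms(1) L2_cmult[OF assms(2), of t]]
      by (simp add: a_def b_def c_def power_mult_distrib mult.left_commute[of _ t])
    finally show ?thesis .
  qed
  have "b\<^sup>2 \<le> a * c"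
  proof (cases "c = 0")
    case True
    have "b = 0"
    proof (rule ccontr)
      assume "b \<noteq> 0"
      \<comment> \<open>For \<open>c = 0\<close> the quadratic is affine in t, and this t gives it
        the value -1.\<close>
      then show False using q[of "(a + 1) / (2 * b)"] True by simp
    qed
    then show ?thesis using True by simp
  next
    case False
    then have "0 < c" using nn by simp
    then show ?thesis using q[of "b / c"] by (simp add: power2_eq_square field_simps)
  qed
  then have "sqrt (b\<^sup>2) \<le> sqrt (a * c)" by (rule real_sqrt_le_mono)
  then show ?thesis by (simp add: L2norm_def a_def b_def c_def real_sqrt_mult)
qed

lemma L2norm_nonneg [simp]: "0 \<le> L2norm \<mu> f" by (simp add: L2norm_def)

lemma L2norm_power2: "(L2norm \<mu> f)\<^sup>2 = (LINT y|\<mu>. (f y)\<^sup>2)" by (simp add: L2norm_def)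

lemma L2norm_triangle:
  assumes "f \<in> L2 \<mu>" "g \<in> L2 \<mu>"
  shows "L2norm \<mu> (\<lambda>y. f y + g y) \<le> L2norm \<mu> f + L2norm \<mu> g"
proof (rule power2_le_imp_le)
  show "(L2norm \<mu> (\<lambda>y. f y + g y))\<^sup>2 \<le> (L2norm \<mu> f + L2norm \<mu> g)\<^sup>2"
    using L2_Cauchy_Schwarz[OF assms] L2_power2_add[OF assms]
    by (simp add: power2_sum L2norm_power2)
qed simp

lemma L2norm_cmult: "L2norm \<mu> (\<lambda>y. c * f y) = \<bar>c\<bar> * L2norm \<mu> f"
  by (simp add: L2norm_def power_mult_distrib real_sqrt_mult)

lemma L2norm_minus_commute: "L2norm \<mu> (\<lambda>y. f y - g y) = L2norm \<mu> (\<lambda>y. g y - f y)"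
  by (simp add: L2norm_def power2_commute)

lemma L2norm_sum:
  assumes "\<And>i. i \<in> I \<Longrightarrow> f i \<in> L2 \<mu>"
  shows "L2norm \<mu> (\<lambda>y. \<Sum>i\<in>I. f i y) \<le> (\<Sum>i\<in>I. L2norm \<mu> (f i))"
  using assms
proof (induction I rule: infinite_finite_induct)
  case (insert i I)
  then show ?case
    using L2norm_triangle[of "f i" \<mu> "\<lambda>y. \<Sum>i\<in>I. f i y"] L2_sum[of I f \<mu>] by simp
qed (auto simp: L2norm_def)

lemma L2norm_cong_AE:
  assumes "f \<in> borel_measurable \<mu>" "g \<in> borel_measurable \<mu>" "AE y in \<mu>. f y = g y"
  shows "L2norm \<mu> f = L2norm \<mu> g"
  unfolding L2norm_def using assms(3)
  by (intro arg_cong[where f=sqrt] integral_cong_AE) (use assms in \<open>auto elim: eventually_mono\<close>)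

section \<open>The cone of almost everywhere nondecreasing functions and its projection\<close>

definition ae_mono :: "real measure \<Rightarrow> (real \<Rightarrow> real) \<Rightarrow> bool" where
  "ae_mono \<mu> k \<longleftrightarrow> (\<exists>G. (AE y in \<mu>. y \<in> G) \<and> mono_on G k)"

definition mono_cone :: "real measure \<Rightarrow> (real \<Rightarrow> real) set" where
  "mono_cone \<mu> = {k \<in> L2 \<mu>. ae_mono \<mu> k}"

text \<open>Moreau's description of the nearest point in a closed convex cone: the residual
  \<open>g - X\<close> lies in the polar cone and is orthogonal to \<open>X\<close>. It is linear in
  \<open>g\<close>, hence easier to use than minimality of the distance.\<close>

definition is_cone_proj :: "real measure \<Rightarrow> (real \<Rightarrow> real) \<Rightarrow> (real \<Rightarrow> real) \<Rightarrow> bool" where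
  "is_cone_proj \<mu> g X \<longleftrightarrow> X \<in> mono_cone \<mu> \<and> (\<forall>k\<in>mono_cone \<mu>. (LINT y|\<mu>. (g y - X y) * k y) \<le> 0) \<and>
     (LINT y|\<mu>. (g y - X y) * X y) = 0"

lemma mono_imp_ae_mono: "mono k \<Longrightarrow> ae_mono \<mu> k"
  unfolding ae_mono_def by (intro exI[of _ UNIV]) auto

text \<open>The source of almost all memberships in the cone: sums, nonnegative multiples, lattice
  operations and nondecreasing functions of one member are instances.\<close>

lemma ae_mono_map2:
  assumes "ae_mono \<mu> f" "ae_mono \<mu> g" and "\<And>a b c d. a \<le> c \<Longrightarrow> b \<le> d \<Longrightarrow> F a b \<le> F c d"
  shows "ae_mono \<mu> (\<lambda>y. F (f y) (g y))"
proof -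
  obtain G H where "AE y in \<mu>. y \<in> G" "mono_on G f" "AE y in \<mu>. y \<in> H" "mono_on H g"
    using assms(1,2) unfolding ae_mono_def by blast
  then show ?thesis unfolding ae_mono_def using assms(3)
    by (intro exI[of _ "G \<inter> H"]) (auto simp: monotone_on_def)
qed

lemma ae_mono_cong_AE:
  assumes "ae_mono \<mu> f" "AE y in \<mu>. f y = g y"
  shows "ae_mono \<mu> g"
proof -
  obtain G where "AE y in \<mu>. y \<in> G" "mono_on G f" using assms(1) unfolding ae_mono_def by blast
  moreover have "mono_on (G \<inter> {y. f y = g y}) g"
  proof (rule mono_onI)
    fix r s assume "r \<in> G \<inter> {y. f y = g y}" "s \<in> G \<inter> {y. f y = g y}" "r \<le> s"
    with mono_onD[OF \<open>mono_on G f\<close>, of r s] show "g r \<le> g s" by simp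
  qed
  ultimately show ?thesis using assms(2) unfolding ae_mono_def
    by (intro exI[of _ "G \<inter> {y. f y = g y}"]) simp
qed

lemma mono_cone_L2: "k \<in> mono_cone \<mu> \<Longrightarrow> k \<in> L2 \<mu>" by (simp add: mono_cone_def)

lemma mono_cone_add: "f \<in> mono_cone \<mu> \<Longrightarrow> g \<in> mono_cone \<mu> \<Longrightarrow> (\<lambda>y. f y + g y) \<in> mono_cone \<mu>"
  by (auto simp: mono_cone_def intro!: L2_add ae_mono_map2[where F="(+)"])

lemma mono_cone_cmult: "f \<in> mono_cone \<mu> \<Longrightarrow> c \<ge> 0 \<Longrightarrow> (\<lambda>y. c * f y) \<in> mono_cone \<mu>"
  by (auto simp: mono_cone_def intro!: L2_cmult ae_mono_map2[where F="\<lambda>a _. c * a"] mult_left_mono)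

lemma is_cone_projD:
  assumes "is_cone_proj \<mu> g X"
  shows "X \<in> mono_cone \<mu>" "X \<in> L2 \<mu>" "k \<in> mono_cone \<mu> \<Longrightarrow> (LINT y|\<mu>. (g y - X y) * k y) \<le> 0"
    "(LINT y|\<mu>. (g y - X y) * X y) = 0"
  using assms by (auto simp: is_cone_proj_def mono_cone_def)

lemma is_cone_proj_self: "X \<in> mono_cone \<mu> \<Longrightarrow> is_cone_proj \<mu> X X"
  by (simp add: is_cone_proj_def)

lemma is_cone_proj_cmult:
  assumes "is_cone_proj \<mu> g X" "c \<ge> 0"
  shows "is_cone_proj \<mu> (\<lambda>y. c * g y) (\<lambda>y. c * X y)"
proof -
  have "(LINT y|\<mu>. (c * g y - c * X y) * k y) = c * (LINT y|\<mu>. (g y - X y) * k y)" for k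
    by (simp flip: right_diff_distrib add: mult.assoc)
  moreover have "(LINT y|\<mu>. (g y - X y) * (c * X y)) = c * (LINT y|\<mu>. (g y - X y) * X y)"
    by (simp add: mult.left_commute[of _ c])
  ultimately show ?thesis using assms
    by (auto simp: is_cone_proj_def mult_nonneg_nonpos intro: mono_cone_cmult)
qed

lemma is_cone_proj_cong_AE:
  assumes "is_cone_proj \<mu> g X" "Y \<in> borel_measurable \<mu>" "AE y in \<mu>. X y = Y y" "g \<in> borel_measurable \<mu>"
  shows "is_cone_proj \<mu> g Y"
proof -
  have X: "X \<in> L2 \<mu>" "ae_mono \<mu> X" using assms(1) by (auto simp: is_cone_proj_def mono_cone_def)
  have Y: "Y \<in> mono_cone \<mu>"
    unfolding mono_cone_def using L2_cong_AE[OF X(1) assms(2,3)] ae_mono_cong_AE[OF X(2) assms(3)] by simp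
  have [measurable]: "X \<in> borel_measurable \<mu>" "Y \<in> borel_measurable \<mu>" "g \<in> borel_measurable \<mu>"
    using X assms by (auto simp: L2_def)
  have "(LINT y|\<mu>. (g y - Y y) * k y) = (LINT y|\<mu>. (g y - X y) * k y)" if "k \<in> L2 \<mu>" for k
  proof (rule integral_cong_AE)
    have [measurable]: "k \<in> borel_measurable \<mu>" using that by (simp add: L2_def)
    show "(\<lambda>y. (g y - Y y) * k y) \<in> borel_measurable \<mu>" "(\<lambda>y. (g y - X y) * k y) \<in> borel_measurable \<mu>"
      by measurable
    show "AE y in \<mu>. (g y - Y y) * k y = (g y - X y) * k y" using assms(3) by eventually_elim simp
  qed
  moreover have "(LINT y|\<mu>. (g y - X y) * Y y) = (LINT y|\<mu>. (g y - X y) * X y)"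
    using assms(3) by (intro integral_cong_AE) auto
  ultimately show ?thesis using assms(1) Y mono_cone_L2 unfolding is_cone_proj_def by simp
qed

text \<open>The difference of \<open>(g - h) * (X - Y)\<close> and \<open>(X - Y)^2\<close> expands
  into the pairings of the two residuals with \<open>X\<close> and \<open>Y\<close>. Two of them
  vanish and the other two have a favourable sign, so Cauchy-Schwarz finishes.\<close>

lemma is_cone_proj_contraction:
  assumes p: "is_cone_proj \<mu> g X" "is_cone_proj \<mu> h Y" and L: "g \<in> L2 \<mu>" "h \<in> L2 \<mu>"
  shows "L2norm \<mu> (\<lambda>y. X y - Y y) \<le> L2norm \<mu> (\<lambda>y. g y - h y)"
proof -
  have X: "X \<in> L2 \<mu>" "Y \<in> L2 \<mu>" using p by (auto simp: is_cone_proj_def mono_cone_def)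
  note i = L2_mult_integrable
  have 1: "(LINT y|\<mu>. (g y - X y) * Y y) \<le> 0" "(LINT y|\<mu>. (h y - Y y) * X y) \<le> 0"
    "(LINT y|\<mu>. (g y - X y) * X y) = 0" "(LINT y|\<mu>. (h y - Y y) * Y y) = 0"
    using p by (auto simp: is_cone_proj_def mono_cone_def)
  have "(LINT y|\<mu>. (g y - h y) * (X y - Y y)) - (LINT y|\<mu>. (X y - Y y)\<^sup>2) =
      (LINT y|\<mu>. (g y - h y) * (X y - Y y) - (X y - Y y)\<^sup>2)"
    by (intro Bochner_Integration.integral_diff[symmetric] i L2_integrable_power2 L2_diff L X)
  also have "\<dots> = (LINT y|\<mu>. (g y - X y) * X y - (g y - X y) * Y y - (h y - Y y) * X y + (h y - Y y) * Y y)"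
    by (intro Bochner_Integration.integral_cong) (auto simp: algebra_simps power2_eq_square)
  also have "\<dots> = (LINT y|\<mu>. (g y - X y) * X y) - (LINT y|\<mu>. (g y - X y) * Y y) -
      (LINT y|\<mu>. (h y - Y y) * X y) + (LINT y|\<mu>. (h y - Y y) * Y y)"
    by (simp only: Bochner_Integration.integral_diff Bochner_Integration.integral_add
        Bochner_Integration.integrable_diff i L2_diff L X)
  finally have "(L2norm \<mu> (\<lambda>y. X y - Y y))\<^sup>2 \<le> (LINT y|\<mu>. (g y - h y) * (X y - Y y))"
    using 1 by (simp add: L2norm_power2)
  also have "\<dots> \<le> L2norm \<mu> (\<lambda>y. g y - h y) * L2norm \<mu> (\<lambda>y. X y - Y y)"
    using L2_Cauchy_Schwarz[OF L2_diff[OF L] L2_diff[OF X]] by simp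
  finally have *: "L2norm \<mu> (\<lambda>y. X y - Y y) * L2norm \<mu> (\<lambda>y. X y - Y y) \<le>
      L2norm \<mu> (\<lambda>y. g y - h y) * L2norm \<mu> (\<lambda>y. X y - Y y)"
    by (simp add: power2_eq_square)
  show ?thesis
  proof (cases "L2norm \<mu> (\<lambda>y. X y - Y y) = 0")
    case False
    then have "0 < L2norm \<mu> (\<lambda>y. X y - Y y)" using L2norm_nonneg[of \<mu> "\<lambda>y. X y - Y y"] by linarith
    with * show ?thesis by (rule mult_right_le_imp_le)
  qed simp
qed

lemma is_cone_proj_unique:
  assumes p: "is_cone_proj \<mu> g X" "is_cone_proj \<mu> g Y" and L: "g \<in> L2 \<mu>"
  shows "AE y in \<mu>. X y = Y y"
proof -
  have X: "X \<in> L2 \<mu>" "Y \<in> L2 \<mu>" using p by (auto simp: is_cone_proj_def mono_cone_def)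
  have "L2norm \<mu> (\<lambda>y. X y - Y y) \<le> 0"
    using is_cone_proj_contraction[OF p L L] by (simp add: L2norm_def)
  then have "L2norm \<mu> (\<lambda>y. X y - Y y) = 0" by (intro antisym) auto
  then have "(LINT y|\<mu>. (X y - Y y)\<^sup>2) = 0" by (simp add: L2norm_def)
  then have "AE y in \<mu>. (X y - Y y)\<^sup>2 = 0"
    using L2_integrable_power2[OF L2_diff[OF X]] by (subst (asm) integral_nonneg_eq_0_iff_AE) auto
  then show ?thesis by simp
qed

text \<open>Testing the first projection with \<open>X - w\<close> and the second with
  \<open>Y + w\<close> gives opposite inequalities for the pairings of the residuals with
  \<open>w\<close>. Subtracting them leaves \<open>h - Y + X\<close> against \<open>w\<close> with a
  nonpositive integral, and by the last assumption this integral dominates that of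
  \<open>w^2\<close>. So a violation \<open>w\<close> that may be moved from one projection to the
  other must vanish.\<close>

lemma cone_proj_perturbation:
  assumes p: "is_cone_proj \<mu> g X" "is_cone_proj \<mu> (\<lambda>y. g y + h y) Y"
    and L: "g \<in> L2 \<mu>" "h \<in> L2 \<mu>" and w: "w \<in> L2 \<mu>"
    and c: "ae_mono \<mu> (\<lambda>y. X y - w y)" "ae_mono \<mu> (\<lambda>y. Y y + w y)"
    and le: "AE y in \<mu>. (w y)\<^sup>2 \<le> (h y - Y y + X y) * w y"
  shows "AE y in \<mu>. w y = 0"
proof -
  have X: "X \<in> L2 \<mu>" "Y \<in> L2 \<mu>" using p by (auto simp: is_cone_proj_def mono_cone_def)
  note gX = L2_diff[OF L(1) X(1)] and gY = L2_diff[OF L2_add[OF L] X(2)]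
  have "(\<lambda>y. X y - w y) \<in> mono_cone \<mu>" using L2_diff[OF X(1) w] c(1) by (simp add: mono_cone_def)
  then have "(LINT y|\<mu>. (g y - X y) * (X y - w y)) \<le> 0" by (rule is_cone_projD(3)[OF p(1)])
  then have 1: "0 \<le> (LINT y|\<mu>. (g y - X y) * w y)"
    using is_cone_projD(4)[OF p(1)] L2_mult_integrable[OF gX X(1)] L2_mult_integrable[OF gX w]
    by (simp add: right_diff_distrib[of "_ - _"])
  have "(\<lambda>y. Y y + w y) \<in> mono_cone \<mu>" using L2_add[OF X(2) w] c(2) by (simp add: mono_cone_def)
  then have "(LINT y|\<mu>. (g y + h y - Y y) * (Y y + w y)) \<le> 0" by (rule is_cone_projD(3)[OF p(2)])
  then have 2: "(LINT y|\<mu>. (g y + h y - Y y) * w y) \<le> 0"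
    using is_cone_projD(4)[OF p(2)] L2_mult_integrable[OF gY X(2)] L2_mult_integrable[OF gY w]
    by (simp add: distrib_left[of "_ - _"])
  have "(LINT y|\<mu>. (w y)\<^sup>2) \<le> (LINT y|\<mu>. (g y + h y - Y y) * w y - (g y - X y) * w y)"
    using le by (intro integral_mono_AE L2_integrable_power2 Bochner_Integration.integrable_diff
        L2_mult_integrable gX gY w) (auto simp: algebra_simps elim: eventually_mono)
  also have "\<dots> \<le> 0" using 1 2
    by (subst Bochner_Integration.integral_diff) (auto intro!: L2_mult_integrable gX gY w)
  finally have "(LINT y|\<mu>. (w y)\<^sup>2) = 0" by (simp add: antisym)
  then have "AE y in \<mu>. (w y)\<^sup>2 = 0"
    using L2_integrable_power2[OF w] by (subst (asm) integral_nonneg_eq_0_iff_AE) auto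
  then show ?thesis by simp
qed

text \<open>The directions are the truncations of \<open>X - (Y - \<eta>)\<close> and \<open>(Y - \<eta>) - X\<close> at level \<open>c\<close>;
  the truncation keeps all four perturbed functions monotone.\<close>

lemma
  assumes p: "is_cone_proj \<mu> g X" "is_cone_proj \<mu> (\<lambda>y. g y + h y) Y"
    and L: "g \<in> L2 \<mu>" "h \<in> L2 \<mu>" and fm: "finite_measure \<mu>"
  shows cone_proj_level_above: "AE y in \<mu>. c < X y \<longrightarrow> \<eta> \<le> h y \<Longrightarrow> AE y in \<mu>. c < X y \<longrightarrow> X y + \<eta> \<le> Y y"
    and cone_proj_level_below: "AE y in \<mu>. X y < c \<longrightarrow> h y \<le> \<eta> \<Longrightarrow> AE y in \<mu>. X y < c \<longrightarrow> Y y \<le> X y + \<eta>"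
proof -
  have X: "X \<in> L2 \<mu>" "Y \<in> L2 \<mu>" "ae_mono \<mu> X" "ae_mono \<mu> Y"
    using p by (auto simp: is_cone_proj_def mono_cone_def)
  note [measurable] = L2_measurable[OF X(1)] L2_measurable[OF X(2)]
  have Xc: "(\<lambda>y. X y - c) \<in> L2 \<mu>" by (intro L2_diff X L2_const fm)
  note lattice = min_le_iff_disj le_max_iff_disj
  {
    assume \<eta>: "AE y in \<mu>. c < X y \<longrightarrow> \<eta> \<le> h y"
    define w where "w y = max 0 (X y - max (Y y - \<eta>) c)" for y
    have "AE y in \<mu>. w y = 0"
    proof (rule cone_proj_perturbation[OF p L])
      have "w \<in> borel_measurable \<mu>" unfolding w_def by measurable
      then show "w \<in> L2 \<mu>" by (rule L2_bound[OF Xc]) (auto simp: w_def)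
      \<comment> \<open>Subtracting \<open>w\<close> does not visibly preserve monotonicity. In this
        form both perturbed functions are nondecreasing in the values of \<open>X\<close> and
        \<open>Y\<close>, as \<open>ae_mono_map2\<close> requires.\<close>
      have eq: "(\<lambda>y. X y - w y) = (\<lambda>y. min (X y) (max (Y y - \<eta>) c))"
        "(\<lambda>y. Y y + w y) = (\<lambda>y. max (Y y) (min (X y + \<eta>) (X y + Y y - c)))"
        by (auto simp: w_def fun_eq_iff)
      show "ae_mono \<mu> (\<lambda>y. X y - w y)" unfolding eq
        by (rule ae_mono_map2[OF X(3,4), of "\<lambda>a b. min a (max (b - \<eta>) c)"]) (auto simp: lattice)
      show "ae_mono \<mu> (\<lambda>y. Y y + w y)" unfolding eq
        by (rule ae_mono_map2[OF X(3,4), of "\<lambda>a b. max b (min (a + \<eta>) (a + b - c))"]) (auto simp: lattice)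
      show "AE y in \<mu>. (w y)\<^sup>2 \<le> (h y - Y y + X y) * w y"
        using \<eta>
      proof eventually_elim
        case (elim y)
        show ?case
        proof (cases "w y > 0")
          case True
          then have "c < X y" "w y \<le> X y - (Y y - \<eta>)" by (auto simp: w_def max_def split: if_splits)
          then have "w y \<le> h y - Y y + X y" using elim by auto
          then show ?thesis using True by (simp add: power2_eq_square mult_right_mono)
        qed (auto simp: w_def)
      qed
    qed
    then show "AE y in \<mu>. c < X y \<longrightarrow> X y + \<eta> \<le> Y y"
      by eventually_elim (auto simp: w_def max_def split: if_splits)
  }
  {
    assume \<eta>: "AE y in \<mu>. X y < c \<longrightarrow> h y \<le> \<eta>"
    define w where "w y = min 0 (X y - min (Y y - \<eta>) c)" for y
    have "AE y in \<mu>. w y = 0"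
    proof (rule cone_proj_perturbation[OF p L])
      have "w \<in> borel_measurable \<mu>" unfolding w_def by measurable
      then show "w \<in> L2 \<mu>" by (rule L2_bound[OF Xc]) (auto simp: w_def)
      have eq: "(\<lambda>y. X y - w y) = (\<lambda>y. max (X y) (min (Y y - \<eta>) c))"
        "(\<lambda>y. Y y + w y) = (\<lambda>y. min (Y y) (max (X y + \<eta>) (X y + Y y - c)))"
        by (auto simp: w_def fun_eq_iff)
      show "ae_mono \<mu> (\<lambda>y. X y - w y)" unfolding eq
        by (rule ae_mono_map2[OF X(3,4), of "\<lambda>a b. max a (min (b - \<eta>) c)"]) (auto simp: lattice)
      show "ae_mono \<mu> (\<lambda>y. Y y + w y)" unfolding eq
        by (rule ae_mono_map2[OF X(3,4), of "\<lambda>a b. min b (max (a + \<eta>) (a + b - c))"]) (auto simp: lattice)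
      show "AE y in \<mu>. (w y)\<^sup>2 \<le> (h y - Y y + X y) * w y"
        using \<eta>
      proof eventually_elim
        case (elim y)
        show ?case
        proof (cases "w y < 0")
          case True
          then have "X y < c" "X y - (Y y - \<eta>) \<le> w y" by (auto simp: w_def min_def split: if_splits)
          then have "h y - Y y + X y \<le> w y" using elim by auto
          then show ?thesis using True by (simp add: power2_eq_square mult_right_mono_neg)
        qed (auto simp: w_def)
      qed
    qed
    then show "AE y in \<mu>. X y < c \<longrightarrow> Y y \<le> X y + \<eta>"
      by eventually_elim (auto simp: w_def min_def split: if_splits)
  }
qed

text \<open>If \<open>X z < X y\<close>, choose a rational level q between them. The number
  \<open>\<eta> q\<close> separates the values of \<open>h\<close> below the level from those above
  it, so the two level lemmas give \<open>Y z - X z \<le> \<eta> q \<le> Y y - X y\<close>. If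
  \<open>X z = X y\<close>, monotonicity of \<open>Y\<close> suffices. Rational levels keep the
  exceptional set null, and \<open>ok\<close> ensures that both sides of a level are inhabited, so
  that the supremum is a genuine one.\<close>

theorem cone_proj_add_mono:
  assumes p: "is_cone_proj \<mu> g X" "is_cone_proj \<mu> (\<lambda>y. g y + h y) Y"
    and L: "g \<in> L2 \<mu>" "h \<in> L2 \<mu>" and h: "mono h" and fm: "finite_measure \<mu>"
  shows "ae_mono \<mu> (\<lambda>y. Y y - X y)"
proof -
  have X: "ae_mono \<mu> X" "ae_mono \<mu> Y"
    using p by (auto simp: is_cone_proj_def mono_cone_def)
  obtain G where G: "AE y in \<mu>. y \<in> G" "mono_on G X" using X(1) by (auto simp: ae_mono_def)
  obtain H where H: "AE y in \<mu>. y \<in> H" "mono_on H Y" using X(2) by (auto simp: ae_mono_def)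
  define \<eta> where "\<eta> c = Sup (h ` {y \<in> G. X y \<le> c})" for c
  define ok where "ok c \<longleftrightarrow> (\<exists>y\<in>G. c < X y) \<and> (\<exists>z\<in>G. X z \<le> c)" for c
  have hle: "h z \<le> h y" if "y \<in> G" "z \<in> G" "X z \<le> c" "c < X y" for y z c
    using mono_onD[OF G(2) \<open>y \<in> G\<close> \<open>z \<in> G\<close>] that monoD[OF h, of z y] by (cases "z \<le> y") auto
  have \<eta>1: "\<eta> c \<le> h y" if "ok c" "y \<in> G" "c < X y" for c y
    unfolding \<eta>_def using that hle by (intro cSup_least) (auto simp: ok_def)
  have \<eta>2: "h z \<le> \<eta> c" if "ok c" "z \<in> G" "X z \<le> c" for c z
  proof -
    obtain y where "y \<in> G" "c < X y" using \<open>ok c\<close> by (auto simp: ok_def)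
    then show ?thesis unfolding \<eta>_def using that hle
      by (intro cSup_upper bdd_aboveI[of _ "h y"]) auto
  qed
  have "AE y in \<mu>. (of_rat q < X y \<longrightarrow> X y + \<eta> (of_rat q) \<le> Y y) \<and> (X y < of_rat q \<longrightarrow> Y y \<le> X y + \<eta> (of_rat q))"
    if q: "ok (of_rat q)" for q
  proof -
    let ?c = "of_rat q :: real"
    have "AE y in \<mu>. ?c < X y \<longrightarrow> X y + \<eta> ?c \<le> Y y"
      using G(1) \<eta>1[OF q] by (intro cone_proj_level_above[OF p L fm]) (auto elim: eventually_mono)
    moreover have "AE y in \<mu>. X y < ?c \<longrightarrow> Y y \<le> X y + \<eta> ?c"
      using G(1) \<eta>2[OF q] by (intro cone_proj_level_below[OF p L fm]) (auto elim: eventually_mono)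
    ultimately show ?thesis by eventually_elim auto
  qed
  then have "AE y in \<mu>. ok (of_rat q) \<longrightarrow> (of_rat q < X y \<longrightarrow> X y + \<eta> (of_rat q) \<le> Y y) \<and>
      (X y < of_rat q \<longrightarrow> Y y \<le> X y + \<eta> (of_rat q))" for q
    by (cases "ok (of_rat q)") auto
  then have all: "AE y in \<mu>. \<forall>q. ok (of_rat q) \<longrightarrow> (of_rat q < X y \<longrightarrow> X y + \<eta> (of_rat q) \<le> Y y) \<and>
      (X y < of_rat q \<longrightarrow> Y y \<le> X y + \<eta> (of_rat q))"
    by (simp add: AE_all_countable)
  define S where "S = {y \<in> G \<inter> H. \<forall>q. ok (of_rat q) \<longrightarrow> (of_rat q < X y \<longrightarrow> X y + \<eta> (of_rat q) \<le> Y y) \<and>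
      (X y < of_rat q \<longrightarrow> Y y \<le> X y + \<eta> (of_rat q))}"
  have "AE y in \<mu>. y \<in> S" using all G(1) H(1) by eventually_elim (simp add: S_def)
  moreover have "mono_on S (\<lambda>y. Y y - X y)"
  proof (rule mono_onI)
    fix z y assume zy: "z \<in> S" "y \<in> S" "z \<le> y"
    then have GH: "z \<in> G" "y \<in> G" "z \<in> H" "y \<in> H" by (auto simp: S_def)
    show "Y z - X z \<le> Y y - X y"
    proof (cases "X z = X y")
      case True
      then show ?thesis using mono_onD[OF H(2) GH(3,4) zy(3)] by simp
    next
      case False
      then have "X z < X y" using mono_onD[OF G(2) GH(1,2) zy(3)] by simp
      then obtain q where q: "X z < of_rat q" "of_rat q < X y" using of_rat_dense by blast
      then have "ok (of_rat q)" using GH unfolding ok_def by (auto intro: less_imp_le)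
      then show ?thesis using zy(1,2) q unfolding S_def by force
    qed
  qed
  ultimately show ?thesis unfolding ae_mono_def by blast
qed

section \<open>Existence of the projection\<close>

lemma AE_summable_of_L1:
  fixes f :: "nat \<Rightarrow> 'a \<Rightarrow> real"
  assumes i: "\<And>n. integrable \<mu> (f n)" and s: "summable b" and le: "\<And>n. (LINT y|\<mu>. \<bar>f n y\<bar>) \<le> b n"
  shows "AE y in \<mu>. summable (\<lambda>n. f n y)"
proof -
  have [measurable]: "f n \<in> borel_measurable \<mu>" for n using i by auto
  have b0: "0 \<le> b n" for n by (rule order_trans[OF _ le[of n]]) simp
  have "(\<integral>\<^sup>+y. (\<Sum>n. ennreal \<bar>f n y\<bar>) \<partial>\<mu>) = (\<Sum>n. \<integral>\<^sup>+y. ennreal \<bar>f n y\<bar> \<partial>\<mu>)"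
    by (rule nn_integral_suminf) measurable
  also have "\<dots> \<le> (\<Sum>n. ennreal (b n))"
  proof (rule suminf_le)
    fix n
    have "(\<integral>\<^sup>+y. ennreal \<bar>f n y\<bar> \<partial>\<mu>) = ennreal (LINT y|\<mu>. \<bar>f n y\<bar>)"
      by (rule nn_integral_eq_integral) (use i in auto)
    then show "(\<integral>\<^sup>+y. ennreal \<bar>f n y\<bar> \<partial>\<mu>) \<le> ennreal (b n)" using le[of n] by (simp add: ennreal_leI)
  qed auto
  also have "\<dots> = ennreal (\<Sum>n. b n)" using b0 s by (simp add: suminf_ennreal2)
  finally have "(\<integral>\<^sup>+y. (\<Sum>n. ennreal \<bar>f n y\<bar>) \<partial>\<mu>) \<noteq> \<infinity>"
    by (metis ennreal_less_top infinity_ennreal_def leD)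
  then have "AE y in \<mu>. (\<Sum>n. ennreal \<bar>f n y\<bar>) \<noteq> \<infinity>"
    by (intro nn_integral_PInf_AE) measurable
  then show ?thesis
  proof eventually_elim
    case (elim y)
    then have "summable (\<lambda>n. \<bar>f n y\<bar>)" by (intro summable_suminf_not_top) auto
    then show ?case by (rule summable_rabs_cancel)
  qed
qed

text \<open>The minimising sequence has error \<open>(1/4)^n\<close>, so the parallelogram identity,
  applied to the midpoint in the cone, bounds consecutive distances by \<open>2 * (1/2)^n\<close>.
  These are summable, hence the sequence itself converges almost everywhere. The pointwise limit
  inherits monotonicity, Fatou's lemma makes it a minimiser, and the first variation in the
  directions of the cone and in the direction \<open>- X\<close> yields the two conditions on the
  residual.\<close>

lemma cone_proj_exists:
  assumes fm: "finite_measure \<mu>" and g: "g \<in> L2 \<mu>"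
  obtains X where "is_cone_proj \<mu> g X"
proof -
  let ?K = "mono_cone \<mu>"
  define J where "J k = (LINT y|\<mu>. (g y - k y)\<^sup>2)" for k
  define d where "d = Inf (J ` ?K)"
  have J0: "0 \<le> J k" for k by (simp add: J_def)
  have bdd: "bdd_below (J ` ?K)" using J0 by (intro bdd_belowI[of _ 0]) auto
  have zero: "(\<lambda>_. 0) \<in> ?K"
    using L2_const[OF fm, of 0] mono_imp_ae_mono[of "\<lambda>_. 0" \<mu>] by (simp add: mono_cone_def mono_def)
  have d: "d \<le> J k" if "k \<in> ?K" for k unfolding d_def using that bdd by (intro cInf_lower) auto
  have "\<exists>k\<in>?K. J k < d + (1/4)^n" for n :: nat
  proof -
    have "Inf (J ` ?K) < d + (1/4)^n" by (simp add: d_def)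
    then show ?thesis using zero cInf_lessD[of "J ` ?K"] by blast
  qed
  then obtain k where k: "\<And>n :: nat. k n \<in> ?K" "\<And>n. J (k n) < d + (1/4)^n" by metis
  have kL: "k n \<in> L2 \<mu>" for n using k(1) by (rule mono_cone_L2)
  have [measurable]: "g \<in> borel_measurable \<mu>" "k n \<in> borel_measurable \<mu>" for n
    using g kL by (auto simp: L2_def)
  have N: "L2norm \<mu> (\<lambda>y. k (Suc n) y - k n y) \<le> 2 * (1/2)^n" for n
  proof -
    let ?m = "\<lambda>y. 1/2 * (k (Suc n) y + k n y)"
    have mK: "?m \<in> ?K" by (intro mono_cone_cmult mono_cone_add k) simp
    note i = L2_integrable_power2[OF L2_diff[OF g kL]] L2_integrable_power2[OF L2_diff[OF g mono_cone_L2[OF mK]]]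
    have "(LINT y|\<mu>. (k (Suc n) y - k n y)\<^sup>2) =
        (LINT y|\<mu>. (2 * (g y - k n y)\<^sup>2 + 2 * (g y - k (Suc n) y)\<^sup>2) - 4 * (g y - ?m y)\<^sup>2)"
      by (intro Bochner_Integration.integral_cong) (auto simp: power2_eq_square algebra_simps)
    also have "\<dots> = 2 * J (k n) + 2 * J (k (Suc n)) - 4 * J ?m"
      using i by (simp add: J_def del: distrib_left_numeral)
    also have "\<dots> \<le> 2 * (d + (1/4)^n) + 2 * (d + (1/4)^n) - 4 * d"
    proof -
      have "J (k (Suc n)) < d + (1/4)^n"
      proof -
        have "0 < (1/4 :: real)^n" by simp
        moreover have "J (k (Suc n)) < d + (1/4)^n / 4" using k(2)[of "Suc n"] by simp
        ultimately show ?thesis by linarith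
      qed
      moreover have "4 * d \<le> 4 * J ?m" by (rule mult_left_mono[OF d[OF mK]]) simp
      moreover have "2 * J (k n) \<le> 2 * (d + (1/4)^n)" using k(2)[of n] by simp
      ultimately show ?thesis by (intro diff_mono add_mono) auto
    qed
    also have "\<dots> = (2 * (1/2)^n)\<^sup>2"
      by (simp add: power_mult_distrib power_divide flip: power_mult) (simp add: power_mult mult.commute[of n])
    finally show ?thesis unfolding L2norm_def by (metis real_sqrt_le_mono real_sqrt_abs abs_of_nonneg zero_le_power zero_le_divide_1_iff zero_le_numeral mult_nonneg_nonneg)
  qed
  have "AE y in \<mu>. summable (\<lambda>n. k (Suc n) y - k n y)"
  proof (rule AE_summable_of_L1)
    show "integrable \<mu> (\<lambda>y. k (Suc n) y - k n y)" for n by (intro L2_integrable fm L2_diff kL)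
    show "summable (\<lambda>n. 2 * (1/2)^n * L2norm \<mu> (\<lambda>_. 1))"
      by (intro summable_mult2 summable_mult summable_geometric) simp
    fix n
    have aL: "(\<lambda>y. \<bar>k (Suc n) y - k n y\<bar>) \<in> L2 \<mu>"
      by (rule L2_bound[OF L2_diff[OF kL kL]]) auto
    have "(LINT y|\<mu>. \<bar>k (Suc n) y - k n y\<bar>) \<le> L2norm \<mu> (\<lambda>y. \<bar>k (Suc n) y - k n y\<bar>) * L2norm \<mu> (\<lambda>_. 1)"
      using L2_Cauchy_Schwarz[OF aL L2_const[OF fm, of 1]] by simp
    also have "L2norm \<mu> (\<lambda>y. \<bar>k (Suc n) y - k n y\<bar>) = L2norm \<mu> (\<lambda>y. k (Suc n) y - k n y)"
      by (simp add: L2norm_def)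
    finally show "(LINT y|\<mu>. \<bar>k (Suc n) y - k n y\<bar>) \<le> 2 * (1/2)^n * L2norm \<mu> (\<lambda>_. 1)"
      using mult_right_mono[OF N[of n], of "L2norm \<mu> (\<lambda>_. 1)"] by simp
  qed
  then have conv: "AE y in \<mu>. convergent (\<lambda>n. k n y)"
  proof eventually_elim
    case (elim y)
    then have "(\<lambda>n. (\<Sum>i<n. k (Suc i) y - k i y) + k 0 y) \<longlonglongrightarrow> (\<Sum>i. k (Suc i) y - k i y) + k 0 y"
      by (intro tendsto_intros summable_LIMSEQ)
    then show ?case by (auto simp: sum_lessThan_telescope[of "\<lambda>i. k i y"] convergent_def)
  qed
  define X where "X y = lim (\<lambda>n. k n y)" for y
  have [measurable]: "X \<in> borel_measurable \<mu>" unfolding X_def by measurable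
  have lim: "AE y in \<mu>. (\<lambda>n. k n y) \<longlonglongrightarrow> X y"
    using conv by eventually_elim (simp add: X_def convergent_LIMSEQ_iff)
  have "\<exists>G. (AE y in \<mu>. y \<in> G) \<and> mono_on G (k n)" for n
    using k(1)[of n] by (simp add: mono_cone_def ae_mono_def)
  then obtain G where G: "\<And>n. AE y in \<mu>. y \<in> G n" "\<And>n. mono_on (G n) (k n)" by metis
  have mX: "ae_mono \<mu> X"
    unfolding ae_mono_def
  proof (intro exI conjI)
    show "AE y in \<mu>. y \<in> {y. (\<forall>n. y \<in> G n) \<and> (\<lambda>n. k n y) \<longlonglongrightarrow> X y}"
      using lim G(1) by (simp add: AE_all_countable)
    show "mono_on {y. (\<forall>n. y \<in> G n) \<and> (\<lambda>n. k n y) \<longlonglongrightarrow> X y} X"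
    proof (rule mono_onI)
      fix r s assume rs: "r \<in> {y. (\<forall>n. y \<in> G n) \<and> (\<lambda>n. k n y) \<longlonglongrightarrow> X y}"
        "s \<in> {y. (\<forall>n. y \<in> G n) \<and> (\<lambda>n. k n y) \<longlonglongrightarrow> X y}" "r \<le> s"
      then have "\<And>n. k n r \<le> k n s" by (intro mono_onD[OF G(2)]) auto
      then show "X r \<le> X s" using rs by (intro LIMSEQ_le[of "\<lambda>n. k n r" _ "\<lambda>n. k n s"]) auto
    qed
  qed
  have nn: "(\<integral>\<^sup>+y. ennreal ((g y - X y)\<^sup>2) \<partial>\<mu>) \<le> ennreal d"
  proof -
    have "(\<integral>\<^sup>+y. ennreal ((g y - X y)\<^sup>2) \<partial>\<mu>) = (\<integral>\<^sup>+y. liminf (\<lambda>n. ennreal ((g y - k n y)\<^sup>2)) \<partial>\<mu>)"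
    proof (rule nn_integral_cong_AE)
      show "AE y in \<mu>. ennreal ((g y - X y)\<^sup>2) = liminf (\<lambda>n. ennreal ((g y - k n y)\<^sup>2))"
        using lim
      proof eventually_elim
        case (elim y)
        then have "(\<lambda>n. ennreal ((g y - k n y)\<^sup>2)) \<longlonglongrightarrow> ennreal ((g y - X y)\<^sup>2)"
          by (intro tendsto_intros)
        then show ?case by (metis lim_imp_Liminf sequentially_bot)
      qed
    qed
    also have "\<dots> \<le> liminf (\<lambda>n. \<integral>\<^sup>+y. ennreal ((g y - k n y)\<^sup>2) \<partial>\<mu>)"
      by (rule nn_integral_liminf) measurable
    also have "\<dots> \<le> liminf (\<lambda>n. ennreal (d + (1/4)^n))"
    proof (intro Liminf_mono always_eventually allI)
      fix n
      have "(\<integral>\<^sup>+y. ennreal ((g y - k n y)\<^sup>2) \<partial>\<mu>) = ennreal (J (k n))"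
        unfolding J_def using L2_integrable_power2[OF L2_diff[OF g kL]] by (intro nn_integral_eq_integral) auto
      then show "(\<integral>\<^sup>+y. ennreal ((g y - k n y)\<^sup>2) \<partial>\<mu>) \<le> ennreal (d + (1/4)^n)"
        using k(2)[of n] by (simp add: ennreal_leI)
    qed
    also have "(\<lambda>n. ennreal (d + (1/4)^n)) \<longlonglongrightarrow> ennreal (d + 0)"
      by (intro tendsto_intros LIMSEQ_power_zero) simp
    then have "liminf (\<lambda>n. ennreal (d + (1/4)^n)) = ennreal d"
      using lim_imp_Liminf[OF sequentially_bot] by fastforce
    finally show ?thesis .
  qed
  have d0: "0 \<le> d" unfolding d_def using zero J0 by (intro cInf_greatest) auto
  have igX: "integrable \<mu> (\<lambda>y. (g y - X y)\<^sup>2)"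
    using nn by (intro integrableI_nonneg) (auto simp: le_less_trans)
  then have gX: "(\<lambda>y. g y - X y) \<in> L2 \<mu>" by (simp add: L2_def)
  have XL: "X \<in> L2 \<mu>" using L2_diff[OF g gX] by simp
  have JX: "J X \<le> d"
    using nn nn_integral_eq_integral[OF igX] d0 by (simp add: J_def)
  have XK: "X \<in> ?K" using XL mX by (simp add: mono_cone_def)
  have var: "(LINT y|\<mu>. (g y - X y) * u y) \<le> 0"
    if u: "u \<in> L2 \<mu>" and uK: "\<And>t. 0 < t \<Longrightarrow> t \<le> 1 \<Longrightarrow> (\<lambda>y. X y + t * u y) \<in> ?K" for u
  proof (rule ccontr)
    define a where "a = (LINT y|\<mu>. (g y - X y) * u y)"
    define b where "b = (LINT y|\<mu>. (u y)\<^sup>2)"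
    assume "\<not> (LINT y|\<mu>. (g y - X y) * u y) \<le> 0"
    then have a: "a > 0" by (simp add: a_def)
    have b: "b \<ge> 0" by (simp add: b_def)
    \<comment> \<open>With this step length \<open>t * b \<le> a\<close>, whereas minimality along
      the direction \<open>u\<close> forces \<open>2 * a \<le> t * b\<close>; adding 1 to
      \<open>b\<close> covers the case \<open>b = 0\<close>.\<close>
    define t where "t = min 1 (a / (b + 1))"
    have t: "0 < t" "t \<le> 1" using a b by (auto simp: t_def)
    have "t \<le> a / (b + 1)" by (simp add: t_def)
    then have t3: "t * (b + 1) \<le> a" using b by (simp add: pos_le_divide_eq)
    have "J X \<le> J (\<lambda>y. X y + t * u y)" using JX d[OF uK[OF t(1,2)]] by simp
    also have "\<dots> = (LINT y|\<mu>. ((g y - X y) - t * u y)\<^sup>2)" by (simp add: J_def algebra_simps)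
    also have "\<dots> = J X - 2 * t * a + t\<^sup>2 * b"
      using L2_power2_diff[OF gX L2_cmult[OF u, of t]]
      by (simp add: J_def a_def b_def power_mult_distrib mult.left_commute[of _ t])
    finally have "t * (2 * a) \<le> t * (t * b)" by (simp add: power2_eq_square)
    then have "2 * a \<le> t * b" using t(1) by simp
    also have "\<dots> \<le> t * (b + 1)" using t(1) by simp
    finally show False using t3 a by simp
  qed
  have "is_cone_proj \<mu> g X"
    unfolding is_cone_proj_def
  proof (intro conjI ballI)
    show "X \<in> ?K" by fact
    show v: "(LINT y|\<mu>. (g y - X y) * u y) \<le> 0" if "u \<in> ?K" for u
      using that by (intro var mono_cone_L2 mono_cone_add mono_cone_cmult XK) auto
    have "(LINT y|\<mu>. (g y - X y) * (- X y)) \<le> 0"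
    proof (rule var)
      show "(\<lambda>y. - X y) \<in> L2 \<mu>" using L2_cmult[OF XL, of "-1"] by simp
      fix t :: real assume "0 < t" "t \<le> 1"
      then have "(\<lambda>y. (1 - t) * X y) \<in> ?K" by (intro mono_cone_cmult XK) simp
      then show "(\<lambda>y. X y + t * - X y) \<in> ?K" by (simp add: left_diff_distrib)
    qed
    then show "(LINT y|\<mu>. (g y - X y) * X y) = 0" using v[OF XK] by simp
  qed
  then show thesis by (rule that)
qed

section \<open>The projection as a conditional expectation\<close>

lemma cone_proj_integral_Lipschitz:
  assumes fm: "finite_measure \<mu>" and g: "g \<in> L2 \<mu>" and p: "is_cone_proj \<mu> g X"
    and \<phi>: "\<phi> \<in> borel_measurable borel" "\<And>x. \<bar>\<phi> x\<bar> \<le> B" "L > 0" 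
    and lip: "\<And>x y. x \<le> y \<Longrightarrow> \<bar>\<phi> y - \<phi> x\<bar> \<le> L * (y - x)"
  shows "(LINT y|\<mu>. (g y - X y) * \<phi> (X y)) = 0"
proof -
  have X: "X \<in> L2 \<mu>" "ae_mono \<mu> X" using p by (auto simp: is_cone_proj_def mono_cone_def)
  note [measurable] = L2_measurable[OF X(1)] \<phi>(1)
  have \<phi>L: "(\<lambda>y. \<phi> (X y)) \<in> L2 \<mu>" using \<phi>(2) by (intro L2_bounded[OF fm, of _ B]) auto
  have 1: "s * (LINT y|\<mu>. (g y - X y) * \<phi> (X y)) \<le> 0" if s: "\<bar>s\<bar> = 1" for s
  proof -
    \<comment> \<open>For both signs s, the map \<open>x + s / L * \<phi> x\<close> is nondecreasing
      because \<open>\<phi>\<close> is L-Lipschitz. So \<open>X\<close> may be perturbed by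
      \<open>\<phi> (X y)\<close> in both directions inside the cone, which turns the variational
      inequality into an equation.\<close>
    have "(\<lambda>y. X y + s / L * \<phi> (X y)) \<in> mono_cone \<mu>"
      unfolding mono_cone_def
    proof (intro CollectI conjI L2_add L2_cmult X \<phi>L)
      have *: "a + s / L * \<phi> a \<le> c + s / L * \<phi> c" if "a \<le> c" for a c
      proof -
        have "s * (\<phi> a - \<phi> c) \<le> \<bar>s * (\<phi> a - \<phi> c)\<bar>" by (rule abs_ge_self)
        also have "\<dots> \<le> L * (c - a)" using lip[OF that] s by (simp add: abs_mult abs_minus_commute)
        finally have "s * (\<phi> a - \<phi> c) / L \<le> c - a"
          using \<phi>(3) by (simp add: pos_divide_le_eq mult.commute)
        moreover have "s / L * \<phi> a - s / L * \<phi> c = s * (\<phi> a - \<phi> c) / L"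
          by (simp add: diff_divide_distrib right_diff_distrib)
        ultimately show ?thesis by linarith
      qed
      show "ae_mono \<mu> (\<lambda>y. X y + s / L * \<phi> (X y))"
        by (rule ae_mono_map2[where F="\<lambda>a _. a + s / L * \<phi> a", OF X(2) X(2)]) (rule *)
    qed
    then have "(LINT y|\<mu>. (g y - X y) * (X y + s / L * \<phi> (X y))) \<le> 0" by (rule is_cone_projD(3)[OF p])
    also have "(LINT y|\<mu>. (g y - X y) * (X y + s / L * \<phi> (X y))) =
        (LINT y|\<mu>. (g y - X y) * X y + s / L * ((g y - X y) * \<phi> (X y)))"
      by (intro Bochner_Integration.integral_cong) (auto simp: distrib_left mult.left_commute)
    also have "\<dots> = s / L * (LINT y|\<mu>. (g y - X y) * \<phi> (X y))"
      using is_cone_projD(4)[OF p] L2_mult_integrable[OF L2_diff[OF g X(1)] X(1)]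
        L2_mult_integrable[OF L2_diff[OF g X(1)] \<phi>L]
      by (subst Bochner_Integration.integral_add) auto
    finally show ?thesis using \<phi>(3) by (simp add: divide_le_0_iff)
  qed
  from 1[of 1] 1[of "-1"] show ?thesis by simp
qed

lemma cone_proj_integral_greaterThan:
  assumes fm: "finite_measure \<mu>" and g: "g \<in> L2 \<mu>" and p: "is_cone_proj \<mu> g X"
  shows "(LINT y|\<mu>. (g y - X y) * indicator {c<..} (X y)) = 0"
proof -
  have X: "X \<in> L2 \<mu>" using p by (auto simp: is_cone_proj_def mono_cone_def)
  note [measurable] = L2_measurable[OF X] L2_measurable[OF g]
  \<comment> \<open>Ramps that rise from 0 at \<open>c\<close> with slope n + 1 and are cut off at
    1. They vanish up to \<open>c\<close>, so their limit is the indicator of the open half-line;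
    the slope serves as the Lipschitz constant and is positive already for n = 0.\<close>
  define \<phi> where "\<phi> n x = min 1 (max 0 (real (Suc n) * (x - c)))" for n x
  have "(\<lambda>n. LINT y|\<mu>. (g y - X y) * \<phi> n (X y)) \<longlonglongrightarrow> (LINT y|\<mu>. (g y - X y) * indicator {c<..} (X y))"
  proof (rule integral_dominated_convergence)
    show "integrable \<mu> (\<lambda>y. \<bar>g y - X y\<bar>)" using L2_integrable[OF fm L2_diff[OF g X]] by simp
    show "AE y in \<mu>. (\<lambda>n. (g y - X y) * \<phi> n (X y)) \<longlonglongrightarrow> (g y - X y) * indicator {c<..} (X y)"
    proof (intro AE_I2 tendsto_mult_left)
      fix y
      show "(\<lambda>n. \<phi> n (X y)) \<longlonglongrightarrow> indicator {c<..} (X y)"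
      proof (cases "X y > c")
        case True
        obtain N where "1 / (X y - c) < real N" using reals_Archimedean2 by blast
        then have "\<phi> n (X y) = 1" if "n \<ge> N" for n
        proof -
          have "1 \<le> real (Suc n) * (X y - c)"
          proof -
            have "1 = 1 / (X y - c) * (X y - c)" using True by simp
            also have "\<dots> \<le> real (Suc n) * (X y - c)"
              using \<open>1 / (X y - c) < real N\<close> \<open>n \<ge> N\<close> True by (intro mult_right_mono) auto
            finally show ?thesis .
          qed
          then show ?thesis by (simp add: \<phi>_def)
        qed
        then have "eventually (\<lambda>n. \<phi> n (X y) = indicator {c<..} (X y)) sequentially"
          using True by (auto simp: eventually_sequentially)
        then show ?thesis by (rule tendsto_eventually)
      next
        case False
        then have "real (Suc n) * (X y - c) \<le> 0" for n by (intro mult_nonneg_nonpos) auto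
        then have "\<phi> n (X y) = 0" for n unfolding \<phi>_def by (subst max_absorb1) auto
        then show ?thesis using False by simp
      qed
    qed
    show "AE y in \<mu>. norm ((g y - X y) * \<phi> n (X y)) \<le> \<bar>g y - X y\<bar>" for n
      by (auto simp: abs_mult \<phi>_def intro!: mult_left_le)
  qed (auto simp: \<phi>_def)
  moreover have "(LINT y|\<mu>. (g y - X y) * \<phi> n (X y)) = 0" for n
  proof (rule cone_proj_integral_Lipschitz[OF fm g p, where B=1 and L="real (Suc n)"])
    show "\<bar>\<phi> n y - \<phi> n x\<bar> \<le> real (Suc n) * (y - x)" if "x \<le> y" for x y
    proof -
      have "real (Suc n) * (x - c) \<le> real (Suc n) * (y - c)" using that by (intro mult_left_mono) auto
      then have "\<bar>\<phi> n y - \<phi> n x\<bar> \<le> real (Suc n) * (y - c) - real (Suc n) * (x - c)"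
        unfolding \<phi>_def by linarith
      then show ?thesis by (simp add: right_diff_distrib)
    qed
  qed (auto simp: \<phi>_def)
  ultimately show ?thesis by (simp add: LIMSEQ_const_iff)
qed

lemma cone_proj_integral_indicator:
  assumes fm: "finite_measure \<mu>" and g: "g \<in> L2 \<mu>" and p: "is_cone_proj \<mu> g X" and B: "B \<in> sets borel"
  shows "(LINT y|\<mu>. (g y - X y) * indicator B (X y)) = 0"
proof -
  have X: "X \<in> L2 \<mu>" using p by (auto simp: is_cone_proj_def mono_cone_def)
  note [measurable] = L2_measurable[OF X] L2_measurable[OF g]
  have i: "integrable \<mu> (\<lambda>y. g y - X y)" using L2_integrable[OF fm L2_diff[OF g X]] by simp
  have iB: "integrable \<mu> (\<lambda>y. (g y - X y) * indicator B (X y))" if [measurable]: "B \<in> sets borel" for B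
    by (rule Bochner_Integration.integrable_bound[OF i]) (auto simp: indicator_def)
  have tot: "(LINT y|\<mu>. g y - X y) = 0"
    using cone_proj_integral_Lipschitz[OF fm g p, where \<phi>="\<lambda>_. 1" and B=1 and L=1] by simp
  have sb: "sets (borel :: real measure) = sigma_sets UNIV (range greaterThan)"
    by (subst borel_Ioi) (auto simp: sets_measure_of)
  then have BB: "B \<in> sigma_sets UNIV (range greaterThan)" using B by simp
  have "Int_stable (range (greaterThan :: real \<Rightarrow> real set))"
  proof (rule Int_stableI)
    fix A B :: "real set" assume "A \<in> range greaterThan" "B \<in> range greaterThan"
    then obtain a b where "A = {a<..}" "B = {b<..}" by auto
    then have "A \<inter> B = {max a b<..}" by auto
    then show "A \<inter> B \<in> range greaterThan" by simp
  qed
  moreover have "range (greaterThan :: real \<Rightarrow> real set) \<subseteq> Pow UNIV" by simp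
  from \<open>Int_stable _\<close> this BB show ?thesis
  proof (induction rule: sigma_sets_induct_disjoint)
    case (basic A)
    then show ?case using cone_proj_integral_greaterThan[OF fm g p] by auto
  next
    case (compl A)
    then have A: "A \<in> sets borel" by (simp add: sb)
    have "(LINT y|\<mu>. (g y - X y) * indicator (UNIV - A) (X y)) =
        (LINT y|\<mu>. (g y - X y) - (g y - X y) * indicator A (X y))"
      by (intro Bochner_Integration.integral_cong) (auto simp: indicator_def)
    also have "\<dots> = 0" using i iB[OF A] compl tot by (subst Bochner_Integration.integral_diff) auto
    finally show ?case .
  next
    case (union A)
    then have A: "A n \<in> sets borel" for n by (auto simp: sb)
    then have [measurable]: "(\<Union>n. A n) \<in> sets borel" by auto
    note [measurable] = A
    have "(\<lambda>n. LINT y|\<mu>. (g y - X y) * (\<Sum>k<n. indicator (A k) (X y))) \<longlonglongrightarrow> (LINT y|\<mu>. (g y - X y) * indicator (\<Union>n. A n) (X y))"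
    proof (rule integral_dominated_convergence)
      show "integrable \<mu> (\<lambda>y. \<bar>g y - X y\<bar>)" using i by simp
      show "AE y in \<mu>. (\<lambda>n. (g y - X y) * (\<Sum>k<n. indicator (A k) (X y))) \<longlonglongrightarrow> (g y - X y) * indicator (\<Union>n. A n) (X y)"
        using union(1) by (intro AE_I2 tendsto_mult_left) (simp add: indicator_sums[unfolded sums_def] disjoint_family_on_def)
      show "AE y in \<mu>. norm ((g y - X y) * (\<Sum>k<n. indicator (A k) (X y))) \<le> \<bar>g y - X y\<bar>" for n
      proof (intro AE_I2)
        fix y
        have "disjoint_family_on A {..<n}" using union(1) by (auto simp: disjoint_family_on_def)
        then have "(\<Sum>k<n. indicator (A k) (X y)) = (indicator (\<Union>k<n. A k) (X y) :: real)"
          by (rule indicator_UN_disjoint[OF finite_lessThan, symmetric])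
        then show "norm ((g y - X y) * (\<Sum>k<n. indicator (A k) (X y))) \<le> \<bar>g y - X y\<bar>"
          by (simp add: abs_mult mult_left_le)
      qed
    qed auto
    moreover have "(LINT y|\<mu>. (g y - X y) * (\<Sum>k<n. indicator (A k) (X y))) = 0" for n
      using iB[OF A] union by (subst sum_distrib_left, subst Bochner_Integration.integral_sum) auto
    ultimately show ?case by (simp add: LIMSEQ_const_iff)
  qed auto
qed

section \<open>The support and continuous representatives\<close>

lemma closed_msupp:
  assumes "finite_measure \<mu>" "sets \<mu> = sets borel"
  shows "closed (msupp \<mu>)"
  unfolding closed_def open_dist
proof
  interpret finite_measure \<mu> by fact
  fix y assume "y \<in> - msupp \<mu>"
  then obtain \<delta> where \<delta>: "\<delta> > 0" "measure \<mu> {y - \<delta><..<y + \<delta>} \<le> 0"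
    by (auto simp: msupp_def not_less)
  have "z \<in> - msupp \<mu>" if "dist z y < \<delta> / 2" for z
  proof -
    have "measure \<mu> {z - \<delta>/2<..<z + \<delta>/2} \<le> measure \<mu> {y - \<delta><..<y + \<delta>}"
      using that assms(2) by (intro finite_measure_mono) (auto simp: dist_real_def abs_if field_simps split: if_splits)
    then show ?thesis using \<delta> unfolding msupp_def
      by (auto simp: not_less intro!: exI[of _ "\<delta> / 2"])
  qed
  then show "\<exists>e>0. \<forall>z. dist z y < e \<longrightarrow> z \<in> - msupp \<mu>" using \<delta>(1) by (intro exI[of _ "\<delta> / 2"]) auto
qed

text \<open>A point off the support lies in an interval with rational end points and measure zero,
  and there are countably many of these.\<close>

lemma AE_msupp:
  assumes "finite_measure \<mu>" "sets \<mu> = sets borel"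
  shows "AE y in \<mu>. y \<in> msupp \<mu>"
proof -
  interpret finite_measure \<mu> by fact
  have "AE y in \<mu>. \<not> (measure \<mu> {real_of_rat p<..<real_of_rat q} = 0 \<and> y \<in> {real_of_rat p<..<real_of_rat q})" for p q
  proof (cases "measure \<mu> {real_of_rat p<..<real_of_rat q} = 0")
    case True
    then have "{real_of_rat p<..<real_of_rat q} \<in> null_sets \<mu>"
      using assms(2) by (auto simp: null_sets_def emeasure_eq_measure)
    then show ?thesis by (rule AE_not_in[THEN eventually_mono]) auto
  qed auto
  then have "AE y in \<mu>. \<forall>p q. \<not> (measure \<mu> {real_of_rat p<..<real_of_rat q} = 0 \<and> y \<in> {real_of_rat p<..<real_of_rat q})"
    unfolding AE_all_countable by blast
  then show ?thesis
  proof eventually_elim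
    case (elim y)
    show ?case
      unfolding msupp_def
    proof (intro CollectI allI impI)
      fix \<delta> :: real assume "\<delta> > 0"
      obtain p where p: "y - \<delta> < real_of_rat p" "real_of_rat p < y"
        using of_rat_dense[of "y - \<delta>" y] \<open>\<delta> > 0\<close> by auto
      obtain q where q: "y < real_of_rat q" "real_of_rat q < y + \<delta>"
        using of_rat_dense[of y "y + \<delta>"] \<open>\<delta> > 0\<close> by auto
      have "0 < measure \<mu> {real_of_rat p<..<real_of_rat q}"
        using elim p q measure_nonneg[of \<mu> "{real_of_rat p<..<real_of_rat q}"] by (auto simp: less_le)
      also have "\<dots> \<le> measure \<mu> {y - \<delta><..<y + \<delta>}"
        using p q assms(2) by (intro finite_measure_mono) auto
      finally show "0 < measure \<mu> {y - \<delta><..<y + \<delta>}" .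
    qed
  qed
qed

lemma msupp_dense:
  assumes y: "y \<in> msupp \<mu>" and G: "AE u in \<mu>. u \<in> G" and "\<delta> > 0" and s: "sets \<mu> = sets borel"
  shows "\<exists>u\<in>G. \<bar>u - y\<bar> < \<delta>"
proof (rule ccontr)
  assume *: "\<not> ?thesis"
  have "AE u in \<mu>. u \<notin> {y - \<delta><..<y + \<delta>}" using G
    by eventually_elim (use * in \<open>auto simp: abs_less_iff\<close>)
  then have "{y - \<delta><..<y + \<delta>} \<in> null_sets \<mu>"
    by (subst AE_iff_null_sets) (auto simp: s)
  then have "measure \<mu> {y - \<delta><..<y + \<delta>} = 0" by (simp add: null_sets_def measure_def)
  moreover have "measure \<mu> {y - \<delta><..<y + \<delta>} > 0" using y \<open>\<delta> > 0\<close> by (simp add: msupp_def)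
  ultimately show False by simp
qed

text \<open>A set of full measure is dense in the support, so points of \<open>G\<close> approximate
  z and y. Approximants within half of the gap \<open>y - z\<close> keep their order, and continuity
  carries the inequality over to z and y. This is how all almost everywhere comparisons become
  pointwise ones.\<close>

lemma ae_mono_continuous_imp_mono_on:
  assumes fm: "finite_measure \<mu>" and s: "sets \<mu> = sets borel"
    and m: "ae_mono \<mu> Z" and c: "continuous_on (msupp \<mu>) Z"
  shows "mono_on (msupp \<mu>) Z"
proof (rule mono_onI)
  obtain G where G: "AE y in \<mu>. y \<in> G" "mono_on G Z" using m by (auto simp: ae_mono_def)
  have GS: "AE y in \<mu>. y \<in> G \<inter> msupp \<mu>" using G(1) AE_msupp[OF fm s] by eventually_elim simp
  fix z y assume zy: "z \<in> msupp \<mu>" "y \<in> msupp \<mu>" "z \<le> y"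
  show "Z z \<le> Z y"
  proof (cases "z = y")
    case False
    show ?thesis
    proof (rule field_le_epsilon)
      fix e :: real assume "e > 0"
      then have e2: "e / 2 > 0" by simp
      obtain d1 where d1: "d1 > 0" "\<And>u. u \<in> msupp \<mu> \<Longrightarrow> dist u z < d1 \<Longrightarrow> dist (Z u) (Z z) < e / 2"
        using c zy(1) e2 unfolding continuous_on_iff by blast
      obtain d2 where d2: "d2 > 0" "\<And>u. u \<in> msupp \<mu> \<Longrightarrow> dist u y < d2 \<Longrightarrow> dist (Z u) (Z y) < e / 2"
        using c zy(2) e2 unfolding continuous_on_iff by blast
      define d where "d = (y - z) / 2"
      have d: "d > 0" using zy(3) False by (simp add: d_def)
      obtain u where u: "u \<in> G" "u \<in> msupp \<mu>" "\<bar>u - z\<bar> < min d d1"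
        using msupp_dense[OF zy(1) GS, of "min d d1"] d d1(1) s by auto
      obtain w where w: "w \<in> G" "w \<in> msupp \<mu>" "\<bar>w - y\<bar> < min d d2"
        using msupp_dense[OF zy(2) GS, of "min d d2"] d d2(1) s by auto
      have "\<bar>u - z\<bar> < d" "\<bar>w - y\<bar> < d" using u(3) w(3) by simp_all
      then have "u < z + d" "y - d < w" by (simp_all add: abs_less_iff)
      moreover have "z + d = y - d" by (simp add: d_def field_simps)
      ultimately have "u \<le> w" by linarith
      then have "Z u \<le> Z w" using mono_onD[OF G(2) u(1) w(1)] by simp
      moreover have "dist (Z u) (Z z) < e / 2" using u by (intro d1) (auto simp: dist_real_def)
      moreover have "dist (Z w) (Z y) < e / 2" using w by (intro d2) (auto simp: dist_real_def)
      ultimately show "Z z \<le> Z y + e" unfolding dist_real_def by linarith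
    qed
  qed simp
qed

text \<open>On a set \<open>D\<close> of full measure both \<open>X\<close> and \<open>l - X\<close>
  are nondecreasing, so increments of \<open>X\<close> are bounded by those of \<open>l\<close> and
  \<open>X\<close> inherits its modulus of uniform continuity. It therefore extends to the closure
  of \<open>D\<close>, which contains the support. The constant value off the support makes the
  representative Borel and lets it factor through a map into the support.\<close>

lemma ae_mono_continuous_version:
  assumes fm: "finite_measure \<mu>" and s: "sets \<mu> = sets borel"
    and X: "X \<in> borel_measurable \<mu>" "ae_mono \<mu> X" "ae_mono \<mu> (\<lambda>y. l y - X y)"
    and l: "uniformly_continuous_on UNIV (l :: real \<Rightarrow> real)" and y0: "y0 \<in> msupp \<mu>"
  obtains Z where "Z \<in> borel_measurable borel" "AE y in \<mu>. X y = Z y"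
    "continuous_on (msupp \<mu>) Z" "\<And>y. y \<notin> msupp \<mu> \<Longrightarrow> Z y = Z y0"
proof -
  let ?S = "msupp \<mu>"
  obtain G where G: "AE y in \<mu>. y \<in> G" "mono_on G X" using X(2) by (auto simp: ae_mono_def)
  obtain H where H: "AE y in \<mu>. y \<in> H" "mono_on H (\<lambda>y. l y - X y)" using X(3) by (auto simp: ae_mono_def)
  define D where "D = G \<inter> H"
  have D: "AE y in \<mu>. y \<in> D" using G(1) H(1) by eventually_elim (simp add: D_def)
  have le: "\<bar>X y - X z\<bar> \<le> \<bar>l y - l z\<bar>" if "y \<in> D" "z \<in> D" "z \<le> y" for y z
    using mono_onD[OF G(2), of z y] mono_onD[OF H(2), of z y] that by (auto simp: D_def)
  have "uniformly_continuous_on D X"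
    unfolding uniformly_continuous_on_def
  proof (intro allI impI)
    fix e :: real assume "e > 0"
    then have "\<exists>d>0. \<forall>x x'. dist x' x < d \<longrightarrow> dist (l x') (l x) < e"
      using l unfolding uniformly_continuous_on_def by simp
    then obtain d where d: "d > 0" "\<And>x x'. dist x' x < d \<Longrightarrow> dist (l x') (l x) < e" by auto
    have "dist (X x') (X x) < e" if "x \<in> D" "x' \<in> D" "dist x' x < d" for x x'
    proof -
      have "\<bar>X x' - X x\<bar> \<le> \<bar>l x' - l x\<bar>"
      proof (cases "x \<le> x'")
        case True
        from le[OF that(2,1) this] show ?thesis .
      next
        case False
        then have "x' \<le> x" by simp
        from le[OF that(1,2) this] show ?thesis by (simp add: abs_minus_commute)
      qed
      then show ?thesis using d(2)[OF that(3)] by (simp add: dist_real_def)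
    qed
    then show "\<exists>d>0. \<forall>x\<in>D. \<forall>x'\<in>D. dist x' x < d \<longrightarrow> dist (X x') (X x) < e" using d(1) by blast
  qed
  then obtain g where g: "uniformly_continuous_on (closure D) g" "\<And>x. x \<in> D \<Longrightarrow> X x = g x"
    by (rule uniformly_continuous_on_extension_on_closure) (rule that, assumption, assumption)
  have SD: "?S \<subseteq> closure D"
  proof
    fix y assume "y \<in> ?S"
    then show "y \<in> closure D"
      using msupp_dense[OF _ D _ s] by (auto simp: closure_approachable dist_real_def)
  qed
  have cg: "continuous_on ?S g"
    using continuous_on_subset[OF uniformly_continuous_imp_continuous[OF g(1)] SD] .
  have Sb: "?S \<in> sets borel" using closed_msupp[OF fm s] by (rule borel_closed)
  define Z where "Z y = (if y \<in> ?S then g y else g y0)" for y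
  show thesis
  proof
    have "(\<lambda>y. indicator ?S y *\<^sub>R g y + indicator (- ?S) y * g y0) \<in> borel_measurable borel"
      using Sb by (intro borel_measurable_add borel_measurable_continuous_on_indicator[OF Sb cg]) auto
    also have "(\<lambda>y. indicator ?S y *\<^sub>R g y + indicator (- ?S) y * g y0) = Z" by (auto simp: Z_def)
    finally show "Z \<in> borel_measurable borel" .
    show "AE y in \<mu>. X y = Z y" using D AE_msupp[OF fm s] by eventually_elim (simp add: Z_def g(2))
    show "continuous_on ?S Z" using cg by (rule continuous_on_eq) (simp add: Z_def)
    show "\<And>y. y \<notin> ?S \<Longrightarrow> Z y = Z y0" using y0 by (simp add: Z_def)
  qed
qed

section \<open>Decreasing filtrations\<close>

locale decreasing_filtration = prob_space \<mu> for \<mu> :: "real measure" +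
  fixes F :: "real \<Rightarrow> real measure"
  assumes sub: "0 \<le> t \<Longrightarrow> subalgebra \<mu> (F t)"
    and dec: "0 \<le> s \<Longrightarrow> s \<le> t \<Longrightarrow> subalgebra (F s) (F t)"
begin

abbreviation "E t Z \<equiv> real_cond_exp \<mu> (F t) Z"

definition L2F :: "real \<Rightarrow> (real \<Rightarrow> real) set" where
  "L2F t = L2 \<mu> \<inter> borel_measurable (F t)"

lemma L2F_L2: "k \<in> L2F t \<Longrightarrow> k \<in> L2 \<mu>" by (simp add: L2F_def)

lemma L2F_mono: "0 \<le> s \<Longrightarrow> s \<le> t \<Longrightarrow> k \<in> L2F t \<Longrightarrow> k \<in> L2F s"
  using measurable_from_subalg[OF dec] by (auto simp: L2F_def)

lemma L2F_diff: "f \<in> L2F t \<Longrightarrow> g \<in> L2F t \<Longrightarrow> (\<lambda>y. f y - g y) \<in> L2F t"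
  by (auto simp: L2F_def intro!: L2_diff borel_measurable_diff)

lemma L2F_cmult: "f \<in> L2F t \<Longrightarrow> (\<lambda>y. c * f y) \<in> L2F t"
  by (auto simp: L2F_def intro!: L2_cmult borel_measurable_times)

lemma E_L2F:
  assumes t: "0 \<le> t" and Z: "Z \<in> L2 \<mu>"
  shows "E t Z \<in> L2F t"
proof -
  interpret S: finite_measure_subalgebra \<mu> "F t" by unfold_locales (rule sub[OF t])
  have "integrable \<mu> (\<lambda>y. (E t Z y)\<^sup>2)"
  proof (rule S.integrable_convex_cond_exp[where I=UNIV])
    show "integrable \<mu> Z" using L2_integrable[OF finite_measure_axioms Z] .
    show "convex_on UNIV (\<lambda>x :: real. x\<^sup>2)" by (rule convex_power2)
  qed (use L2_integrable_power2[OF Z] emeasure_space_1 in auto)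
  then show ?thesis by (simp add: L2F_def L2_def)
qed

lemma E_L2: "0 \<le> t \<Longrightarrow> Z \<in> L2 \<mu> \<Longrightarrow> E t Z \<in> L2 \<mu>" by (rule L2F_L2[OF E_L2F])

lemma E_inner:
  assumes t: "0 \<le> t" and Z: "Z \<in> L2 \<mu>" and k: "k \<in> L2F t"
  shows "(LINT y|\<mu>. k y * E t Z y) = (LINT y|\<mu>. k y * Z y)"
proof -
  interpret S: finite_measure_subalgebra \<mu> "F t" by unfold_locales (rule sub[OF t])
  show ?thesis
    using L2_mult_integrable[OF L2F_L2[OF k] Z] k L2_measurable[OF Z]
    by (intro S.real_cond_exp_intg) (auto simp: L2F_def)
qed

lemma E_orth:
  assumes t: "0 \<le> t" and Z: "Z \<in> L2 \<mu>" and k: "k \<in> L2F t"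
  shows "(LINT y|\<mu>. (Z y - E t Z y) * k y) = 0"
proof -
  have "(LINT y|\<mu>. (Z y - E t Z y) * k y) = (LINT y|\<mu>. k y * Z y - k y * E t Z y)"
    by (intro Bochner_Integration.integral_cong) (auto simp: algebra_simps)
  also have "\<dots> = 0"
    using E_inner[OF assms] L2_mult_integrable[OF L2F_L2[OF k] Z] L2_mult_integrable[OF L2F_L2[OF k] E_L2[OF t Z]]
    by simp
  finally show ?thesis .
qed

lemma E_best:
  assumes t: "0 \<le> t" and Z: "Z \<in> L2 \<mu>" and k: "k \<in> L2F t"
  shows "L2norm \<mu> (\<lambda>y. Z y - E t Z y) \<le> L2norm \<mu> (\<lambda>y. Z y - k y)"
proof -
  have e: "(\<lambda>y. E t Z y - k y) \<in> L2F t" by (intro L2F_diff E_L2F t Z k)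
  have "(LINT y|\<mu>. (Z y - k y)\<^sup>2) = (LINT y|\<mu>. ((Z y - E t Z y) + (E t Z y - k y))\<^sup>2)" by simp
  also have "\<dots> = (LINT y|\<mu>. (Z y - E t Z y)\<^sup>2) + (LINT y|\<mu>. (E t Z y - k y)\<^sup>2)"
    using L2_power2_add[OF L2_diff[OF Z E_L2[OF t Z]] L2F_L2[OF e]] E_orth[OF t Z e] by simp
  also have "\<dots> \<ge> (LINT y|\<mu>. (Z y - E t Z y)\<^sup>2)" by simp
  finally show ?thesis by (simp add: L2norm_def)
qed

lemma E_norm: "0 \<le> t \<Longrightarrow> Z \<in> L2 \<mu> \<Longrightarrow> L2norm \<mu> (E t Z) \<le> L2norm \<mu> Z"
proof -
  assume t: "0 \<le> t" and Z: "Z \<in> L2 \<mu>"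
  have "(L2norm \<mu> (E t Z))\<^sup>2 = (LINT y|\<mu>. E t Z y * Z y)"
    using E_inner[OF t Z E_L2F[OF t Z]] unfolding L2norm_power2 by (simp add: power2_eq_square)
  also have "\<dots> \<le> L2norm \<mu> (E t Z) * L2norm \<mu> Z"
    using L2_Cauchy_Schwarz[OF E_L2[OF t Z] Z] by simp
  finally have *: "L2norm \<mu> (E t Z) * L2norm \<mu> (E t Z) \<le> L2norm \<mu> (E t Z) * L2norm \<mu> Z"
    by (simp add: power2_eq_square)
  show ?thesis
  proof (cases "L2norm \<mu> (E t Z) = 0")
    case False
    then have "0 < L2norm \<mu> (E t Z)" using L2norm_nonneg[of \<mu> "E t Z"] by linarith
    with * show ?thesis by (rule mult_left_le_imp_le)
  qed simp
qed

lemma E_Pythagoras: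
  assumes s: "0 \<le> s" "s \<le> t" and Z: "Z \<in> L2 \<mu>"
  shows "(LINT y|\<mu>. (E s Z y - E t Z y)\<^sup>2) = (LINT y|\<mu>. (E s Z y)\<^sup>2) - (LINT y|\<mu>. (E t Z y)\<^sup>2)"
proof -
  have t: "0 \<le> t" using s by simp
  note kt = E_L2F[OF t Z]
  have "(LINT y|\<mu>. E t Z y * E s Z y) = (LINT y|\<mu>. (E t Z y)\<^sup>2)"
    using E_inner[OF s(1) Z L2F_mono[OF s kt]] E_inner[OF t Z kt] by (simp add: power2_eq_square)
  then show ?thesis using L2_power2_diff[OF E_L2[OF s(1) Z] E_L2[OF t Z]] by (simp add: mult.commute)
qed

text \<open>By Pythagoras the distance between \<open>E r Z\<close> and \<open>E t Z\<close> is the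
  square root of the increment of the nonincreasing function \<open>N t\<close>, the squared norm of
  \<open>E t Z\<close>. A monotone function has only countably many discontinuities.\<close>

lemma E_continuous_off_countable:
  assumes Z: "Z \<in> L2 \<mu>"
  obtains D where "countable D" "\<And>t. 0 < t \<Longrightarrow> t \<notin> D \<Longrightarrow>
    ((\<lambda>r. L2norm \<mu> (\<lambda>y. E r Z y - E t Z y)) \<longlongrightarrow> 0) (at t)"
proof -
  define N where "N t = (LINT y|\<mu>. (E t Z y)\<^sup>2)" for t
  have anti: "N t \<le> N s" if "0 \<le> s" "s \<le> t" for s t
  proof -
    have "0 \<le> (LINT y|\<mu>. (E s Z y - E t Z y)\<^sup>2)" by simp
    then show ?thesis unfolding E_Pythagoras[OF that Z] N_def by simp
  qed
  have "mono_on {0<..} (\<lambda>t. - N t)" using anti by (intro mono_onI) auto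
  then have "countable {t \<in> {0<..}. \<not> isCont (\<lambda>t. - N t) t}"
    by (intro mono_on_ctble_discont_open) auto
  then show thesis
  proof (rule that)
    fix t :: real assume t: "0 < t" "t \<notin> {t \<in> {0<..}. \<not> isCont (\<lambda>t. - N t) t}"
    then have "isCont (\<lambda>t. - N t) t" by auto
    then have "((\<lambda>r. - N r) \<longlongrightarrow> - N t) (at t)" unfolding isCont_def .
    then have "((\<lambda>r. sqrt \<bar>- N r - - N t\<bar>) \<longlongrightarrow> sqrt \<bar>- N t - - N t\<bar>) (at t)"
      by (intro tendsto_real_sqrt tendsto_rabs tendsto_diff[OF _ tendsto_const])
    then have lim: "((\<lambda>r. sqrt \<bar>N t - N r\<bar>) \<longlongrightarrow> 0) (at t)" by simp
    have "eventually (\<lambda>r. r \<in> {0<..}) (at t)" using t(1) by (intro eventually_at_in_open') auto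
    then have "eventually (\<lambda>r. sqrt \<bar>N t - N r\<bar> = L2norm \<mu> (\<lambda>y. E r Z y - E t Z y)) (at t)"
    proof eventually_elim
      case (elim r)
      show ?case
      proof (cases "r \<le> t")
        case True
        then show ?thesis using elim E_Pythagoras[of r t, OF _ _ Z] anti[of r t]
          by (simp add: L2norm_def N_def)
      next
        case False
        then show ?thesis using t(1) E_Pythagoras[of t r, OF _ _ Z] anti[of t r]
          by (simp add: L2norm_def N_def power2_commute[of "E r Z _"])
      qed
    qed
    from tendsto_cong[OF this] lim
    show "((\<lambda>r. L2norm \<mu> (\<lambda>y. E r Z y - E t Z y)) \<longlongrightarrow> 0) (at t)" by simp
  qed
qed

end

section \<open>Motion along a decreasing filtration\<close>

lemma L2norm_orthogonal_sum:
  assumes "finite I" "\<And>i. i \<in> I \<Longrightarrow> f i \<in> L2 \<mu>"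
    and "\<And>i j. i \<in> I \<Longrightarrow> j \<in> I \<Longrightarrow> i \<noteq> j \<Longrightarrow> (LINT y|\<mu>. f i y * f j y) = 0"
  shows "(L2norm \<mu> (\<lambda>y. \<Sum>i\<in>I. f i y))\<^sup>2 = (\<Sum>i\<in>I. (L2norm \<mu> (f i))\<^sup>2)"
  using assms
proof (induction I rule: finite_induct)
  case empty
  then show ?case by (simp add: L2norm_def)
next
  case (insert i I)
  have L: "f i \<in> L2 \<mu>" "(\<lambda>y. \<Sum>i\<in>I. f i y) \<in> L2 \<mu>" using insert by (auto intro!: L2_sum)
  have "(LINT y|\<mu>. f i y * (\<Sum>j\<in>I. f j y)) = (\<Sum>j\<in>I. LINT y|\<mu>. f i y * f j y)"
    using insert by (simp add: sum_distrib_left L2_mult_integrable)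
  also have "\<dots> = 0" using insert by (intro sum.neutral) auto
  finally show ?case using insert L2_power2_add[OF L] by (simp add: L2norm_power2)
qed

text \<open>This isolates what the time evolution uses of the cone projection: by \<open>X\<close>
  and \<open>proj\<close>, \<open>X t\<close> is the conditional expectation of the free motion
  given \<open>F t\<close>, and by \<open>contr\<close> its increments are bounded by those of the
  free motion.\<close>

locale projected_flow = decreasing_filtration +
  fixes X :: "real \<Rightarrow> real \<Rightarrow> real" and x0 v A :: "real \<Rightarrow> real"
  assumes L: "x0 \<in> L2 \<mu>" "v \<in> L2 \<mu>" "A \<in> L2 \<mu>"
    and X: "0 \<le> t \<Longrightarrow> X t \<in> L2F t"
    and proj: "0 \<le> t \<Longrightarrow> k \<in> L2F t \<Longrightarrow>
      (LINT y|\<mu>. k y * X t y) = (LINT y|\<mu>. k y * (x0 y + t * v y - t\<^sup>2 / 2 * A y))"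
    and contr: "0 \<le> s \<Longrightarrow> 0 \<le> t \<Longrightarrow> L2norm \<mu> (\<lambda>y. X t y - X s y) \<le>
      L2norm \<mu> (\<lambda>y. (t - s) * v y - (t\<^sup>2 - s\<^sup>2) / 2 * A y)"
begin

definition V :: "real \<Rightarrow> real \<Rightarrow> real" where
  "V t y = E t v y - t * E t A y"

lemma XL: "0 \<le> t \<Longrightarrow> X t \<in> L2 \<mu>" by (rule L2F_L2[OF X])

lemma V_L2F: "0 \<le> t \<Longrightarrow> V t \<in> L2F t"
  unfolding V_def by (intro L2F_diff L2F_cmult E_L2F L)

lemma VL: "0 \<le> t \<Longrightarrow> V t \<in> L2 \<mu>" by (rule L2F_L2[OF V_L2F])

lemma V_inner:
  assumes t: "0 \<le> t" and k: "k \<in> L2F t"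
  shows "(LINT y|\<mu>. k y * V t y) = (LINT y|\<mu>. k y * v y) - t * (LINT y|\<mu>. k y * A y)"
proof -
  note i = L2_mult_integrable[OF L2F_L2[OF k]]
  have "(LINT y|\<mu>. k y * V t y) = (LINT y|\<mu>. k y * E t v y - t * (k y * E t A y))"
    by (intro Bochner_Integration.integral_cong) (auto simp: V_def algebra_simps)
  also have "\<dots> = (LINT y|\<mu>. k y * E t v y) - t * (LINT y|\<mu>. k y * E t A y)"
    using i[OF E_L2[OF t L(2)]] i[OF E_L2[OF t L(3)]] by simp
  finally show ?thesis using E_inner[OF t L(2) k] E_inner[OF t L(3) k] by simp
qed

text \<open>A preliminary bound whose constant grows with the time horizon. It suffices for
  estimating the martingale differences; the uniform constant has to wait for the decay of the
  energy.\<close>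

lemma X_Lipschitz_on:
  assumes "0 \<le> s" "s \<le> t" "t \<le> T"
  shows "L2norm \<mu> (\<lambda>y. X t y - X s y) \<le> (L2norm \<mu> v + T * L2norm \<mu> A) * (t - s)"
proof -
  have "L2norm \<mu> (\<lambda>y. X t y - X s y) \<le> L2norm \<mu> (\<lambda>y. (t - s) * v y + (- ((t\<^sup>2 - s\<^sup>2) / 2)) * A y)"
    using contr[of s t] assms by simp
  also have "\<dots> \<le> L2norm \<mu> (\<lambda>y. (t - s) * v y) + L2norm \<mu> (\<lambda>y. (- ((t\<^sup>2 - s\<^sup>2) / 2)) * A y)"
    by (intro L2norm_triangle L2_cmult L)
  also have "\<dots> = (t - s) * L2norm \<mu> v + \<bar>(t\<^sup>2 - s\<^sup>2) / 2\<bar> * L2norm \<mu> A"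
    unfolding L2norm_cmult using assms by simp
  also have "\<bar>(t\<^sup>2 - s\<^sup>2) / 2\<bar> \<le> (t - s) * T"
  proof -
    have "t\<^sup>2 - s\<^sup>2 = (t - s) * (t + s)" by (simp add: power2_eq_square algebra_simps)
    moreover have "(t - s) * (t + s) \<le> (t - s) * (2 * T)" using assms by (intro mult_left_mono) auto
    moreover have "0 \<le> (t - s) * (t + s)" using assms by simp
    ultimately show ?thesis by simp
  qed
  finally show ?thesis by (simp add: algebra_simps mult_right_mono)
qed

text \<open>A test function measurable for \<open>F t\<close> is also measurable for
  \<open>F s\<close>, so \<open>proj\<close> applies to it at both times and x0 cancels. The
  remaining coefficient of \<open>A\<close> is rewritten with
  \<open>(t^2 - s^2) / 2 = t * (t - s) - (t - s)^2 / 2\<close>, whose first term belongs to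
  \<open>(t - s) * V t\<close>. The discrepancy \<open>D\<close> is itself a test function, hence
  zero.\<close>

lemma step_identity:
  assumes s: "0 \<le> s" "s \<le> t"
  shows "AE y in \<mu>. X t y - E t (X s) y = (t - s) * V t y + (t - s)\<^sup>2 / 2 * E t A y"
proof -
  have t: "0 \<le> t" using s by simp
  define D where "D y = (X t y - E t (X s) y) - ((t - s) * V t y + (t - s)\<^sup>2 / 2 * E t A y)" for y
  have D: "D \<in> L2F t"
    unfolding D_def
    by (intro L2F_diff L2F_cmult X V_L2F E_L2F t L XL s)
      (use L2F_diff[OF L2F_cmult[OF V_L2F[OF t], of "t - s"] L2F_cmult[OF E_L2F[OF t L(3)], of "- ((t - s)\<^sup>2 / 2)"]] in simp)
  have zero: "(LINT y|\<mu>. k y * D y) = 0" if k: "k \<in> L2F t" for k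
  proof -
    note i = L2_mult_integrable[OF L2F_L2[OF k]]
    note ii = i[OF XL[OF t]] i[OF E_L2[OF t XL[OF s(1)]]] i[OF VL[OF t]] i[OF E_L2[OF t L(3)]] i[OF L(1)] i[OF L(2)] i[OF L(3)]
    have e: "(LINT y|\<mu>. k y * (x0 y + r * v y - r\<^sup>2 / 2 * A y)) =
        (LINT y|\<mu>. k y * x0 y) + r * (LINT y|\<mu>. k y * v y) - r\<^sup>2 / 2 * (LINT y|\<mu>. k y * A y)" for r
    proof -
      have "(LINT y|\<mu>. k y * (x0 y + r * v y - r\<^sup>2 / 2 * A y)) =
          (LINT y|\<mu>. k y * x0 y + r * (k y * v y) - r\<^sup>2 / 2 * (k y * A y))"
        by (intro Bochner_Integration.integral_cong) (auto simp: algebra_simps)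
      also have "\<dots> = (LINT y|\<mu>. k y * x0 y) + r * (LINT y|\<mu>. k y * v y) - r\<^sup>2 / 2 * (LINT y|\<mu>. k y * A y)"
        using ii by (subst Bochner_Integration.integral_diff Bochner_Integration.integral_add, simp, simp)+ simp
      finally show ?thesis .
    qed
    have "(LINT y|\<mu>. k y * D y) = (LINT y|\<mu>. k y * X t y - k y * E t (X s) y -
        ((t - s) * (k y * V t y) + (t - s)\<^sup>2 / 2 * (k y * E t A y)))"
      unfolding D_def by (intro Bochner_Integration.integral_cong) (auto simp: algebra_simps)
    also have "\<dots> = (LINT y|\<mu>. k y * X t y) - (LINT y|\<mu>. k y * E t (X s) y) -
        ((t - s) * (LINT y|\<mu>. k y * V t y) + (t - s)\<^sup>2 / 2 * (LINT y|\<mu>. k y * E t A y))"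
      using ii by simp
    also have "\<dots> = 0"
      unfolding proj[OF t k] E_inner[OF t XL[OF s(1)] k] proj[OF s(1) L2F_mono[OF s k]]
        V_inner[OF t k] E_inner[OF t L(3) k] e
      by (simp add: power2_eq_square field_simps)
    finally show ?thesis .
  qed
  have "(LINT y|\<mu>. (D y)\<^sup>2) = 0" using zero[OF D] by (simp add: power2_eq_square)
  then have "AE y in \<mu>. (D y)\<^sup>2 = 0"
    using L2_integrable_power2[OF L2F_L2[OF D]] by (subst (asm) integral_nonneg_eq_0_iff_AE) auto
  then show ?thesis by eventually_elim (simp add: D_def)
qed

definition mesh :: "real \<Rightarrow> real \<Rightarrow> nat \<Rightarrow> nat \<Rightarrow> real" where
  "mesh s t n i = s + real i * ((t - s) / real n)"

text \<open>The error of a Riemann sum for the increment of \<open>X\<close>. The sum takes right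
  end points because \<open>step_identity\<close> conditions on the later, smaller
  \<sigma>-algebra.\<close>

definition remainder :: "real \<Rightarrow> real \<Rightarrow> nat \<Rightarrow> real \<Rightarrow> real" where
  "remainder s t n y = X t y - X s y - (\<Sum>i<n. (t - s) / real n * V (mesh s t n (Suc i)) y)"

lemma mesh:
  assumes "s \<le> t" "0 < n"
  shows "mesh s t n 0 = s" "mesh s t n n = t" "mesh s t n (Suc i) - mesh s t n i = (t - s) / real n"
    "i \<le> j \<Longrightarrow> mesh s t n i \<le> mesh s t n j" "s \<le> mesh s t n i" "i \<le> n \<Longrightarrow> mesh s t n i \<le> t"
proof -
  show m: "i \<le> j \<Longrightarrow> mesh s t n i \<le> mesh s t n j" for i j
    using assms unfolding mesh_def by (intro add_left_mono mult_right_mono divide_nonneg_nonneg) auto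
  show 0: "mesh s t n 0 = s" by (simp add: mesh_def)
  show n: "mesh s t n n = t" using assms by (simp add: mesh_def)
  show "mesh s t n (Suc i) - mesh s t n i = (t - s) / real n"
    unfolding mesh_def of_nat_Suc distrib_right by simp
  show "s \<le> mesh s t n i" using m[of 0 i] 0 by simp
  show "i \<le> n \<Longrightarrow> mesh s t n i \<le> t" using m[of i n] n by simp
qed

lemma remainder_L2:
  assumes "0 \<le> s" "s \<le> t" "0 < n"
  shows "remainder s t n \<in> L2 \<mu>"
  unfolding remainder_def using assms
  by (intro L2_diff L2_sum L2_cmult XL VL order_trans[OF assms(1) mesh(5)]) auto

text \<open>The martingale differences \<open>X(r\<^sub>i) - E(X(r\<^sub>i) | F(r\<^sub>i\<^sub>+\<^sub>1))\<close> are pairwise orthogonal, so their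
  sum over a mesh of width \<open>\<delta>\<close> is only of size \<open>\<surd>\<delta>\<close>.\<close>

lemma remainder_bound:
  assumes s: "0 \<le> s" "s \<le> t" and n: "0 < n"
  shows "L2norm \<mu> (remainder s t n) \<le>
    ((t - s)\<^sup>2 * L2norm \<mu> A) / real n + ((L2norm \<mu> v + t * L2norm \<mu> A) * (t - s)) / sqrt (real n)"
proof -
  define r where "r = mesh s t n"
  define d where "d = (t - s) / real n"
  define C where "C = L2norm \<mu> v + t * L2norm \<mu> A"
  note m = mesh[OF s(2) n, folded r_def d_def]
  have r0: "0 \<le> r i" for i using m(5)[of i] s by simp
  have d0: "0 \<le> d" using s n by (simp add: d_def)
  have t: "0 \<le> t" using s by simp
  have C0: "0 \<le> C" using t by (simp add: C_def)
  define W where "W i y = X (r i) y - E (r (Suc i)) (X (r i)) y" for i y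
  have W: "W i \<in> L2F (r i)" for i
    unfolding W_def using m(4)[of i "Suc i"] r0 by (intro L2F_diff X L2F_mono[OF _ _ E_L2F] XL) auto
  \<comment> \<open>\<open>W i\<close> is a residual of conditioning on
    \<open>F (r (Suc i))\<close>, and for \<open>j > i\<close> the function \<open>W j\<close> is
    measurable for that \<sigma>-algebra.\<close>
  have orth: "(LINT y|\<mu>. W i y * W j y) = 0" if "i < j" for i j
    unfolding W_def[of i]
    using that m(4)[of "Suc i" j] r0 by (intro E_orth XL L2F_mono[OF _ _ W]) auto
  have orth': "(LINT y|\<mu>. W i y * W j y) = 0" if "i \<noteq> j" for i j
    using that orth[of i j] orth[of j i] by (cases "i < j") (auto simp: mult.commute)
  \<comment> \<open>The conditional expectation is the best approximation among the functions
    measurable for \<open>F (r (Suc i))\<close>, and \<open>X (r (Suc i))\<close> is one of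
    these.\<close>
  have Wn: "L2norm \<mu> (W i) \<le> C * d" if "i < n" for i
  proof -
    have "L2norm \<mu> (W i) \<le> L2norm \<mu> (\<lambda>y. X (r i) y - X (r (Suc i)) y)"
      unfolding W_def by (intro E_best XL X r0)
    also have "\<dots> = L2norm \<mu> (\<lambda>y. X (r (Suc i)) y - X (r i) y)" by (rule L2norm_minus_commute)
    also have "\<dots> \<le> C * (r (Suc i) - r i)"
      unfolding C_def using that m(4)[of i "Suc i"] m(6)[of "Suc i"] r0 by (intro X_Lipschitz_on) auto
    finally show ?thesis by (simp add: m(3))
  qed
  have "(L2norm \<mu> (\<lambda>y. \<Sum>i<n. W i y))\<^sup>2 = (\<Sum>i<n. (L2norm \<mu> (W i))\<^sup>2)"
    using orth' by (intro L2norm_orthogonal_sum L2F_L2[OF W]) auto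
  also have "\<dots> \<le> (\<Sum>i<n. (C * d)\<^sup>2)" using Wn by (intro sum_mono power_mono) auto
  also have "\<dots> = (sqrt (real n) * (C * d))\<^sup>2" by (simp add: power_mult_distrib)
  finally have SW: "L2norm \<mu> (\<lambda>y. \<Sum>i<n. W i y) \<le> sqrt (real n) * (C * d)"
    using C0 d0 by (intro power2_le_imp_le[of "L2norm \<mu> _"]) auto
  have AL: "(\<lambda>y. d\<^sup>2 / 2 * E (r (Suc i)) A y) \<in> L2 \<mu>" for i by (intro L2_cmult E_L2 L r0)
  have An: "L2norm \<mu> (\<lambda>y. d\<^sup>2 / 2 * E (r (Suc i)) A y) \<le> d\<^sup>2 * L2norm \<mu> A" for i
    unfolding L2norm_cmult using E_norm[OF r0 L(3), of "Suc i"] by (intro mult_mono) auto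
  have "AE y in \<mu>. \<forall>i. X (r (Suc i)) y - E (r (Suc i)) (X (r i)) y = d * V (r (Suc i)) y + d\<^sup>2 / 2 * E (r (Suc i)) A y"
    unfolding AE_all_countable
  proof
    fix i
    show "AE y in \<mu>. X (r (Suc i)) y - E (r (Suc i)) (X (r i)) y = d * V (r (Suc i)) y + d\<^sup>2 / 2 * E (r (Suc i)) A y"
      using step_identity[OF r0 m(4)[of i "Suc i"]] by (simp add: m(3))
  qed
  then have AE: "AE y in \<mu>. remainder s t n y = (\<Sum>i<n. d\<^sup>2 / 2 * E (r (Suc i)) A y) - (\<Sum>i<n. W i y)"
  proof eventually_elim
    case (elim y)
    have "X t y - X s y = (\<Sum>i<n. X (r (Suc i)) y - X (r i) y)"
      by (subst sum_lessThan_telescope[of "\<lambda>i. X (r i) y"]) (simp add: m)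
    also have "\<dots> = (\<Sum>i<n. d * V (r (Suc i)) y + d\<^sup>2 / 2 * E (r (Suc i)) A y - W i y)"
      using elim by (intro sum.cong) (auto simp: W_def algebra_simps)
    finally show ?case by (simp add: remainder_def sum.distrib sum_subtractf r_def d_def)
  qed
  have SL: "(\<lambda>y. \<Sum>i<n. d\<^sup>2 / 2 * E (r (Suc i)) A y) \<in> L2 \<mu>" "(\<lambda>y. \<Sum>i<n. W i y) \<in> L2 \<mu>"
    by (intro L2_sum AL L2F_L2[OF W])+
  note rL = remainder_L2[OF s n]
  have "L2norm \<mu> (remainder s t n) = L2norm \<mu> (\<lambda>y. (\<Sum>i<n. d\<^sup>2 / 2 * E (r (Suc i)) A y) - (\<Sum>i<n. W i y))"
    using AE by (intro L2norm_cong_AE L2_measurable rL L2_diff SL)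
  also have "\<dots> \<le> L2norm \<mu> (\<lambda>y. \<Sum>i<n. d\<^sup>2 / 2 * E (r (Suc i)) A y) + L2norm \<mu> (\<lambda>y. \<Sum>i<n. W i y)"
    using L2norm_triangle[OF SL(1) L2_cmult[OF SL(2), of "-1"]] L2norm_cmult[of \<mu> "-1" "\<lambda>y. \<Sum>i<n. W i y"] by simp
  also have "L2norm \<mu> (\<lambda>y. \<Sum>i<n. d\<^sup>2 / 2 * E (r (Suc i)) A y) \<le> (\<Sum>i<n. d\<^sup>2 * L2norm \<mu> A)"
    using An by (intro order_trans[OF L2norm_sum] sum_mono AL) auto
  also have "(\<Sum>i<n. d\<^sup>2 * L2norm \<mu> A) = ((t - s)\<^sup>2 * L2norm \<mu> A) / real n"
    using n by (simp add: d_def power2_eq_square)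
  also note SW
  also have "sqrt (real n) * (C * d) = (C * (t - s)) / sqrt (real n)"
    using n by (simp add: d_def field_simps)
  finally show ?thesis by (simp add: C_def)
qed

lemma remainder_tendsto:
  assumes s: "0 \<le> s" "s \<le> t"
  shows "(\<lambda>n. L2norm \<mu> (remainder s t (Suc n))) \<longlonglongrightarrow> 0"
proof -
  let ?b = "\<lambda>n. ((t - s)\<^sup>2 * L2norm \<mu> A) / real (Suc n) + ((L2norm \<mu> v + t * L2norm \<mu> A) * (t - s)) / sqrt (real (Suc n))"
  have le: "eventually (\<lambda>n. L2norm \<mu> (remainder s t (Suc n)) \<le> ?b n) sequentially"
    by (intro always_eventually allI remainder_bound s) simp
  have 1: "(\<lambda>n. 1 / real (Suc n)) \<longlonglongrightarrow> 0" using LIMSEQ_inverse_real_of_nat by (simp add: inverse_eq_divide)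
  have "(\<lambda>n. ((t - s)\<^sup>2 * L2norm \<mu> A) * (1 / real (Suc n)) + ((L2norm \<mu> v + t * L2norm \<mu> A) * (t - s)) * sqrt (1 / real (Suc n)))
      \<longlonglongrightarrow> ((t - s)\<^sup>2 * L2norm \<mu> A) * 0 + ((L2norm \<mu> v + t * L2norm \<mu> A) * (t - s)) * sqrt 0"
    by (intro tendsto_intros 1)
  then have lim: "?b \<longlonglongrightarrow> 0" by (simp add: real_sqrt_divide)
  show ?thesis by (rule tendsto_sandwich[OF _ le tendsto_const lim]) auto
qed

text \<open>A mean value inequality with \<open>V\<close> in the role of the derivative: up to the
  vanishing remainder, the increment is a Riemann sum of \<open>V\<close>. Since right end points
  are used, nothing is asked of \<open>V\<close> at the time s. The choice \<open>U = 0\<close>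
  gives the Lipschitz bound, and \<open>U = V t\<close> gives differentiability.\<close>

lemma increment_bound:
  assumes s: "0 \<le> s" "s \<le> t" and U: "U \<in> L2 \<mu>"
    and e: "\<And>r. s < r \<Longrightarrow> r \<le> t \<Longrightarrow> L2norm \<mu> (\<lambda>y. V r y - U y) \<le> e"
  shows "L2norm \<mu> (\<lambda>y. X t y - X s y - (t - s) * U y) \<le> (t - s) * e"
proof (cases "s = t")
  case True
  then show ?thesis by (simp add: L2norm_def)
next
  case False
  have t: "0 \<le> t" using s by simp
  have "L2norm \<mu> (\<lambda>y. X t y - X s y - (t - s) * U y) \<le> L2norm \<mu> (remainder s t n) + (t - s) * e" if n: "0 < n" for n
  proof -
    let ?r = "mesh s t n" and ?d = "(t - s) / real n"
    note m = mesh[OF s(2) n]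
    have r0: "0 \<le> ?r i" for i using m(5)[of i] s by simp
    have rs: "s < ?r (Suc i)" for i
    proof -
      have "0 < ?d" using s n False by simp
      moreover have "?r (Suc i) - ?r i = ?d" by (rule m(3))
      ultimately show ?thesis using m(5)[of i] by linarith
    qed
    note rL = remainder_L2[OF s n]
    have dL: "(\<lambda>y. ?d * (V (?r (Suc i)) y - U y)) \<in> L2 \<mu>" for i by (intro L2_cmult L2_diff VL r0 U)
    have "(\<lambda>y. X t y - X s y - (t - s) * U y) = (\<lambda>y. remainder s t n y + (\<Sum>i<n. ?d * (V (?r (Suc i)) y - U y)))"
      using n by (simp add: remainder_def right_diff_distrib sum_subtractf fun_eq_iff)
    then have "L2norm \<mu> (\<lambda>y. X t y - X s y - (t - s) * U y) \<le>
        L2norm \<mu> (remainder s t n) + L2norm \<mu> (\<lambda>y. \<Sum>i<n. ?d * (V (?r (Suc i)) y - U y))"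
      using L2norm_triangle[OF rL L2_sum[OF dL]] by simp
    also have "L2norm \<mu> (\<lambda>y. \<Sum>i<n. ?d * (V (?r (Suc i)) y - U y)) \<le> (\<Sum>i<n. ?d * e)"
    proof (intro order_trans[OF L2norm_sum] sum_mono dL)
      fix i assume "i \<in> {..<n}"
      then have "L2norm \<mu> (\<lambda>y. V (?r (Suc i)) y - U y) \<le> e" using m(6)[of "Suc i"] by (intro e rs) auto
      then have "?d * L2norm \<mu> (\<lambda>y. V (?r (Suc i)) y - U y) \<le> ?d * e" using s by (intro mult_left_mono) auto
      then show "L2norm \<mu> (\<lambda>y. ?d * (V (?r (Suc i)) y - U y)) \<le> ?d * e"
        using s by (subst L2norm_cmult) simp
    qed
    also have "(\<Sum>i<n. ?d * e) = (t - s) * e" using n by simp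
    finally show ?thesis by simp
  qed
  then have "L2norm \<mu> (\<lambda>y. X t y - X s y - (t - s) * U y) \<le> 0 + (t - s) * e"
    by (intro LIMSEQ_le_const[OF tendsto_add[OF remainder_tendsto[OF s] tendsto_const]]) auto
  then show ?thesis by simp
qed

definition energy :: "real \<Rightarrow> real" where
  "energy t = 1/2 * (LINT y|\<mu>. (V t y)\<^sup>2) + (LINT y|\<mu>. X t y * A y)"

text \<open>\<open>V t\<close> is measurable for \<open>F s\<close> too, so \<open>V_inner\<close>
  evaluates its pairings with \<open>V s\<close> and with \<open>V t\<close>; they differ by
  \<open>t - s\<close> times the pairing with \<open>A\<close>. The inequality discards the
  nonnegative integral of \<open>(V t - V s)^2\<close>.\<close>

lemma kinetic_step:
  assumes s: "0 \<le> s" "s \<le> t"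
  shows "1/2 * (LINT y|\<mu>. (V t y)\<^sup>2) - 1/2 * (LINT y|\<mu>. (V s y)\<^sup>2) \<le> - (t - s) * (LINT y|\<mu>. V t y * A y)"
proof -
  have t: "0 \<le> t" using s by simp
  have "(LINT y|\<mu>. V t y * V s y) = (LINT y|\<mu>. (V t y)\<^sup>2) + (t - s) * (LINT y|\<mu>. V t y * A y)"
    using V_inner[OF s(1) L2F_mono[OF s V_L2F[OF t]]] V_inner[OF t V_L2F[OF t]]
    by (simp add: power2_eq_square algebra_simps)
  moreover have "0 \<le> (LINT y|\<mu>. (V t y - V s y)\<^sup>2)" by simp
  ultimately show ?thesis unfolding L2_power2_diff[OF VL[OF t] VL[OF s(1)]] by (simp add: algebra_simps)
qed

text \<open>Summed over the mesh, the kinetic steps lose at least the Riemann sum of the pairings of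
  \<open>V\<close> with \<open>A\<close>. The potential energy gains the pairing of
  \<open>X t - X s\<close> with \<open>A\<close>, which is the same sum up to the remainder, and the
  remainder vanishes with the mesh.\<close>

lemma energy_antimono:
  assumes s: "0 \<le> s" "s \<le> t"
  shows "energy t \<le> energy s"
proof -
  have t: "0 \<le> t" using s by simp
  have "energy t - energy s \<le> L2norm \<mu> (remainder s t n) * L2norm \<mu> A" if n: "0 < n" for n
  proof -
    define r where "r = mesh s t n"
    define d where "d = (t - s) / real n"
    define K where "K i = 1/2 * (LINT y|\<mu>. (V (r i) y)\<^sup>2)" for i
    note m = mesh[OF s(2) n, folded r_def d_def]
    have r0: "0 \<le> r i" for i using m(5)[of i] s by simp
    note rL = remainder_L2[OF s n]
    note i = L2_mult_integrable[OF XL[OF t] L(3)] L2_mult_integrable[OF XL[OF s(1)] L(3)]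
      L2_mult_integrable[OF VL[OF r0] L(3)]
    have "K n - K 0 = (\<Sum>i<n. K (Suc i) - K i)" by (rule sum_lessThan_telescope[symmetric])
    also have "\<dots> \<le> (\<Sum>i<n. - d * (LINT y|\<mu>. V (r (Suc i)) y * A y))"
    proof (rule sum_mono)
      fix i
      show "K (Suc i) - K i \<le> - d * (LINT y|\<mu>. V (r (Suc i)) y * A y)"
        using kinetic_step[OF r0 m(4)[of i "Suc i"]] by (simp add: K_def m(3))
    qed
    finally have K: "K n - K 0 \<le> (\<Sum>i<n. - d * (LINT y|\<mu>. V (r (Suc i)) y * A y))" .
    have "(LINT y|\<mu>. remainder s t n y * A y) =
        (LINT y|\<mu>. X t y * A y - X s y * A y - (\<Sum>i<n. d * (V (r (Suc i)) y * A y)))"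
      by (intro Bochner_Integration.integral_cong)
        (auto simp: remainder_def r_def d_def left_diff_distrib sum_distrib_right mult.assoc)
    also have "\<dots> = (LINT y|\<mu>. X t y * A y) - (LINT y|\<mu>. X s y * A y) - (\<Sum>i<n. d * (LINT y|\<mu>. V (r (Suc i)) y * A y))"
      using i by simp
    finally have "energy t - energy s \<le> (LINT y|\<mu>. remainder s t n y * A y)"
      using K by (simp add: energy_def K_def m sum_negf)
    also have "\<dots> \<le> L2norm \<mu> (remainder s t n) * L2norm \<mu> A"
      using L2_Cauchy_Schwarz[OF rL L(3)] by simp
    finally show ?thesis .
  qed
  then have "energy t - energy s \<le> 0 * L2norm \<mu> A"
    by (intro LIMSEQ_le_const[OF tendsto_mult[OF remainder_tendsto[OF s] tendsto_const]]) auto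
  then show ?thesis by simp
qed

lemma L2_lipschitz_X:
  assumes pos: "\<And>t. 0 \<le> t \<Longrightarrow> 0 \<le> (LINT y|\<mu>. X t y * A y)"
  shows "L2_lipschitz \<mu> X"
proof -
  \<comment> \<open>Since the potential energy is nonnegative, half the squared norm of
    \<open>V t\<close> is at most \<open>energy t\<close>, hence at most
    \<open>energy 0\<close>.\<close>
  define C where "C = sqrt (2 * energy 0)"
  have V: "L2norm \<mu> (V t) \<le> C" if "0 \<le> t" for t
    using energy_antimono[OF order_refl that] pos[OF that] unfolding C_def L2norm_def energy_def[of t]
    by (intro real_sqrt_le_mono) simp
  have C0: "0 \<le> C" using V[of 0] L2norm_nonneg[of \<mu> "V 0"] by linarith
  have le: "L2norm \<mu> (\<lambda>y. X t y - X s y) \<le> C * (t - s)" if "0 \<le> s" "s \<le> t" for s t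
    using increment_bound[OF that L2_const[OF finite_measure_axioms, of 0], of C] V that by (simp add: mult.commute)
  show ?thesis
    unfolding L2_lipschitz_def
  proof (intro conjI exI[of _ C] allI impI XL C0)
    fix s t :: real assume "0 \<le> s" "0 \<le> t"
    then show "L2norm \<mu> (\<lambda>y. X t y - X s y) \<le> C * \<bar>t - s\<bar>"
      using le[of s t] le[of t s] L2norm_minus_commute[of \<mu> "X t" "X s"] by (cases "s \<le> t") auto
  qed
qed

lemma V_continuous_off_countable:
  obtains D where "countable D" "\<And>t. 0 < t \<Longrightarrow> t \<notin> D \<Longrightarrow>
    ((\<lambda>r. L2norm \<mu> (\<lambda>y. V r y - V t y)) \<longlongrightarrow> 0) (at t)"
proof -
  obtain D1 where D1: "countable D1" "\<And>t. 0 < t \<Longrightarrow> t \<notin> D1 \<Longrightarrow>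
      ((\<lambda>r. L2norm \<mu> (\<lambda>y. E r v y - E t v y)) \<longlongrightarrow> 0) (at t)"
    using E_continuous_off_countable[OF L(2)] by auto
  obtain D2 where D2: "countable D2" "\<And>t. 0 < t \<Longrightarrow> t \<notin> D2 \<Longrightarrow>
      ((\<lambda>r. L2norm \<mu> (\<lambda>y. E r A y - E t A y)) \<longlongrightarrow> 0) (at t)"
    using E_continuous_off_countable[OF L(3)] by auto
  show thesis
  proof
    show "countable (D1 \<union> D2)" using D1(1) D2(1) by simp
    fix t :: real assume t: "0 < t" "t \<notin> D1 \<union> D2"
    let ?b = "\<lambda>r. L2norm \<mu> (\<lambda>y. E r v y - E t v y) + (\<bar>r - t\<bar> * L2norm \<mu> A + t * L2norm \<mu> (\<lambda>y. E r A y - E t A y))"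
    show "((\<lambda>r. L2norm \<mu> (\<lambda>y. V r y - V t y)) \<longlongrightarrow> 0) (at t)"
    proof (rule tendsto_sandwich[of "\<lambda>_. 0"])
      have "(?b \<longlongrightarrow> 0 + (\<bar>t - t\<bar> * L2norm \<mu> A + t * 0)) (at t)"
        using t by (intro tendsto_intros D1(2) D2(2)) auto
      then show "(?b \<longlongrightarrow> 0) (at t)" by simp
      have "eventually (\<lambda>r. r \<in> {0<..}) (at t)" using t(1) by (intro eventually_at_in_open') auto
      then show "eventually (\<lambda>r. L2norm \<mu> (\<lambda>y. V r y - V t y) \<le> ?b r) (at t)"
      proof eventually_elim
        case (elim r)
        have r: "0 \<le> r" "0 \<le> t" using elim t by auto
        let ?a = "\<lambda>y. E r v y - E t v y" and ?c = "\<lambda>y. (t - r) * E r A y" and ?e = "\<lambda>y. (- t) * (E r A y - E t A y)"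
        have Ls: "?a \<in> L2 \<mu>" "?c \<in> L2 \<mu>" "?e \<in> L2 \<mu>"
          by (intro L2_diff L2_cmult E_L2 L r)+
        have "L2norm \<mu> (\<lambda>y. V r y - V t y) = L2norm \<mu> (\<lambda>y. ?a y + (?c y + ?e y))"
          by (simp add: V_def algebra_simps)
        also have "\<dots> \<le> L2norm \<mu> ?a + (L2norm \<mu> ?c + L2norm \<mu> ?e)"
          using L2norm_triangle[OF Ls(1) L2_add[OF Ls(2,3)]] L2norm_triangle[OF Ls(2,3)] by simp
        also have "L2norm \<mu> ?c \<le> \<bar>r - t\<bar> * L2norm \<mu> A"
          unfolding L2norm_cmult using E_norm[OF r(1) L(3)] by (intro mult_mono) auto
        also have "L2norm \<mu> ?e = t * L2norm \<mu> (\<lambda>y. E r A y - E t A y)"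
          unfolding L2norm_cmult using t(1) by simp
        finally show ?case by simp
      qed
    qed auto
  qed
qed

text \<open>Near t the function \<open>V\<close> stays within e/2 of \<open>V t\<close>, so
  \<open>increment_bound\<close> with \<open>U = V t\<close> applies on the interval between t and
  \<open>t + \<tau>\<close>, for either sign of \<open>\<tau>\<close>. The restriction
  \<open>\<bar>\<tau>\<bar> < t\<close> keeps both times positive.\<close>

lemma has_L2_deriv_V:
  assumes t: "0 < t" and c: "((\<lambda>r. L2norm \<mu> (\<lambda>y. V r y - V t y)) \<longlongrightarrow> 0) (at t)"
  shows "has_L2_deriv \<mu> X t (V t)"
  unfolding has_L2_deriv_def
proof
  show VtL: "V t \<in> L2 \<mu>" using t by (intro VL) simp
  show "((\<lambda>\<tau>. L2norm \<mu> (\<lambda>y. (X (t + \<tau>) y - X t y) / \<tau> - V t y)) \<longlongrightarrow> 0) (at 0)"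
    unfolding tendsto_iff
  proof (intro allI impI)
    fix e :: real assume "e > 0"
    then have "eventually (\<lambda>r. dist (L2norm \<mu> (\<lambda>y. V r y - V t y)) 0 < e / 2) (at t)"
      using c half_gt_zero[OF \<open>e > 0\<close>] unfolding tendsto_iff by blast
    then have "\<exists>d>0. \<forall>r. r \<noteq> t \<longrightarrow> dist r t < d \<longrightarrow> dist (L2norm \<mu> (\<lambda>y. V r y - V t y)) 0 < e / 2"
      unfolding eventually_at by blast
    then obtain d where d: "d > 0" "\<And>r. r \<noteq> t \<Longrightarrow> dist r t < d \<Longrightarrow> dist (L2norm \<mu> (\<lambda>y. V r y - V t y)) 0 < e / 2"
      by auto
    have near: "L2norm \<mu> (\<lambda>y. V r y - V t y) \<le> e / 2" if "\<bar>r - t\<bar> < d" for r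
    proof (cases "r = t")
      case True
      then show ?thesis using \<open>e > 0\<close> by (simp add: L2norm_def)
    next
      case False
      then show ?thesis using d(2)[of r] that by (simp add: dist_real_def)
    qed
    have "L2norm \<mu> (\<lambda>y. (X (t + \<tau>) y - X t y) / \<tau> - V t y) \<le> e / 2" if \<tau>: "\<tau> \<noteq> 0" "\<bar>\<tau>\<bar> < min d t" for \<tau>
    proof -
      have *: "L2norm \<mu> (\<lambda>y. X (t + \<tau>) y - X t y - \<tau> * V t y) \<le> \<bar>\<tau>\<bar> * (e / 2)"
      proof (cases "\<tau> > 0")
        case True
        have "L2norm \<mu> (\<lambda>y. X (t + \<tau>) y - X t y - (t + \<tau> - t) * V t y) \<le> (t + \<tau> - t) * (e / 2)"
          using True t \<tau> by (intro increment_bound VtL near) auto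
        then show ?thesis using True by simp
      next
        case False
        have "L2norm \<mu> (\<lambda>y. X t y - X (t + \<tau>) y - (t - (t + \<tau>)) * V t y) \<le> (t - (t + \<tau>)) * (e / 2)"
          using False t \<tau> by (intro increment_bound VtL near) auto
        moreover have "L2norm \<mu> (\<lambda>y. X t y - X (t + \<tau>) y - (t - (t + \<tau>)) * V t y) =
            L2norm \<mu> (\<lambda>y. (-1) * (X (t + \<tau>) y - X t y - \<tau> * V t y))"
          by (simp add: algebra_simps)
        ultimately show ?thesis using False unfolding L2norm_cmult by simp
      qed
      have "(\<lambda>y. (X (t + \<tau>) y - X t y) / \<tau> - V t y) = (\<lambda>y. 1 / \<tau> * (X (t + \<tau>) y - X t y - \<tau> * V t y))"
        using \<tau>(1) by (simp add: fun_eq_iff field_simps)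
      then have "L2norm \<mu> (\<lambda>y. (X (t + \<tau>) y - X t y) / \<tau> - V t y) =
          1 / \<bar>\<tau>\<bar> * L2norm \<mu> (\<lambda>y. X (t + \<tau>) y - X t y - \<tau> * V t y)"
        by (simp only: L2norm_cmult) simp
      also have "\<dots> \<le> 1 / \<bar>\<tau>\<bar> * (\<bar>\<tau>\<bar> * (e / 2))" using * by (intro mult_left_mono) auto
      also have "\<dots> = e / 2" using \<tau>(1) by simp
      finally show ?thesis .
    qed
    then show "eventually (\<lambda>\<tau>. dist (L2norm \<mu> (\<lambda>y. (X (t + \<tau>) y - X t y) / \<tau> - V t y)) 0 < e) (at 0)"
      unfolding eventually_at using d(1) t \<open>e > 0\<close>
      by (intro exI[of _ "min d t"]) (auto simp: dist_real_def intro: le_less_trans[of _ "e / 2"])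
  qed
qed

end

section \<open>The Euler-Poisson flow\<close>

text \<open>\<open>\<phi>\<close> is McShane's extension of the K-Lipschitz function that sends
  \<open>h y\<close> to \<open>f y\<close>. It is defined on the whole line, so it is Borel whatever
  the range of \<open>h\<close> looks like.\<close>

lemma Lipschitz_factorization:
  fixes f h :: "'a \<Rightarrow> real"
  assumes lip: "\<And>y z. \<bar>f y - f z\<bar> \<le> K * \<bar>h y - h z\<bar>" and K: "0 \<le> K"
  obtains \<phi> where "\<phi> \<in> borel_measurable borel" "\<And>y. f y = \<phi> (h y)"
proof -
  define \<phi> where "\<phi> x = (INF z. f z + K * \<bar>x - h z\<bar>)" for x
  have low: "f y - K * \<bar>x - h y\<bar> \<le> f z + K * \<bar>x - h z\<bar>" for x y z
  proof -
    have "f y - f z \<le> K * \<bar>h y - h z\<bar>" using lip[of y z] by simp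
    also have "\<dots> \<le> K * (\<bar>x - h y\<bar> + \<bar>x - h z\<bar>)" using K by (intro mult_left_mono) auto
    finally show ?thesis by (simp add: algebra_simps)
  qed
  then have bdd: "bdd_below (range (\<lambda>z. f z + K * \<bar>x - h z\<bar>))" for x by (intro bdd_belowI) auto
  have eq: "f y = \<phi> (h y)" for y
  proof (rule antisym)
    show "f y \<le> \<phi> (h y)" unfolding \<phi>_def using low[of y "h y"] by (intro cINF_greatest) auto
    have "\<phi> (h y) \<le> f y + K * \<bar>h y - h y\<bar>" unfolding \<phi>_def by (intro cINF_lower bdd) auto
    then show "\<phi> (h y) \<le> f y" by simp
  qed
  have le: "\<phi> x \<le> \<phi> x' + K * \<bar>x - x'\<bar>" for x x'
  proof -
    have "\<phi> x - K * \<bar>x - x'\<bar> \<le> f z + K * \<bar>x' - h z\<bar>" for z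
    proof -
      have "\<phi> x \<le> f z + K * \<bar>x - h z\<bar>" unfolding \<phi>_def by (intro cINF_lower bdd) auto
      also have "K * \<bar>x - h z\<bar> \<le> K * (\<bar>x - x'\<bar> + \<bar>x' - h z\<bar>)" using K by (intro mult_left_mono) auto
      finally show ?thesis by (simp add: algebra_simps)
    qed
    then have "\<phi> x - K * \<bar>x - x'\<bar> \<le> \<phi> x'" unfolding \<phi>_def[of x'] by (intro cINF_greatest) auto
    then show ?thesis by simp
  qed
  have "K-lipschitz_on UNIV \<phi>"
  proof (rule lipschitz_onI)
    show "dist (\<phi> x) (\<phi> y) \<le> K * dist x y" for x y
      using le[of x y] le[of y x] by (simp add: dist_real_def abs_minus_commute abs_le_iff)
  qed (rule K)
  then have "continuous_on UNIV \<phi>" by (rule lipschitz_on_continuous_on)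
  then show thesis using eq by (intro that[of \<phi>] borel_measurable_continuous_onI)
qed

section \<open>Construction of the flow from the initial data\<close>

locale euler_poisson_data = prob_space \<mu> for \<mu> :: "real measure" +
  fixes v :: "real \<Rightarrow> real"
  assumes sets_mu [measurable_cong]: "sets \<mu> = sets borel"
    and second_moment: "integrable \<mu> (\<lambda>x. x\<^sup>2)"
    and ac: "abs_continuous v"
begin

abbreviation "S \<equiv> msupp \<mu>"

lemma space_mu [simp]: "space \<mu> = UNIV" using sets_eq_imp_space_eq[OF sets_mu] by simp

lemma prob_UNIV [simp]: "prob UNIV = 1" using prob_space by simp

lemma borel_measurable_mu: "borel_measurable \<mu> = borel_measurable borel"
  by (rule measurable_cong_sets[OF sets_mu refl])

definition A :: "real \<Rightarrow> real" where "A y = (LINT z|\<mu>. sgn (y - z))"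

definition g :: "real \<Rightarrow> real \<Rightarrow> real" where "g t y = y + t * v y - t\<^sup>2 / 2 * A y"

text \<open>The comparison function for (ii): both \<open>l t\<close> and \<open>l t - g t\<close>
  are nondecreasing. As \<open>l t\<close> is its own projection, \<open>cone_proj_add_mono\<close>
  makes \<open>l t - X t\<close> nondecreasing.\<close>

definition l :: "real \<Rightarrow> real \<Rightarrow> real" where "l t y = y + t * variation_fun v y"

lemma integrable_sgn: "integrable \<mu> (\<lambda>z. sgn (f z))" if [measurable]: "f \<in> borel_measurable \<mu>" for f :: "real \<Rightarrow> real"
  by (rule integrable_const_bound[where B=1]) (auto simp: abs_sgn_eq)

lemma abs_integral_sgn_le: "\<bar>LINT z|\<mu>. sgn (f z :: real)\<bar> \<le> 1"
proof -
  have "\<bar>LINT z|\<mu>. sgn (f z)\<bar> \<le> (LINT z|\<mu>. 1)"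
  \<comment> \<open>A function that is not integrable has integral 0 by default, so the bound holds
    for every \<open>f\<close>.\<close>
  proof (cases "integrable \<mu> (\<lambda>z. sgn (f z))")
    case True
    have "\<bar>LINT z|\<mu>. sgn (f z)\<bar> \<le> (LINT z|\<mu>. \<bar>sgn (f z)\<bar>)" by (rule integral_abs_bound)
    also have "\<dots> \<le> (LINT z|\<mu>. 1)" 
    proof (rule integral_mono)
      show "integrable \<mu> (\<lambda>z. \<bar>sgn (f z)\<bar>)" using True by (rule integrable_abs)
      show "\<bar>sgn (f z)\<bar> \<le> 1" for z by (simp add: sgn_if)
    qed simp
    finally show ?thesis .
  qed (simp add: not_integrable_integral_eq)
  then show ?thesis by simp
qed

lemma abs_A_le: "\<bar>A y\<bar> \<le> 1" unfolding A_def by (rule abs_integral_sgn_le)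

lemma mono_A: "mono A"
proof (rule monoI)
  fix x y :: real assume "x \<le> y"
  then show "A x \<le> A y"
    unfolding A_def by (intro integral_mono integrable_sgn) (auto simp: sgn_if)
qed

lemma A_measurable [measurable]: "A \<in> borel_measurable borel"
  by (rule borel_measurable_mono[OF mono_A])

lemma id_L2: "(\<lambda>y. y) \<in> L2 \<mu>" using second_moment by (simp add: L2_def)

lemma A_L2: "A \<in> L2 \<mu>" by (rule L2_bounded[OF finite_measure_axioms _ abs_A_le]) measurable

lemma abs_continuous_L2:
  assumes "abs_continuous w"
  shows "w \<in> L2 \<mu>"
proof -
  obtain C where C: "C \<ge> 0" "\<And>x y. \<bar>w x - w y\<bar> \<le> C * (1 + \<bar>x - y\<bar>)"
    using abs_continuous_growth[OF assms] by blast
  have "(\<lambda>y. \<bar>y\<bar>) \<in> L2 \<mu>" using second_moment by (simp add: L2_def)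
  then have "(\<lambda>y. (\<bar>w 0\<bar> + C) + C * \<bar>y\<bar>) \<in> L2 \<mu>"
    by (intro L2_add L2_cmult L2_const finite_measure_axioms)
  then show ?thesis
  proof (rule L2_bound)
    show "w \<in> borel_measurable \<mu>" using abs_continuous_measurable[OF assms] by (simp add: borel_measurable_mu)
    have "\<bar>w y\<bar> \<le> \<bar>(\<bar>w 0\<bar> + C) + C * \<bar>y\<bar>\<bar>" for y
      using C(2)[of y 0] C(1) by (simp add: distrib_left)
    then show "AE y in \<mu>. \<bar>w y\<bar> \<le> \<bar>(\<bar>w 0\<bar> + C) + C * \<bar>y\<bar>\<bar>" by simp
  qed
qed

lemma v_L2: "v \<in> L2 \<mu>" by (rule abs_continuous_L2[OF ac])

lemma g_L2: "g t \<in> L2 \<mu>"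
  unfolding g_def by (intro L2_diff L2_add L2_cmult id_L2 v_L2 A_L2)

lemma l_L2: "l t \<in> L2 \<mu>"
  unfolding l_def
  by (intro L2_add L2_cmult id_L2 abs_continuous_L2 abs_continuous_variation_fun ac)

lemma mono_l: "0 \<le> t \<Longrightarrow> mono (l t)"
  using mono_variation_fun[OF ac] unfolding l_def mono_def
  by (auto intro!: add_mono mult_left_mono)

lemma mono_l_minus_g: "0 \<le> t \<Longrightarrow> mono (\<lambda>y. l t y - g t y)"
proof (rule monoI)
  fix x y :: real assume t: "0 \<le> t" and xy: "x \<le> y"
  have "v y - v x \<le> variation_fun v y - variation_fun v x" using variation_fun_ge[OF ac xy] by simp
  then have "t * (v y - v x) \<le> t * (variation_fun v y - variation_fun v x)" using t by (rule mult_left_mono)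
  moreover have "t\<^sup>2 / 2 * A x \<le> t\<^sup>2 / 2 * A y" using monoD[OF mono_A xy] by (intro mult_left_mono) auto
  ultimately show "l t x - g t x \<le> l t y - g t y" by (simp add: l_def g_def right_diff_distrib)
qed

lemma l_minus_proj_ae_mono:
  assumes t: "0 \<le> t" and X: "is_cone_proj \<mu> (g t) X"
  shows "ae_mono \<mu> (\<lambda>y. l t y - X y)"
proof -
  have "l t \<in> mono_cone \<mu>" using l_L2 mono_imp_ae_mono[OF mono_l[OF t]] by (simp add: mono_cone_def)
  then have "is_cone_proj \<mu> (\<lambda>y. g t y + (l t y - g t y)) (l t)" using is_cone_proj_self by simp
  from cone_proj_add_mono[OF X this g_L2 L2_diff[OF l_L2 g_L2] mono_l_minus_g[OF t] finite_measure_axioms]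
  show ?thesis .
qed

lemma l_uniformly_continuous: "uniformly_continuous_on UNIV (l t)"
  unfolding l_def
  by (intro uniformly_continuous_on_add uniformly_continuous_on_cmul_left
      uniformly_continuous_on_id abs_continuous_uniformly_continuous abs_continuous_variation_fun ac)

lemma AE_S: "AE y in \<mu>. y \<in> S" by (rule AE_msupp[OF finite_measure_axioms sets_mu])

lemma S_nonempty: "S \<noteq> {}"
proof
  assume "S = {}"
  then have "AE y in \<mu>. False" using AE_S by simp
  then show False by simp
qed

definition y0 :: real where "y0 = (SOME y. y \<in> S)"

lemma y0: "y0 \<in> S" 
  unfolding y0_def by (rule someI_ex) (use S_nonempty in auto)

text \<open>\<open>X t\<close> is chosen to factor through this map, so inequalities between points
  of the support hold for \<open>X t\<close> at arbitrary real arguments.\<close>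

definition retr :: "real \<Rightarrow> real" where "retr y = (if y \<in> S then y else y0)"

lemma retr_S [simp]: "retr y \<in> S" using y0 by (simp add: retr_def)

lemma retr_eq [simp]: "y \<in> S \<Longrightarrow> retr y = y" by (simp add: retr_def)

lemma flow_exists:
  assumes t: "0 \<le> t"
  shows "\<exists>Z. Z \<in> borel_measurable borel \<and> is_cone_proj \<mu> (g t) Z \<and> continuous_on S Z \<and>
    (\<forall>y. Z y = Z (retr y))"
proof -
  obtain X where X: "is_cone_proj \<mu> (g t) X" 
    by (rule cone_proj_exists[OF finite_measure_axioms g_L2[of t]])
  have XL: "X \<in> L2 \<mu>" "ae_mono \<mu> X" using X by (auto simp: is_cone_proj_def mono_cone_def)
  note m = l_minus_proj_ae_mono[OF t X]
  obtain Z where Z: "Z \<in> borel_measurable borel" "AE y in \<mu>. X y = Z y" "continuous_on S Z"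
    "\<And>y. y \<notin> S \<Longrightarrow> Z y = Z y0"
    by (rule ae_mono_continuous_version[OF finite_measure_axioms sets_mu L2_measurable[OF XL(1)] XL(2) m
        l_uniformly_continuous y0]) (rule that)
  have "is_cone_proj \<mu> (g t) Z"
    using Z(1) L2_measurable[OF g_L2]
    by (intro is_cone_proj_cong_AE[OF X _ Z(2)]) (auto simp: borel_measurable_mu)
  moreover have "Z y = Z (retr y)" for y using Z(4)[of y] by (cases "y \<in> S") (auto simp: retr_def)
  ultimately show ?thesis using Z(1,3) by blast
qed

definition X :: "real \<Rightarrow> real \<Rightarrow> real" where
  "X t = (SOME Z. Z \<in> borel_measurable borel \<and> is_cone_proj \<mu> (g t) Z \<and> continuous_on S Z \<and>
    (\<forall>y. Z y = Z (retr y)))"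

context
  fixes t :: real assumes t: "0 \<le> t"
begin

lemma X_spec: "X t \<in> borel_measurable borel \<and> is_cone_proj \<mu> (g t) (X t) \<and> continuous_on S (X t) \<and>
    (\<forall>y. X t y = X t (retr y))"
  unfolding X_def by (rule someI_ex[OF flow_exists[OF t]])

lemma X_measurable: "X t \<in> borel_measurable borel"
  and X_proj: "is_cone_proj \<mu> (g t) (X t)"
  and X_continuous: "continuous_on S (X t)"
  and X_retr: "X t (retr y) = X t y"
  using X_spec by auto

lemma X_L2: "X t \<in> L2 \<mu>"
  using X_proj by (auto simp: is_cone_proj_def mono_cone_def)

lemma X_mono: "mono_on S (X t)"
  using X_proj X_continuous
  by (intro ae_mono_continuous_imp_mono_on[OF finite_measure_axioms sets_mu])
    (auto simp: is_cone_proj_def mono_cone_def)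

lemma l_minus_X_mono: "mono_on S (\<lambda>y. l t y - X t y)"
proof (rule ae_mono_continuous_imp_mono_on[OF finite_measure_axioms sets_mu])
  show "ae_mono \<mu> (\<lambda>y. l t y - X t y)" by (rule l_minus_proj_ae_mono[OF t X_proj])
  show "continuous_on S (\<lambda>y. l t y - X t y)"
    using continuous_on_subset[OF uniformly_continuous_imp_continuous[OF l_uniformly_continuous]]
    by (intro continuous_on_diff X_continuous) auto
qed

end

text \<open>The projection is positively homogeneous, so \<open>X s / s\<close> and
  \<open>X t / t\<close> project \<open>g s / s\<close> and \<open>g t / t\<close>. In the
  difference of these the velocity cancels; what remains is
  \<open>(1/s - 1/t) y + (t - s)/2 A y\<close>, which is nondecreasing for
  \<open>s \<le> t\<close>.\<close>

lemma X_quotient_mono: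
  assumes s: "0 < s" "s \<le> t"
  shows "mono_on S (\<lambda>y. 1 / s * X s y - 1 / t * X t y)"
proof (rule ae_mono_continuous_imp_mono_on[OF finite_measure_axioms sets_mu])
  have t: "0 < t" "0 \<le> s" "0 \<le> t" using s by auto
  define h where "h y = (1 / s - 1 / t) * y + (t - s) / 2 * A y" for y
  have h: "mono h"
  proof (rule monoI)
    fix x y :: real assume "x \<le> y"
    moreover have "0 \<le> 1 / s - 1 / t" using s t by (simp add: frac_le)
    ultimately show "h x \<le> h y"
      unfolding h_def using s monoD[OF mono_A \<open>x \<le> y\<close>] by (intro add_mono mult_left_mono) auto
  qed
  have hL: "h \<in> L2 \<mu>" unfolding h_def by (intro L2_add L2_cmult id_L2 A_L2)
  have eq: "(\<lambda>y. 1 / s * g s y) = (\<lambda>y. 1 / t * g t y + h y)"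
    using s t by (simp add: fun_eq_iff g_def h_def field_simps power2_eq_square)
  have p: "is_cone_proj \<mu> (\<lambda>y. 1 / s * g s y) (\<lambda>y. 1 / s * X s y)"
    "is_cone_proj \<mu> (\<lambda>y. 1 / t * g t y) (\<lambda>y. 1 / t * X t y)"
    using t s by (intro is_cone_proj_cmult X_proj; simp)+
  show "ae_mono \<mu> (\<lambda>y. 1 / s * X s y - 1 / t * X t y)"
    by (rule cone_proj_add_mono[OF p(2) p(1)[unfolded eq] L2_cmult[OF g_L2] hL h finite_measure_axioms])
  show "continuous_on S (\<lambda>y. 1 / s * X s y - 1 / t * X t y)"
    using t by (intro continuous_intros X_continuous)
qed

lemma X_scaled_Lipschitz:
  assumes s: "0 < s" "s \<le> t" and yz: "y \<in> S" "z \<in> S"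
  shows "1 / t * \<bar>X t y - X t z\<bar> \<le> 1 / s * \<bar>X s y - X s z\<bar>"
proof -
  have *: "1 / t * \<bar>X t y - X t z\<bar> \<le> 1 / s * \<bar>X s y - X s z\<bar>" if yz: "y \<in> S" "z \<in> S" "z \<le> y" for y z
  proof -
    have "0 \<le> s" "0 \<le> t" using s by auto
    from mono_onD[OF X_mono[OF this(1)] yz(2,1,3)] mono_onD[OF X_mono[OF this(2)] yz(2,1,3)]
      mono_onD[OF X_quotient_mono[OF s] yz(2,1,3)]
    show ?thesis by (simp add: right_diff_distrib diff_divide_distrib)
  qed
  show ?thesis
    using *[OF yz] *[OF yz(2,1)] by (cases "z \<le> y") (auto simp: abs_minus_commute)
qed

text \<open>The identity lies in the cone, so it is the projection of \<open>g 0\<close>, and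
  \<open>X 0\<close> agrees with it almost everywhere. Both \<open>X 0 y - y\<close> and its
  negative are then continuous and nondecreasing on the support. Hence the difference is constant
  there, and it vanishes at the point \<open>u\<close>.\<close>

lemma X_0: "X 0 y = retr y"
proof -
  have "is_cone_proj \<mu> (g 0) (\<lambda>y. y)"
    using is_cone_proj_self[of "\<lambda>y. y" \<mu>] id_L2 mono_imp_ae_mono[of "\<lambda>y. y" \<mu>]
    by (simp add: g_def[abs_def] mono_cone_def mono_def)
  then have AE: "AE y in \<mu>. X 0 y = y" by (intro is_cone_proj_unique[OF X_proj _ g_L2]) auto
  have c: "continuous_on S (\<lambda>y. X 0 y - y)" by (intro continuous_intros X_continuous) simp
  have c': "continuous_on S (\<lambda>y. y - X 0 y)" by (intro continuous_intros X_continuous) simp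
  have z: "ae_mono \<mu> (\<lambda>_. 0)" by (rule mono_imp_ae_mono) (simp add: mono_def)
  have m: "mono_on S (\<lambda>y. X 0 y - y)"
    using AE by (intro ae_mono_continuous_imp_mono_on[OF finite_measure_axioms sets_mu _ c] ae_mono_cong_AE[OF z]) auto
  have m': "mono_on S (\<lambda>y. y - X 0 y)"
    using AE by (intro ae_mono_continuous_imp_mono_on[OF finite_measure_axioms sets_mu _ c'] ae_mono_cong_AE[OF z]) auto
  have "AE u in \<mu>. u \<in> {u \<in> S. X 0 u = u}" using AE AE_S by eventually_elim simp
  from msupp_dense[OF y0 this zero_less_one sets_mu] obtain u where u: "u \<in> S" "X 0 u = u" by auto
  have "X 0 y = y" if "y \<in> S" for y
  proof (cases "u \<le> y")
    case True
    from mono_onD[OF m u(1) that this] mono_onD[OF m' u(1) that this] u(2) show ?thesis by simp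
  next
    case False
    then have "y \<le> u" by simp
    from mono_onD[OF m that u(1) this] mono_onD[OF m' that u(1) this] u(2) show ?thesis by simp
  qed
  then show ?thesis using X_retr[of 0 y] by simp
qed

lemma X_factor:
  assumes s: "0 \<le> s" "s \<le> t"
  obtains \<phi> where "\<phi> \<in> borel_measurable borel" "\<And>y. X t y = \<phi> (X s y)"
proof (cases "s = 0")
  case True
  show thesis
  proof (rule that)
    show "X t \<in> borel_measurable borel" using s by (intro X_measurable) simp
    show "X t y = X t (X s y)" for y using s True X_retr[of t y] by (simp add: X_0)
  qed
next
  case False
  then have s0: "0 < s" "0 < t" "0 \<le> t" using s by auto
  have "\<bar>X t y - X t z\<bar> \<le> t / s * \<bar>X s y - X s z\<bar>" for y z
  proof -
    have "1 / t * \<bar>X t y - X t z\<bar> \<le> 1 / s * \<bar>X s y - X s z\<bar>"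
      using X_scaled_Lipschitz[OF s0(1) s(2) retr_S retr_S, of y z] by (simp add: X_retr s s0)
    then have "t * (1 / t * \<bar>X t y - X t z\<bar>) \<le> t * (1 / s * \<bar>X s y - X s z\<bar>)"
      using s0 by (intro mult_left_mono) auto
    then show ?thesis using s0 by simp
  qed
  from Lipschitz_factorization[OF this] s0 that show thesis by (metis divide_nonneg_nonneg s(1))
qed

definition F :: "real \<Rightarrow> real measure" where "F t = vimage_algebra (space \<mu>) (X t) borel"

lemma X_F: "X t \<in> borel_measurable (F t)"
  unfolding F_def by (rule measurable_vimage_algebra1) auto

lemma sets_F: "sets (F t) = {X t -` B |B. B \<in> sets borel}"
  unfolding F_def by (subst sets_vimage_algebra2) auto

lemma F_sub: "0 \<le> t \<Longrightarrow> subalgebra \<mu> (F t)"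
proof -
  assume t: "0 \<le> t"
  have "X t -` B \<in> sets \<mu>" if "B \<in> sets borel" for B
    using measurable_sets[OF X_measurable[OF t] that] by (simp add: sets_mu)
  then have "sets (F t) \<subseteq> sets \<mu>" unfolding sets_F by auto
  then show "subalgebra \<mu> (F t)" unfolding subalgebra_def by (simp add: F_def)
qed

lemma F_dec:
  assumes "0 \<le> s" "s \<le> t"
  shows "subalgebra (F s) (F t)"
proof -
  obtain \<phi> where \<phi>: "\<phi> \<in> borel_measurable borel" "\<And>y. X t y = \<phi> (X s y)" using X_factor[OF assms] by blast
  have "X t -` B \<in> sets (F s)" if "B \<in> sets borel" for B
  proof -
    have "X t -` B = X s -` (\<phi> -` B)" using \<phi>(2) by auto
    moreover have "\<phi> -` B \<in> sets borel" using measurable_sets[OF \<phi>(1) that] by simp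
    ultimately show ?thesis by (auto simp: sets_F)
  qed
  then have "sets (F t) \<subseteq> sets (F s)" unfolding sets_F[of t] by auto
  then show ?thesis unfolding subalgebra_def by (simp add: F_def)
qed

sublocale decreasing_filtration \<mu> F
  by unfold_locales (auto intro: F_sub F_dec)

lemma E_g:
  assumes t: "0 \<le> t"
  shows "AE y in \<mu>. E t (g t) y = X t y"
proof -
  interpret S: finite_measure_subalgebra \<mu> "F t" by unfold_locales (rule F_sub[OF t])
  show ?thesis
  proof (rule S.real_cond_exp_charact)
    show i: "integrable \<mu> (g t)" "integrable \<mu> (X t)"
      by (intro L2_integrable finite_measure_axioms g_L2 X_L2 t)+
    show "X t \<in> borel_measurable (F t)" by (rule X_F)
    fix B assume "B \<in> sets (F t)"
    then obtain C where C: "B = X t -` C" "C \<in> sets borel" by (auto simp: sets_F)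
    have B[measurable]: "B \<in> sets \<mu>" using measurable_sets[OF X_measurable[OF t] C(2)] by (simp add: C(1) sets_mu)
    have "(LINT y|\<mu>. (g t y - X t y) * indicator C (X t y)) = 0"
      by (rule cone_proj_integral_indicator[OF finite_measure_axioms g_L2 X_proj[OF t] C(2)])
    also have "(LINT y|\<mu>. (g t y - X t y) * indicator C (X t y)) =
        (LINT y|\<mu>. indicator B y *\<^sub>R g t y - indicator B y *\<^sub>R X t y)"
      by (intro Bochner_Integration.integral_cong) (auto simp: C(1) indicator_def)
    also have "\<dots> = (LINT y:B|\<mu>. g t y) - (LINT y:B|\<mu>. X t y)"
      unfolding set_lebesgue_integral_def using i B
      by (intro Bochner_Integration.integral_diff integrable_mult_indicator)
    finally show "(LINT y:B|\<mu>. g t y) = (LINT y:B|\<mu>. X t y)" by simp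
  qed
qed

sublocale projected_flow \<mu> F X "\<lambda>y. y" v A
proof unfold_locales
  show "(\<lambda>y. y) \<in> L2 \<mu>" "v \<in> L2 \<mu>" "A \<in> L2 \<mu>" by (rule id_L2 v_L2 A_L2)+
  show "X t \<in> L2F t" if "0 \<le> t" for t using X_L2[OF that] X_F by (simp add: L2F_def)
  show "(LINT y|\<mu>. k y * X t y) = (LINT y|\<mu>. k y * (y + t * v y - t\<^sup>2 / 2 * A y))"
    if t: "0 \<le> t" and k: "k \<in> L2F t" for t k
  proof -
    have [measurable]: "k \<in> borel_measurable \<mu>" using L2_measurable[OF L2F_L2[OF k]] .
    have [measurable]: "X t \<in> borel_measurable \<mu>" "E t (g t) \<in> borel_measurable \<mu>"
      using L2_measurable[OF X_L2[OF t]] by auto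
    have "(LINT y|\<mu>. k y * X t y) = (LINT y|\<mu>. k y * E t (g t) y)"
      using E_g[OF t] by (intro integral_cong_AE) auto
    also have "\<dots> = (LINT y|\<mu>. k y * g t y)" by (rule E_inner[OF t g_L2 k])
    finally show ?thesis by (simp add: g_def)
  qed
  show "L2norm \<mu> (\<lambda>y. X t y - X s y) \<le> L2norm \<mu> (\<lambda>y. (t - s) * v y - (t\<^sup>2 - s\<^sup>2) / 2 * A y)"
    if "0 \<le> s" "0 \<le> t" for s t
  proof -
    have "L2norm \<mu> (\<lambda>y. X t y - X s y) \<le> L2norm \<mu> (\<lambda>y. g t y - g s y)"
      using that by (intro is_cone_proj_contraction[OF X_proj X_proj g_L2 g_L2])
    also have "(\<lambda>y. g t y - g s y) = (\<lambda>y. (t - s) * v y - (t\<^sup>2 - s\<^sup>2) / 2 * A y)"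
      by (simp add: fun_eq_iff g_def algebra_simps diff_divide_distrib)
    finally show ?thesis .
  qed
qed

section \<open>Preserved order and the potential energy\<close>

lemma sgn_X_diff:
  assumes t: "0 \<le> t" and yz: "y \<in> S" "z \<in> S"
  shows "sgn (y - z) * (X t y - X t z) = \<bar>X t y - X t z\<bar>"
    "X t y \<noteq> X t z \<Longrightarrow> sgn (X t y - X t z) = sgn (y - z)"
proof -
  consider "y = z" | "y < z" | "z < y" by linarith
  then have "sgn (y - z) * (X t y - X t z) = \<bar>X t y - X t z\<bar> \<and>
      (X t y \<noteq> X t z \<longrightarrow> sgn (X t y - X t z) = sgn (y - z))"
  proof cases
    case 2
    then have "X t y \<le> X t z" using mono_onD[OF X_mono[OF t] yz] by simp
    then show ?thesis using 2 by auto
  next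
    case 3
    then have "X t z \<le> X t y" using mono_onD[OF X_mono[OF t] yz(2,1)] by simp
    then show ?thesis using 3 by auto
  qed simp
  then show "sgn (y - z) * (X t y - X t z) = \<bar>X t y - X t z\<bar>"
    "X t y \<noteq> X t z \<Longrightarrow> sgn (X t y - X t z) = sgn (y - z)" by auto
qed

lemma pair_sigma_finite_mu: "pair_sigma_finite \<mu> \<mu>"
  by (intro pair_sigma_finite.intro) unfold_locales

lemma integrable_pair_sgn:
  assumes "f \<in> L2 \<mu>"
  shows "integrable (\<mu> \<Otimes>\<^sub>M \<mu>) (\<lambda>(y, z). sgn (y - z) * f y)"
proof -
  interpret P: pair_sigma_finite \<mu> \<mu> by (rule pair_sigma_finite_mu)
  have [measurable]: "f \<in> borel_measurable \<mu>" using assms by (rule L2_measurable)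
  have i: "integrable \<mu> f" by (rule L2_integrable[OF finite_measure_axioms assms])
  have m: "(\<lambda>(y, z). sgn (y - z) * f y) \<in> borel_measurable (\<mu> \<Otimes>\<^sub>M \<mu>)" by measurable
  have "integrable (\<mu> \<Otimes>\<^sub>M \<mu>) (\<lambda>p. f (fst p))"
  proof (rule P.Fubini_integrable)
    show "(\<lambda>p. f (fst p)) \<in> borel_measurable (\<mu> \<Otimes>\<^sub>M \<mu>)" by measurable
    show "integrable \<mu> (\<lambda>x. LINT y|\<mu>. norm (f (fst (x, y))))" using i by simp
    show "AE x in \<mu>. integrable \<mu> (\<lambda>y. f (fst (x, y)))" by simp
  qed
  then show ?thesis
    by (rule Bochner_Integration.integrable_bound[OF _ m]) (auto simp: abs_mult sgn_if split: if_splits)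
qed

text \<open>On the support the absolute value is \<open>sgn (y - z) * (X t y - X t z)\<close>. The
  part with \<open>X t z\<close> integrates over y to a multiple of \<open>A z\<close>, since
  \<open>sgn\<close> is odd; the part with \<open>X t y\<close> gives the same contribution after
  exchanging the integrals.\<close>

lemma potential_energy:
  assumes t: "0 \<le> t"
  shows "(LINT z|\<mu>. LINT y|\<mu>. 1/2 * \<bar>X t y - X t z\<bar>) = (LINT y|\<mu>. X t y * A y)"
proof -
  interpret P: pair_sigma_finite \<mu> \<mu> by (rule pair_sigma_finite_mu)
  have [measurable]: "X t \<in> borel_measurable \<mu>" using X_L2[OF t] by (rule L2_measurable)
  have iX: "integrable \<mu> (X t)" by (rule L2_integrable[OF finite_measure_axioms X_L2[OF t]])
  have isX: "integrable \<mu> (\<lambda>y. sgn (y - z) * X t y)" for z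
    by (rule Bochner_Integration.integrable_bound[OF iX]) (auto simp: abs_mult sgn_if)
  have iXA: "integrable \<mu> (\<lambda>y. X t y * A y)" by (rule L2_mult_integrable[OF X_L2[OF t] A_L2])
  have mA: "(LINT y|\<mu>. sgn (y - z)) = - A z" for z
  proof -
    have "(LINT y|\<mu>. sgn (y - z)) = (LINT y|\<mu>. - sgn (z - y))"
      by (intro Bochner_Integration.integral_cong) (auto simp: sgn_if)
    then show ?thesis by (simp add: A_def)
  qed
  define I where "I z = (LINT y|\<mu>. sgn (y - z) * X t y)" for z
  have I[measurable]: "I \<in> borel_measurable \<mu>" unfolding I_def by measurable
  have II: "integrable \<mu> I" "(LINT z|\<mu>. I z) = (LINT y|\<mu>. X t y * A y)"
  proof -
    note i = integrable_pair_sgn[OF X_L2[OF t]]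
    show "integrable \<mu> I" using P.integrable_snd[OF i] by (simp add: I_def[abs_def])
    have "(LINT z|\<mu>. I z) = (LINT y|\<mu>. LINT z|\<mu>. sgn (y - z) * X t y)"
      unfolding I_def using P.Fubini_integral[OF i] by simp
    also have "\<dots> = (LINT y|\<mu>. X t y * A y)" by (simp add: A_def mult.commute)
    finally show "(LINT z|\<mu>. I z) = (LINT y|\<mu>. X t y * A y)" .
  qed
  have inner: "(LINT y|\<mu>. 1/2 * \<bar>X t y - X t z\<bar>) = 1/2 * I z + 1/2 * (X t z * A z)" if z: "z \<in> S" for z
  proof -
    have "(LINT y|\<mu>. 1/2 * \<bar>X t y - X t z\<bar>) =
        (LINT y|\<mu>. 1/2 * (sgn (y - z) * X t y) - 1/2 * X t z * sgn (y - z))"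
    proof (rule integral_cong_AE)
      show "AE y in \<mu>. 1/2 * \<bar>X t y - X t z\<bar> = 1/2 * (sgn (y - z) * X t y) - 1/2 * X t z * sgn (y - z)"
        using AE_S by eventually_elim (use sgn_X_diff(1)[OF t _ z] in \<open>simp add: algebra_simps\<close>)
    qed measurable
    also have "\<dots> = 1/2 * I z - 1/2 * X t z * (- A z)"
      using isX integrable_sgn[of "\<lambda>y. y - z"] unfolding I_def mA[symmetric]
      by (subst Bochner_Integration.integral_diff) auto
    finally show ?thesis by simp
  qed
  have "(LINT z|\<mu>. LINT y|\<mu>. 1/2 * \<bar>X t y - X t z\<bar>) = (LINT z|\<mu>. 1/2 * I z + 1/2 * (X t z * A z))"
    using AE_S inner by (intro integral_cong_AE) (auto elim: eventually_mono)
  also have "\<dots> = (LINT y|\<mu>. X t y * A y)" using II iXA by simp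
  finally show ?thesis .
qed

lemma potential_nonneg: "0 \<le> t \<Longrightarrow> 0 \<le> (LINT y|\<mu>. X t y * A y)"
  unfolding potential_energy[symmetric] by (intro Bochner_Integration.integral_nonneg) simp

section \<open>Regularity in time and joint measurability\<close>

lemma X_L2_lipschitz: "L2_lipschitz \<mu> X"
  by (rule L2_lipschitz_X) (rule potential_nonneg)

text \<open>Up to the time \<open>T\<close> all \<open>X s\<close> share the modulus of continuity
  of \<open>l T\<close> on the support. A jump of size e at y would therefore force a difference of
  at least e/3 almost everywhere on a whole neighbourhood of y. This has positive measure m, so the
  L2 Lipschitz bound rules it out for close times.\<close>

lemma X_continuous_time:
  assumes y: "y \<in> S"
  shows "continuous_on {0..} (\<lambda>s. X s y)"
  unfolding continuous_on_iff
proof (intro ballI allI impI)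
  fix t e :: real assume t: "t \<in> {0..}" and "e > 0"
  obtain C where C: "C \<ge> 0" "\<And>s t. 0 \<le> s \<Longrightarrow> 0 \<le> t \<Longrightarrow> L2norm \<mu> (\<lambda>y. X t y - X s y) \<le> C * \<bar>t - s\<bar>"
    using X_L2_lipschitz unfolding L2_lipschitz_def by blast
  define T where "T = t + 1"
  have "e / 3 > 0" using \<open>e > 0\<close> by simp
  have "\<exists>d>0. \<forall>z. dist z y < d \<longrightarrow> dist (l T z) (l T y) < e / 3"
    using l_uniformly_continuous[of T] \<open>e / 3 > 0\<close> unfolding uniformly_continuous_on_def by (metis UNIV_I)
  then obtain d where d: "d > 0" "\<And>z. dist z y < d \<Longrightarrow> dist (l T z) (l T y) < e / 3" by auto
  let ?B = "{y - d<..<y + d}"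
  have osc: "\<bar>X s z - X s y\<bar> \<le> e / 3" if s: "0 \<le> s" "s \<le> T" and z: "z \<in> S" "z \<in> ?B" for s z
  proof -
    have le: "\<bar>X s a - X s b\<bar> \<le> \<bar>l T a - l T b\<bar>" if "a \<in> S" "b \<in> S" "b \<le> a" for a b
    proof -
      have "0 \<le> variation_fun v a - variation_fun v b" using monoD[OF mono_variation_fun[OF ac] that(3)] by simp
      then have "s * (variation_fun v a - variation_fun v b) \<le> T * (variation_fun v a - variation_fun v b)"
        using s(2) by (rule mult_right_mono[rotated])
      then have "l s a - l s b \<le> l T a - l T b" by (simp add: l_def right_diff_distrib)
      then show ?thesis
        using mono_onD[OF X_mono[OF s(1)] that(2,1,3)] mono_onD[OF l_minus_X_mono[OF s(1)] that(2,1,3)] by simp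
    qed
    have "\<bar>X s z - X s y\<bar> \<le> \<bar>l T z - l T y\<bar>"
      using le[OF z(1) y] le[OF y z(1)] by (cases "y \<le> z") (auto simp: abs_minus_commute)
    moreover have "dist z y < d" using z(2) by (auto simp: dist_real_def)
    ultimately show ?thesis using d(2)[of z] by (simp add: dist_real_def)
  qed
  define m where "m = measure \<mu> ?B"
  have m: "m > 0" using y d(1) by (simp add: m_def msupp_def)
  \<comment> \<open>Chosen so that \<open>C * r\<close> stays below \<open>e / 3 * sqrt m\<close>;
    \<open>C + 1\<close> covers \<open>C = 0\<close> and gives strictness, and the bound by 1 keeps
    s below \<open>T\<close>.\<close>
  define r where "r = min 1 (e / 3 * sqrt m / (C + 1))"
  have r: "r > 0" "r \<le> 1" using \<open>e > 0\<close> m C(1) by (auto simp: r_def)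
  have "r \<le> e / 3 * sqrt m / (C + 1)" by (simp add: r_def)
  moreover have "0 < C + 1" using C(1) by simp
  ultimately have rC: "r * (C + 1) \<le> e / 3 * sqrt m" by (simp only: pos_le_divide_eq)
  have "dist (X s y) (X t y) < e" if s: "s \<in> {0..}" "dist s t < r" for s
  proof (rule ccontr)
    assume "\<not> dist (X s y) (X t y) < e"
    then have big: "e \<le> \<bar>X s y - X t y\<bar>" by (simp add: dist_real_def)
    have s0: "0 \<le> s" "s \<le> T" "0 \<le> t" "t \<le> T" using s t r(2) by (auto simp: dist_real_def T_def)
    have lower: "e / 3 \<le> \<bar>X s z - X t z\<bar>" if "z \<in> S" "z \<in> ?B" for z
      using osc[OF s0(1,2) that] osc[OF s0(3,4) that] big by linarith
    have D: "(\<lambda>z. X s z - X t z) \<in> L2 \<mu>" by (intro L2_diff X_L2 s0)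
    have "(e / 3)\<^sup>2 * m = (LINT z|\<mu>. (e / 3)\<^sup>2 * indicator ?B z)" by (simp add: m_def)
    also have "\<dots> \<le> (LINT z|\<mu>. (X s z - X t z)\<^sup>2)"
    proof (rule integral_mono_AE)
      show "integrable \<mu> (\<lambda>z. (e / 3)\<^sup>2 * indicator ?B z)"
        by (intro integrable_mult_right integrable_real_indicator) (auto simp: less_top[symmetric])
      show "integrable \<mu> (\<lambda>z. (X s z - X t z)\<^sup>2)" by (rule L2_integrable_power2[OF D])
      show "AE z in \<mu>. (e / 3)\<^sup>2 * indicator ?B z \<le> (X s z - X t z)\<^sup>2"
        using AE_S
      proof eventually_elim
        case (elim z)
        show ?case
        proof (cases "z \<in> ?B")
          case True
          from lower[OF elim True] \<open>e > 0\<close> have "(e / 3)\<^sup>2 \<le> \<bar>X s z - X t z\<bar>\<^sup>2" by (intro power_mono) auto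
          then show ?thesis using True by simp
        qed simp
      qed
    qed
    also have "\<dots> = (L2norm \<mu> (\<lambda>z. X s z - X t z))\<^sup>2" by (simp add: L2norm_power2)
    also have "\<dots> \<le> (C * \<bar>s - t\<bar>)\<^sup>2" by (intro power_mono C(2) s0) simp
    also have "\<dots> < (e / 3 * sqrt m)\<^sup>2"
    proof (rule power_strict_mono)
      have "C * \<bar>s - t\<bar> \<le> C * r" using s(2) C(1) by (intro mult_left_mono) (auto simp: dist_real_def)
      also have "\<dots> < r * (C + 1)" using r(1) by (simp add: algebra_simps)
      finally show "C * \<bar>s - t\<bar> < e / 3 * sqrt m" using rC by simp
    qed (use C(1) in auto)
    also have "\<dots> = (e / 3)\<^sup>2 * m" using m by (simp add: power_mult_distrib power_divide)
    finally show False by simp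
  qed
  then show "\<exists>r>0. \<forall>s\<in>{0..}. dist s t < r \<longrightarrow> dist (X s y) (X t y) < e" using r(1) by blast
qed

text \<open>\<open>X\<close> is unspecified at negative times, whence \<open>max 0 s\<close>.\<close>

lemma X_joint_measurable: "(\<lambda>(s, y). X (max 0 s) y) \<in> borel_measurable (lborel \<Otimes>\<^sub>M \<mu>)"
proof (rule borel_measurable_LIMSEQ_real)
  \<comment> \<open>Time is rounded down to a grid, so each \<open>f n\<close> uses countably many
    of the measurable functions \<open>X (i / (n + 1))\<close>; for negative s, \<open>nat\<close>
    turns the index into 0. Convergence is continuity in time, applied at \<open>retr y\<close>,
    which lies in the support.\<close>
  define f where "f n = (\<lambda>(s, y). X (real (nat \<lfloor>s * real (Suc n)\<rfloor>) / real (Suc n)) y)" for n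
  show "f n \<in> borel_measurable (lborel \<Otimes>\<^sub>M \<mu>)" for n
  proof -
    have "(\<lambda>p. (\<lambda>i p. X (real i / real (Suc n)) (snd p)) (nat \<lfloor>fst p * real (Suc n)\<rfloor>) p) \<in>
        borel_measurable (lborel \<Otimes>\<^sub>M \<mu>)"
    proof (rule measurable_compose_countable[where f="\<lambda>i p. X (real i / real (Suc n)) (snd p)"
          and g="\<lambda>p. nat \<lfloor>fst p * real (Suc n)\<rfloor>"])
      show "(\<lambda>p. X (real i / real (Suc n)) (snd p)) \<in> borel_measurable (lborel \<Otimes>\<^sub>M \<mu>)" for i
      proof -
        have "X (real i / real (Suc n)) \<in> borel_measurable \<mu>"
          using X_measurable[of "real i / real (Suc n)"] by (simp add: borel_measurable_mu)
        then show ?thesis by (rule measurable_compose[OF measurable_snd])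
      qed
      show "(\<lambda>p. nat \<lfloor>fst p * real (Suc n)\<rfloor>) \<in> measurable (lborel \<Otimes>\<^sub>M \<mu>) (count_space UNIV)"
        by measurable
    qed
    then show ?thesis by (simp add: f_def split_beta')
  qed
  fix p :: "real \<times> real" assume "p \<in> space (lborel \<Otimes>\<^sub>M \<mu>)"
  obtain s y where p: "p = (s, y)" by fastforce
  have lim: "(\<lambda>n. real (nat \<lfloor>s * real (Suc n)\<rfloor>) / real (Suc n)) \<longlonglongrightarrow> max 0 s"
  proof (rule tendsto_sandwich)
    show "eventually (\<lambda>n. max 0 s - 1 / real (Suc n) \<le> real (nat \<lfloor>s * real (Suc n)\<rfloor>) / real (Suc n)) sequentially"
    proof (intro always_eventually allI)
      fix n
      have "max 0 s * real (Suc n) - 1 \<le> real (nat \<lfloor>s * real (Suc n)\<rfloor>)"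
      proof (cases "0 \<le> s")
        case True
        have "q - 1 \<le> real (nat \<lfloor>q\<rfloor>)" for q :: real by linarith
        from this[of "s * real (Suc n)"] True show ?thesis by (simp only: max_absorb2)
      next
        case False
        then show ?thesis by simp
      qed
      then have "(max 0 s * real (Suc n) - 1) / real (Suc n) \<le> real (nat \<lfloor>s * real (Suc n)\<rfloor>) / real (Suc n)"
        by (rule divide_right_mono) simp
      then show "max 0 s - 1 / real (Suc n) \<le> real (nat \<lfloor>s * real (Suc n)\<rfloor>) / real (Suc n)"
        by (simp add: diff_divide_distrib del: of_nat_Suc)
    qed
    show "eventually (\<lambda>n. real (nat \<lfloor>s * real (Suc n)\<rfloor>) / real (Suc n) \<le> max 0 s) sequentially"
    proof (intro always_eventually allI)
      fix n
      have "real (nat \<lfloor>s * real (Suc n)\<rfloor>) \<le> max 0 s * real (Suc n)"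
      proof (cases "0 \<le> s")
        case True
        then have "0 \<le> s * real (Suc n)" by simp
        then have "real (nat \<lfloor>s * real (Suc n)\<rfloor>) \<le> s * real (Suc n)" by linarith
        then show ?thesis using True by simp
      next
        case False
        then have "s * real (Suc n) \<le> 0" by (intro mult_nonpos_nonneg) auto
        then have "nat \<lfloor>s * real (Suc n)\<rfloor> = 0" by linarith
        then show ?thesis using False by simp
      qed
      then show "real (nat \<lfloor>s * real (Suc n)\<rfloor>) / real (Suc n) \<le> max 0 s"
        by (simp add: pos_divide_le_eq)
    qed
    have "(\<lambda>n. 1 / real (Suc n)) \<longlonglongrightarrow> 0" using LIMSEQ_inverse_real_of_nat by (simp add: inverse_eq_divide)
    from tendsto_diff[OF tendsto_const this, of "max 0 s"]
    show "(\<lambda>n. max 0 s - 1 / real (Suc n)) \<longlonglongrightarrow> max 0 s" by simp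
  qed auto
  have "continuous_on {0..} (\<lambda>s. X s (retr y))" by (rule X_continuous_time) simp
  then have "(\<lambda>n. X (real (nat \<lfloor>s * real (Suc n)\<rfloor>) / real (Suc n)) (retr y)) \<longlonglongrightarrow> X (max 0 s) (retr y)"
    by (rule continuous_on_tendsto_compose[OF _ lim]) auto
  then show "(\<lambda>n. f n p) \<longlonglongrightarrow> (case p of (s, y) \<Rightarrow> X (max 0 s) y)"
    by (simp add: p f_def X_retr)
qed

section \<open>The force and its time integral\<close>

definition force :: "real \<Rightarrow> real \<Rightarrow> real" where
  "force s y = (LINT z|\<mu>. sgn (X (max 0 s) y - X (max 0 s) z))"

lemma force_eq: "0 \<le> s \<Longrightarrow> EP_force \<mu> X s y = force s y"
proof -
  assume s: "0 \<le> s"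
  have [measurable]: "X s \<in> borel_measurable \<mu>" using L2_measurable[OF X_L2[OF s]] .
  show ?thesis
    unfolding EP_force_def sgn_conv_def force_def using s
    by (subst integral_distr) auto
qed

lemma force_measurable [measurable]: "(\<lambda>(s, y). force s y) \<in> borel_measurable (lborel \<Otimes>\<^sub>M \<mu>)"
proof -
  have 1: "(\<lambda>p. X (max 0 (fst (fst p))) (snd (fst p))) \<in> borel_measurable ((lborel \<Otimes>\<^sub>M \<mu>) \<Otimes>\<^sub>M \<mu>)"
    using measurable_compose[OF measurable_fst X_joint_measurable] by (simp add: split_beta')
  have "(\<lambda>p. (fst (fst p), snd p)) \<in> measurable ((lborel \<Otimes>\<^sub>M \<mu>) \<Otimes>\<^sub>M \<mu>) (lborel \<Otimes>\<^sub>M \<mu>)" by measurable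
  from measurable_compose[OF this X_joint_measurable]
  have 2: "(\<lambda>p. X (max 0 (fst (fst p))) (snd p)) \<in> borel_measurable ((lborel \<Otimes>\<^sub>M \<mu>) \<Otimes>\<^sub>M \<mu>)" by simp
  have "(\<lambda>(q, z). sgn (X (max 0 (fst q)) (snd q) - X (max 0 (fst q)) z)) \<in> borel_measurable ((lborel \<Otimes>\<^sub>M \<mu>) \<Otimes>\<^sub>M \<mu>)"
    using measurable_compose[OF borel_measurable_diff[OF 1 2] borel_measurable_sgn] by (simp add: split_beta')
  from borel_measurable_lebesgue_integral[OF this]
  show ?thesis by (simp add: force_def split_beta')
qed

lemma abs_force_le: "\<bar>force s y\<bar> \<le> 1" unfolding force_def by (rule abs_integral_sgn_le)

text \<open>The force is the conditional expectation of \<open>A\<close> given \<open>X s\<close>: the difference is antisymmetric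
  in the two integration variables.\<close>

lemma force_inner:
  assumes s: "0 \<le> s" and k: "k \<in> borel_measurable \<mu>" "\<And>y. \<bar>k y\<bar> \<le> 1"
    and kX: "\<And>y z. X s y = X s z \<Longrightarrow> k y = k z"
  shows "(LINT y|\<mu>. force s y * k y) = (LINT y|\<mu>. A y * k y)"
proof -
  interpret P: pair_sigma_finite \<mu> \<mu> by (rule pair_sigma_finite_mu)
  interpret PP: pair_prob_space \<mu> \<mu> by unfold_locales
  have [measurable]: "X s \<in> borel_measurable \<mu>" using L2_measurable[OF X_L2[OF s]] .
  note [measurable] = k(1)
  define D where "D y z = (sgn (X s y - X s z) - sgn (y - z)) * k y" for y z
  have Dm: "(\<lambda>(y, z). D y z) \<in> borel_measurable (\<mu> \<Otimes>\<^sub>M \<mu>)" unfolding D_def by measurable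
  have Db: "\<bar>D y z\<bar> \<le> 2" for y z
  proof -
    have "\<bar>sgn (X s y - X s z) - sgn (y - z)\<bar> \<le> 2" by (simp add: sgn_if)
    from mult_mono[OF this k(2)[of y]] show ?thesis by (simp add: D_def abs_mult)
  qed
  have Di: "integrable (\<mu> \<Otimes>\<^sub>M \<mu>) (\<lambda>(y, z). D y z)"
    using Dm Db by (intro PP.P.integrable_const_bound[where B=2]) auto
  have anti: "D y z = - D z y" if "y \<in> S" "z \<in> S" for y z
  proof (cases "X s y = X s z")
    case True
    have "sgn (z - y) = - sgn (y - z)" using sgn_minus[of "y - z"] by simp
    then show ?thesis unfolding D_def True kX[OF True] by simp
  next
    case False
    then show ?thesis using sgn_X_diff(2)[OF s that] sgn_X_diff(2)[OF s that(2,1)] by (simp add: D_def)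
  qed
  have sw: "(LINT z|\<mu>. LINT y|\<mu>. D y z) = (LINT y|\<mu>. LINT z|\<mu>. D y z)"
    using P.Fubini_integral[OF Di] by simp
  have "(LINT z|\<mu>. LINT y|\<mu>. D y z) = (LINT z|\<mu>. LINT y|\<mu>. - D z y)"
  proof (rule integral_cong_AE)
    show "AE z in \<mu>. (LINT y|\<mu>. D y z) = (LINT y|\<mu>. - D z y)"
      using AE_S
    proof eventually_elim
      case (elim z)
      show ?case
      proof (rule integral_cong_AE)
        show "AE y in \<mu>. D y z = - D z y" using AE_S by eventually_elim (rule anti[OF _ elim])
      qed (use Dm in \<open>auto simp: D_def\<close>)
    qed
  qed (simp_all add: D_def)
  also have "\<dots> = - (LINT y|\<mu>. LINT z|\<mu>. D y z)" by simp
  finally have zero: "(LINT y|\<mu>. LINT z|\<mu>. D y z) = 0" using sw by simp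
  have "(LINT z|\<mu>. D y z) = force s y * k y - A y * k y" for y
  proof -
    have "(LINT z|\<mu>. D y z) = (LINT z|\<mu>. sgn (X s y - X s z) * k y - sgn (y - z) * k y)"
      by (simp add: D_def left_diff_distrib)
    also have "\<dots> = force s y * k y - A y * k y"
      using integrable_sgn[of "\<lambda>z. X s y - X s z"] integrable_sgn[of "\<lambda>z. y - z"] s
      by (simp add: force_def A_def)
    finally show ?thesis .
  qed
  then have "(LINT y|\<mu>. force s y * k y - A y * k y) = 0" using zero by simp
  moreover have "integrable \<mu> (\<lambda>y. force s y * k y)"
  proof (rule integrable_const_bound[where B=1])
    have "(\<lambda>y. force s y) \<in> borel_measurable \<mu>" unfolding force_def using s by simp
    then show "(\<lambda>y. force s y * k y) \<in> borel_measurable \<mu>" by measurable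
    show "AE y in \<mu>. norm (force s y * k y) \<le> 1"
      using abs_force_le k(2) by (simp add: abs_mult mult_le_one)
  qed
  moreover have "integrable \<mu> (\<lambda>y. A y * k y)"
    using abs_A_le k(2) by (intro integrable_const_bound[where B=1]) (auto simp: abs_mult mult_le_one)
  ultimately show ?thesis by simp
qed

definition impulse :: "real \<Rightarrow> real \<Rightarrow> real" where
  "impulse t y = (LINT s|lborel. indicator {0..t} s * force s y)"

lemma impulse_eq: "EP_free_velocity \<mu> v X t y = v y - impulse t y"
proof -
  have "(LINT s:{0..t}|lborel. EP_force \<mu> X s y) = impulse t y"
    unfolding set_lebesgue_integral_def impulse_def
    by (intro Bochner_Integration.integral_cong) (auto simp: force_eq indicator_def)
  then show ?thesis by (simp add: EP_free_velocity_def)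
qed

lemma force_integrable: "integrable lborel (\<lambda>s. indicator {0..t} s * force s y)"
proof (rule Bochner_Integration.integrable_bound[where f="indicator {0..t} :: real \<Rightarrow> real"])
  show "integrable lborel (indicator {0..t} :: real \<Rightarrow> real)"
    by (intro integrable_real_indicator) (auto simp: emeasure_lborel_Icc_eq)
  show "AE s in lborel. norm (indicator {0..t} s * force s y) \<le> norm (indicator {0..t} s :: real)"
    using abs_force_le by (auto simp: indicator_def)
qed measurable

lemma impulse_measurable: "impulse t \<in> borel_measurable \<mu>"
proof -
  have "(\<lambda>p. (snd p, fst p)) \<in> measurable (\<mu> \<Otimes>\<^sub>M lborel) (lborel \<Otimes>\<^sub>M \<mu>)" by measurable
  from measurable_compose[OF this force_measurable]
  have "(\<lambda>(y, s). force s y) \<in> borel_measurable (\<mu> \<Otimes>\<^sub>M lborel)" by (simp add: split_beta')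
  then have "(\<lambda>(y, s). indicator {0..t} s * force s y) \<in> borel_measurable (\<mu> \<Otimes>\<^sub>M lborel)"
    by measurable
  then show ?thesis
    unfolding impulse_def by (rule lborel.borel_measurable_lebesgue_integral)
qed

lemma abs_impulse_le: "0 \<le> t \<Longrightarrow> \<bar>impulse t y\<bar> \<le> t"
proof -
  assume t: "0 \<le> t"
  have "\<bar>impulse t y\<bar> \<le> (LINT s|lborel. \<bar>indicator {0..t} s * force s y\<bar>)"
    unfolding impulse_def by (rule integral_abs_bound)
  also have "\<dots> \<le> (LINT s|lborel. indicator {0..t} s)"
    using force_integrable[of t y] abs_force_le
    by (intro integral_mono integrable_real_indicator) (auto simp: emeasure_lborel_Icc_eq indicator_def)
  also have "\<dots> = t" using t by simp
  finally show ?thesis .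
qed

lemma impulse_L2: "0 \<le> t \<Longrightarrow> impulse t \<in> L2 \<mu>"
  by (rule L2_bounded[OF finite_measure_axioms impulse_measurable abs_impulse_le])

text \<open>Here the monotonicity of the filtration enters the identification of the force: a
  function of \<open>X t\<close> is a function of \<open>X s\<close> for each
  \<open>s \<le> t\<close>. Thus \<open>force_inner\<close> applies at every earlier time with the
  same right-hand side, and Fubini integrates this over a time interval of length t.\<close>

lemma impulse_inner:
  assumes t: "0 \<le> t" and k: "k \<in> borel_measurable \<mu>" "\<And>y. \<bar>k y\<bar> \<le> 1"
    and kX: "\<And>y z. X t y = X t z \<Longrightarrow> k y = k z"
  shows "(LINT y|\<mu>. impulse t y * k y) = t * (LINT y|\<mu>. A y * k y)"
proof -
  interpret P: pair_sigma_finite lborel \<mu> by (intro pair_sigma_finite.intro) unfold_locales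
  note [measurable] = k(1)
  define f where "f s y = indicator {0..t} s * force s y * k y" for s y
  have fm: "(\<lambda>(s, y). f s y) \<in> borel_measurable (lborel \<Otimes>\<^sub>M \<mu>)" unfolding f_def by measurable
  have fb: "\<bar>f s y\<bar> \<le> indicator {0..t} s" for s y
    using abs_force_le[of s y] k(2)[of y] by (auto simp: f_def indicator_def abs_mult mult_le_one)
  have fi: "integrable (lborel \<Otimes>\<^sub>M \<mu>) (\<lambda>(s, y). f s y)"
  proof (rule P.Fubini_integrable[OF fm])
    have nm: "(\<lambda>s. LINT y|\<mu>. norm (f s y)) \<in> borel_measurable lborel"
      using borel_measurable_lebesgue_integral[of "\<lambda>s y. norm (f s y)" lborel] measurable_compose[OF fm borel_measurable_norm]
      by (simp add: split_beta')
    have 1: "integrable \<mu> (\<lambda>y. f s y)" for s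
    proof (rule integrable_const_bound[where B=1])
      show "AE y in \<mu>. norm (f s y) \<le> 1"
      proof (rule AE_I2)
        show "norm (f s y) \<le> 1" for y using order_trans[OF fb[of s y], of 1] by (simp add: indicator_def)
      qed
      show "(\<lambda>y. f s y) \<in> borel_measurable \<mu>" using measurable_compose[OF measurable_Pair1' fm, of s] by simp
    qed
    then show "AE s in lborel. integrable \<mu> (\<lambda>y. case (s, y) of (s, y) \<Rightarrow> f s y)" by simp
    show "integrable lborel (\<lambda>s. LINT y|\<mu>. norm (case (s, y) of (s, y) \<Rightarrow> f s y))"
    proof (rule Bochner_Integration.integrable_bound[where f="indicator {0..t} :: real \<Rightarrow> real"])
      show "integrable lborel (indicator {0..t} :: real \<Rightarrow> real)"
        by (intro integrable_real_indicator) (auto simp: emeasure_lborel_Icc_eq)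
      have "(LINT y|\<mu>. norm (f s y)) \<le> (LINT y|\<mu>. indicator {0..t} s)" for s
        using 1 fb by (intro integral_mono) auto
      then show "AE s in lborel. norm (LINT y|\<mu>. norm (case (s, y) of (s, y) \<Rightarrow> f s y)) \<le> norm (indicator {0..t} s :: real)"
        by simp
      show "(\<lambda>s. LINT y|\<mu>. norm (case (s, y) of (s, y) \<Rightarrow> f s y)) \<in> borel_measurable lborel"
        using nm by simp
    qed
  qed
  have "(LINT y|\<mu>. impulse t y * k y) = (LINT y|\<mu>. LINT s|lborel. f s y)"
    by (simp add: impulse_def f_def)
  also have "\<dots> = (LINT s|lborel. LINT y|\<mu>. f s y)" using P.Fubini_integral[OF fi] by simp
  also have "\<dots> = (LINT s|lborel. indicator {0..t} s * (LINT y|\<mu>. A y * k y))"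
  proof (rule Bochner_Integration.integral_cong[OF refl])
    fix s :: real
    show "(LINT y|\<mu>. f s y) = indicator {0..t} s * (LINT y|\<mu>. A y * k y)"
    proof (cases "s \<in> {0..t}")
      case True
      then have s: "0 \<le> s" "s \<le> t" by auto
      obtain \<phi> where \<phi>: "\<phi> \<in> borel_measurable borel" "\<And>y. X t y = \<phi> (X s y)" using X_factor[OF s] by blast
      have "k y = k z" if "X s y = X s z" for y z using that \<phi>(2) by (intro kX) simp
      from force_inner[OF s(1) k this] True show ?thesis by (simp add: f_def)
    qed (simp add: f_def)
  qed
  also have "\<dots> = t * (LINT y|\<mu>. A y * k y)" using t by simp
  finally show ?thesis .
qed

lemma cond_exp_free_velocity:
  assumes t: "0 \<le> t"
  shows "AE y in \<mu>. cond_exp_given \<mu> (EP_free_velocity \<mu> v X t) (X t) y = V t y"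
proof -
  interpret Sub: finite_measure_subalgebra \<mu> "F t" by unfold_locales (rule F_sub[OF t])
  have fv: "EP_free_velocity \<mu> v X t = (\<lambda>y. v y - impulse t y)" by (simp add: fun_eq_iff impulse_eq)
  have fL: "(\<lambda>y. v y - impulse t y) \<in> L2 \<mu>" by (intro L2_diff v_L2 impulse_L2 t)
  have "AE y in \<mu>. E t (\<lambda>y. v y - impulse t y) y = V t y"
  proof (rule Sub.real_cond_exp_charact)
    show i: "integrable \<mu> (\<lambda>y. v y - impulse t y)" "integrable \<mu> (V t)"
      by (intro L2_integrable finite_measure_axioms fL VL t)+
    show "V t \<in> borel_measurable (F t)" using V_L2F[OF t] by (simp add: L2F_def)
    fix B assume B: "B \<in> sets (F t)"
    then obtain C where C: "B = X t -` C" by (auto simp: sets_F)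
    have Bm: "B \<in> sets \<mu>" using F_sub[OF t] B by (auto simp: subalgebra_def)
    let ?k = "indicator B :: real \<Rightarrow> real"
    have kL: "?k \<in> L2 \<mu>" using Bm by (intro L2_bounded[OF finite_measure_axioms, where B=1]) (auto simp: indicator_def)
    have kF: "?k \<in> L2F t" using kL B by (simp add: L2F_def)
    have "(LINT y|\<mu>. impulse t y * ?k y) = t * (LINT y|\<mu>. A y * ?k y)"
    proof (rule impulse_inner[OF t L2_measurable[OF kL]])
      show "\<bar>?k y\<bar> \<le> 1" for y by (simp add: indicator_def)
      show "X t y = X t z \<Longrightarrow> ?k y = ?k z" for y z by (simp add: C indicator_def)
    qed
    moreover have "(LINT y|\<mu>. ?k y * V t y) = (LINT y|\<mu>. ?k y * v y) - t * (LINT y|\<mu>. ?k y * A y)"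
      by (rule V_inner[OF t kF])
    moreover have "(LINT y|\<mu>. ?k y * (v y - impulse t y)) = (LINT y|\<mu>. ?k y * v y) - (LINT y|\<mu>. ?k y * impulse t y)"
      using L2_mult_integrable[OF kL v_L2] L2_mult_integrable[OF kL impulse_L2[OF t]]
      by (simp add: right_diff_distrib)
    ultimately show "(LINT y:B|\<mu>. v y - impulse t y) = (LINT y:B|\<mu>. V t y)"
      by (simp add: set_lebesgue_integral_def mult.commute)
  qed
  then show ?thesis unfolding cond_exp_given_def fv F_def .
qed

section \<open>The flow equation and the energy\<close>

lemma has_L2_deriv_cong_AE:
  assumes d: "has_L2_deriv \<mu> X t U" and t: "0 < t"
    and W: "W \<in> borel_measurable \<mu>" "AE y in \<mu>. U y = W y"
  shows "has_L2_deriv \<mu> X t W"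
  unfolding has_L2_deriv_def
proof
  have UL: "U \<in> L2 \<mu>" using d by (simp add: has_L2_deriv_def)
  show WL: "W \<in> L2 \<mu>" by (rule L2_cong_AE[OF UL W])
  \<comment> \<open>Only \<open>\<tau> > - t\<close> is considered, because at negative times
    \<open>X\<close> is unspecified and need not be measurable.\<close>
  have "eventually (\<lambda>\<tau>. \<tau> \<in> {- t<..}) (at 0)" using t by (intro eventually_at_in_open') auto
  then have "eventually (\<lambda>\<tau>. L2norm \<mu> (\<lambda>y. (X (t + \<tau>) y - X t y) / \<tau> - U y) =
      L2norm \<mu> (\<lambda>y. (X (t + \<tau>) y - X t y) / \<tau> - W y)) (at 0)"
  proof eventually_elim
    case (elim \<tau>)
    then have [measurable]: "X (t + \<tau>) \<in> borel_measurable \<mu>" "X t \<in> borel_measurable \<mu>"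
      using t by (auto intro!: L2_measurable X_L2)
    note [measurable] = L2_measurable[OF UL] L2_measurable[OF WL]
    show ?case using W(2) by (intro L2norm_cong_AE) (auto elim: eventually_mono)
  qed
  from tendsto_cong[OF this] d
  show "((\<lambda>\<tau>. L2norm \<mu> (\<lambda>y. (X (t + \<tau>) y - X t y) / \<tau> - W y)) \<longlongrightarrow> 0) (at 0)"
    by (simp add: has_L2_deriv_def)
qed

lemma EP_flow_at_X:
  assumes t: "0 < t" and d: "has_L2_deriv \<mu> X t (V t)"
  shows "EP_flow_at \<mu> v X t"
  unfolding EP_flow_at_def
proof (intro conjI)
  have "set_integrable lborel {0..t} (\<lambda>s. EP_force \<mu> X s y)" for y
    unfolding set_integrable_def
    using force_integrable[of t y] by (rule Bochner_Integration.integrable_cong[THEN iffD1, rotated 2])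
      (auto simp: force_eq indicator_def)
  then show "AE y in \<mu>. set_integrable lborel {0..t} (\<lambda>s. EP_force \<mu> X s y)" by simp
  have "EP_free_velocity \<mu> v X t = (\<lambda>y. v y - impulse t y)" by (simp add: fun_eq_iff impulse_eq)
  then show "EP_free_velocity \<mu> v X t \<in> L2 \<mu>" using t by (simp add: L2_diff v_L2 impulse_L2)
  show "has_L2_deriv \<mu> X t (cond_exp_given \<mu> (EP_free_velocity \<mu> v X t) (X t))"
    using cond_exp_free_velocity[of t] t
    by (intro has_L2_deriv_cong_AE[OF d t]) (auto simp: cond_exp_given_def elim: eventually_mono)
qed

text \<open>The decay of \<open>energy\<close> is known between all nonnegative times, while
  \<open>EP_energy\<close> uses a chosen derivative. At times where \<open>V t\<close> is a
  derivative, uniqueness identifies the two almost everywhere, and the inequality carries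
  over.\<close>

lemma EP_energy_X:
  assumes t: "0 < t" and d: "has_L2_deriv \<mu> X t (V t)"
  shows "EP_energy \<mu> X t = energy t"
proof -
  have D: "has_L2_deriv \<mu> X t (L2_deriv \<mu> X t)" unfolding L2_deriv_def by (rule someI[of _ "V t"]) (rule d)
  have AE: "AE y in \<mu>. L2_deriv \<mu> X t y = V t y" by (rule has_L2_deriv_unique[OF X_L2_lipschitz t D d])
  have [measurable]: "L2_deriv \<mu> X t \<in> borel_measurable \<mu>" "V t \<in> borel_measurable \<mu>"
    using D d by (auto simp: has_L2_deriv_def intro: L2_measurable)
  have "(LINT y|\<mu>. 1/2 * (L2_deriv \<mu> X t y)\<^sup>2) = (LINT y|\<mu>. 1/2 * (V t y)\<^sup>2)"
    using AE by (intro integral_cong_AE) (auto elim: eventually_mono)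
  then show ?thesis using potential_energy[of t] t by (simp add: EP_energy_def energy_def)
qed

end

theorem theorem1p2:
  fixes \<rho>0 :: "real measure" and v0 :: "real \<Rightarrow> real"
  assumes "prob_space \<rho>0" and "sets \<rho>0 = sets borel"
    and "integrable \<rho>0 (\<lambda>x. x\<^sup>2)"
    and "abs_continuous v0"
  shows "\<exists>X :: real \<Rightarrow> real \<Rightarrow> real.
    L2_lipschitz \<rho>0 X \<and>
    (AE t in lborel. 0 \<le> t \<longrightarrow> EP_flow_at \<rho>0 v0 X t) \<and>
    (AE y in \<rho>0. X 0 y = y) \<and>
    (\<exists>N \<in> null_sets lborel. \<forall>s t. 0 \<le> s \<and> s \<le> t \<and> s \<notin> N \<and> t \<notin> N \<longrightarrow>
       EP_energy \<rho>0 X t \<le> EP_energy \<rho>0 X s) \<and>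
    (\<forall>t\<ge>0. \<forall>y\<in>msupp \<rho>0. \<forall>z\<in>msupp \<rho>0. z \<le> y \<longrightarrow>
       0 \<le> X t y - X t z \<and>
       X t y - X t z \<le> y - z + t * (LINT x:{z..y}|lebesgue. \<bar>deriv v0 x\<bar>)) \<and>
    (\<forall>s t. 0 < s \<and> s \<le> t \<longrightarrow> (\<forall>y\<in>msupp \<rho>0. \<forall>z\<in>msupp \<rho>0.
       1 / t * \<bar>X t y - X t z\<bar> \<le> 1 / s * \<bar>X s y - X s z\<bar>))"
proof -
  interpret euler_poisson_data \<rho>0 v0
    by (intro euler_poisson_data.intro euler_poisson_data_axioms.intro assms)
  obtain D where D: "countable D" "\<And>t. 0 < t \<Longrightarrow> t \<notin> D \<Longrightarrow>
      ((\<lambda>r. L2norm \<rho>0 (\<lambda>y. V r y - V t y)) \<longlongrightarrow> 0) (at t)"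
    by (rule V_continuous_off_countable) (rule that)
  \<comment> \<open>Besides the discontinuities of \<open>V\<close>, the time 0 is excluded: a
    two-sided difference quotient there would involve \<open>X\<close> at negative times.\<close>
  define N where "N = insert 0 D"
  have N: "N \<in> null_sets lborel" unfolding N_def using D(1) by (intro countable_imp_null_set_lborel) simp
  have d: "has_L2_deriv \<rho>0 X t (V t)" if "0 < t" "t \<notin> N" for t
    using that by (intro has_L2_deriv_V D(2)) (auto simp: N_def)
  show ?thesis
  proof (intro exI[of _ X] conjI bexI[OF _ N] allI impI ballI; (elim conjE)?)
    show "L2_lipschitz \<rho>0 X" by (rule X_L2_lipschitz)
    show "AE t in lborel. 0 \<le> t \<longrightarrow> EP_flow_at \<rho>0 v0 X t"
      using AE_not_in[OF N]
    proof eventually_elim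
      case (elim t)
      then show ?case using d[of t] by (auto simp: N_def intro!: EP_flow_at_X)
    qed
    show "AE y in \<rho>0. X 0 y = y" using AE_S by eventually_elim (simp add: X_0)
    fix s t :: real assume st: "0 \<le> s" "s \<le> t" "s \<notin> N" "t \<notin> N"
    then have "s \<noteq> 0" by (auto simp: N_def)
    then show "EP_energy \<rho>0 X t \<le> EP_energy \<rho>0 X s"
      using st EP_energy_X[OF _ d[of s]] EP_energy_X[OF _ d[of t]] energy_antimono[OF st(1,2)] by simp
  next
    fix t y z :: real assume t: "0 \<le> t" and yz: "y \<in> S" "z \<in> S" "z \<le> y"
    show "0 \<le> X t y - X t z" using mono_onD[OF X_mono[OF t] yz(2,1,3)] by simp
    have "X t y - X t z \<le> l t y - l t z" using mono_onD[OF l_minus_X_mono[OF t] yz(2,1,3)] by simp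
    also have "\<dots> = y - z + t * (variation_fun v0 y - variation_fun v0 z)" by (simp add: l_def right_diff_distrib)
    also have "\<dots> \<le> y - z + t * (LINT x:{z..y}|lebesgue. \<bar>deriv v0 x\<bar>)"
      using t variation_le_integral_deriv[OF ac yz(3)] by (intro add_left_mono mult_left_mono)
    finally show "X t y - X t z \<le> y - z + t * (LINT x:{z..y}|lebesgue. \<bar>deriv v0 x\<bar>)" .
  next
    fix s t y z :: real assume "0 < s" "s \<le> t" "y \<in> S" "z \<in> S"
    then show "1 / t * \<bar>X t y - X t z\<bar> \<le> 1 / s * \<bar>X s y - X s z\<bar>" by (rule X_scaled_Lipschitz)
  qed
qed

end
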